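(* Let $p>1$ and let the sequences $\{q^i\}_{i\in\mathbb{N}}\subset(1,\infty)$, $\{\lambda^i\}_{i\in\mathbb{N}}\subset(0,\infty)$ satisfy $q^i\to\infty$ and $\lambda^i\to0$ as $i\to\infty$. Suppose that $\{a^i\}_{i\in\mathbb{N}}\subset\mathscr{C}$ and $\{h^i\}_{i\in\mathbb{N}}\subset L^2(0,T;\mathbb{R}^N)$ fulfill $$a^i\to a\ \text{ weakly in }W^{1,2}(0,T;\mathbb{R}^N)\text{ and strongly in }C([0,T];\mathbb{R}^N),\qquad h^i\to h\ \text{ weakly in }L^2(0,T;\mathbb{R}^N)$$ for some $a\in\mathscr{C}$ and $h\in L^2(0,T;\mathbb{R}^N)$. Moreover, assume that the sequence of initial data $\{x_0^i\}_{i\in\mathbb{N}}\subset\mathbb{R}^N$ converges to $x_0$ and satisfies $x_0^i\in K_{a^i}(0)$ for every $i\in\mathbb{N}$ and $x_0\in K_a(0)$. Then the solution $x^i$ of $({\rm P}^{q,\lambda})$ with $(q,\lambda,a,h,x_0)=(q^i,\lambda^i,a^i,h^i,x_0^i)$ converges to the solution $x$ of $({\rm P})$ with the data $(a,h,x_0)$ in the following sense: $$x^i\to x\ \text{ weakly in }W^{1,2}(0,T;\mathbb{R}^N)\text{ and strongly in }C([0,T];\mathbb{R}^N).$$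
   Context: Weighted hypergraph: $G=(V,E,w)$ with $V=\{1,\dots,N\}$, $E\subset 2^V$ a family of subsets with $\#e\ge 2$ for every $e\in E$, and $w:E\to(0,\infty)$. Here $N=n+m$, $0<T<\infty$, and $\|\cdot\|$ is the Euclidean norm of $\mathbb{R}^N$. For $x\in\mathbb{R}^N$, $f_e(x)=\max_{i,j\in e}|x_i-x_j|$ and $\varphi_{G,p}(x)=\frac1p\sum_{e\in E}w(e)(f_e(x))^p$. For $q\ge1$, $f_{e,q}(x)=\big(\frac12\sum_{i,j\in e}|x_i-x_j|^q\big)^{1/q}$ and $\varphi_{G,p,q}(x)=\frac1p\sum_{e\in E}w(e)(f_{e,q}(x))^p$; for $p,q>1$ the convex function $\varphi_{G,p,q}$ is $C^1$ with derivative (gradient) $D\varphi_{G,p,q}$. For a proper lower semicontinuous convex $\phi:\mathbb{R}^N\to(-\infty,+\infty]$, $\partial\phi(x)=\{\eta\in\mathbb{R}^N:\ \eta\cdot(z-x)\le\phi(z)-\phi(x)\ \forall z\in\mathbb{R}^N\}$. $\mathscr{C}=\{a\in W^{1,2}(0,T;\mathbb{R}^N):\ a(\cdot)=(0,\dots,0,a_1(\cdot),\dots,a_m(\cdot))\}$ (first $n$ components vanish). For $a\in\mathscr{C}$, $t\in[0,T]$, $K_a(t)=\{x\in\mathbb{R}^N:\ x_{n+j}=a_j(t),\ j=1,\dots,m\}$, with indicator function $I_{K_a(t)}$ ($0$ on $K_a(t)$, $+\infty$ elsewhere). $H:\mathbb{R}^N\to\mathbb{R}^N$ is the linear map $Hz=(0,\dots,0,z_{n+1},\dots,z_{n+m})$.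 Problem $({\rm P})$ with data $a\in\mathscr{C}$, $h\in L^2(0,T;\mathbb{R}^N)$, $x_0\in K_a(0)$: $$x'(t)+\partial\varphi_{G,p}(x(t))+\partial I_{K_a(t)}(x(t))\ni h(t)\ \ (\text{a.e. }t\in(0,T)),\qquad x(0)=x_0 .$$ It is known that it has a unique solution $x\in W^{1,2}(0,T;\mathbb{R}^N)$ with $x(t)\in K_a(t)$ for every $t\in[0,T]$. Problem $({\rm P}^{q,\lambda})$, for $q>1$, $\lambda>0$: $$x'(t)+D\varphi_{G,p,q}(x(t))+\frac1\lambda(Hx(t)-a(t))=h(t)\ \ (\text{a.e. }t\in(0,T)),\qquad x(0)=x_0 ,$$ which has a unique solution in $W^{1,2}(0,T;\mathbb{R}^N)$ for every $x_0\in\mathbb{R}^N$, $a\in\mathscr{C}$, $h\in L^2(0,T;\mathbb{R}^N)$. *)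

theory Defs
  imports "HOL-Analysis.Analysis"
begin

text \<open>
  The vertex set is the finite type \<open>'v\<close>, so that \<open>\<real>\<^sup>N\<close> is \<^typ>\<open>real ^ 'v\<close>. The numbering
  \<open>1, \<dots>, n, n + 1, \<dots>, n + m\<close> only serves to single out the last \<open>m\<close> vertices; these
  are given here as a set \<open>B\<close> of vertices, so \<open>m = card B\<close> and \<open>n = card (- B)\<close>.
\<close>

definition weighted_hypergraph :: "'v::finite set set \<Rightarrow> ('v set \<Rightarrow> real) \<Rightarrow> bool" where
  "weighted_hypergraph E w \<longleftrightarrow> (\<forall>e\<in>E. 2 \<le> card e \<and> 0 < w e)"

definition edge_max :: "'v::finite set \<Rightarrow> real ^ 'v \<Rightarrow> real" where
  "edge_max e x = Max {\<bar>x $ i - x $ j\<bar> | i j. i \<in> e \<and> j \<in> e}"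

definition energy :: "'v::finite set set \<Rightarrow> ('v set \<Rightarrow> real) \<Rightarrow> real \<Rightarrow> real ^ 'v \<Rightarrow> real" where
  "energy E w p x = (1 / p) * (\<Sum>e\<in>E. w e * edge_max e x powr p)"

definition edge_norm :: "real \<Rightarrow> 'v::finite set \<Rightarrow> real ^ 'v \<Rightarrow> real" where
  "edge_norm q e x = ((1 / 2) * (\<Sum>i\<in>e. \<Sum>j\<in>e. \<bar>x $ i - x $ j\<bar> powr q)) powr (1 / q)"

definition energy_q ::
    "'v::finite set set \<Rightarrow> ('v set \<Rightarrow> real) \<Rightarrow> real \<Rightarrow> real \<Rightarrow> real ^ 'v \<Rightarrow> real" where
  "energy_q E w p q x = (1 / p) * (\<Sum>e\<in>E. w e * edge_norm q e x powr p)"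

text \<open>
  For proper \<open>\<phi>\<close> the subdifferential is empty at points where \<open>\<phi> x = \<infinity>\<close>: choosing
  \<open>z\<close> with \<open>\<phi> z\<close> finite makes the right-hand side \<open>-\<infinity>\<close>. The convention
  \<open>\<infinity> - \<infinity> = \<infinity>\<close> of \<^typ>\<open>ereal\<close> is therefore harmless.
\<close>

definition subdifferential :: "('a::real_inner \<Rightarrow> ereal) \<Rightarrow> 'a \<Rightarrow> 'a set" where
  "subdifferential \<phi> x = {\<eta>. \<forall>z. ereal (\<eta> \<bullet> (z - x)) \<le> \<phi> z - \<phi> x}"

definition convex_indicator :: "'a set \<Rightarrow> 'a \<Rightarrow> ereal" where
  "convex_indicator K x = (if x \<in> K then 0 else \<infinity>)"

definition L2 :: "real \<Rightarrow> (real \<Rightarrow> 'a::euclidean_space) set" where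
  "L2 T = {v. v \<in> borel_measurable (lebesgue_on {0<..<T}) \<and>
              integrable (lebesgue_on {0<..<T}) (\<lambda>t. (norm (v t))\<^sup>2)}"

definition inner_L2 :: "real \<Rightarrow> (real \<Rightarrow> 'a::euclidean_space) \<Rightarrow> (real \<Rightarrow> 'a) \<Rightarrow> real" where
  "inner_L2 T u v = (\<integral>t. u t \<bullet> v t \<partial>lebesgue_on {0<..<T})"

definition test_functions :: "real \<Rightarrow> (real \<Rightarrow> real) set" where
  "test_functions T = {\<psi>. \<psi> C1_differentiable_on UNIV \<and>
     (\<exists>K. compact K \<and> K \<subseteq> {0<..<T} \<and> (\<forall>t. t \<notin> K \<longrightarrow> \<psi> t = 0))}"

definition has_weak_deriv ::
    "real \<Rightarrow> (real \<Rightarrow> 'a::euclidean_space) \<Rightarrow> (real \<Rightarrow> 'a) \<Rightarrow> bool" where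
  "has_weak_deriv T u v \<longleftrightarrow> (\<forall>\<psi>\<in>test_functions T.
     (\<integral>t. deriv \<psi> t *\<^sub>R u t \<partial>lebesgue_on {0<..<T}) =
     - (\<integral>t. \<psi> t *\<^sub>R v t \<partial>lebesgue_on {0<..<T}))"

text \<open>
  Members of \<open>W\<^sup>1\<^sup>,\<^sup>2\<close> are represented by their representative that is continuous on
  \<open>[0,T]\<close>, so that point values such as \<open>u 0\<close> make sense. Values outside \<open>[0,T]\<close> are
  irrelevant.
\<close>

definition W12 :: "real \<Rightarrow> (real \<Rightarrow> 'a::euclidean_space) set" where
  "W12 T = {u. continuous_on {0..T} u \<and> u \<in> L2 T \<and> (\<exists>v\<in>L2 T. has_weak_deriv T u v)}"

text \<open>The weak derivative is unique up to null sets, and is only used up to null sets below.\<close>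

definition weak_deriv :: "real \<Rightarrow> (real \<Rightarrow> 'a::euclidean_space) \<Rightarrow> real \<Rightarrow> 'a" where
  "weak_deriv T u = (SOME v. v \<in> L2 T \<and> has_weak_deriv T u v)"

definition inner_W12 :: "real \<Rightarrow> (real \<Rightarrow> 'a::euclidean_space) \<Rightarrow> (real \<Rightarrow> 'a) \<Rightarrow> real" where
  "inner_W12 T u v = inner_L2 T u v + inner_L2 T (weak_deriv T u) (weak_deriv T v)"

text \<open>Both spaces are Hilbert spaces, so weak convergence is tested with inner products.\<close>

definition weakly_L2 ::
    "real \<Rightarrow> (nat \<Rightarrow> real \<Rightarrow> 'a::euclidean_space) \<Rightarrow> (real \<Rightarrow> 'a) \<Rightarrow> bool" where
  "weakly_L2 T u v \<longleftrightarrow> (\<forall>i. u i \<in> L2 T) \<and> v \<in> L2 T \<and>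
     (\<forall>z\<in>L2 T. (\<lambda>i. inner_L2 T (u i) z) \<longlonglongrightarrow> inner_L2 T v z)"

definition weakly_W12 ::
    "real \<Rightarrow> (nat \<Rightarrow> real \<Rightarrow> 'a::euclidean_space) \<Rightarrow> (real \<Rightarrow> 'a) \<Rightarrow> bool" where
  "weakly_W12 T u v \<longleftrightarrow> (\<forall>i. u i \<in> W12 T) \<and> v \<in> W12 T \<and>
     (\<forall>z\<in>W12 T. (\<lambda>i. inner_W12 T (u i) z) \<longlonglongrightarrow> inner_W12 T v z)"

definition boundary_data :: "real \<Rightarrow> 'v::finite set \<Rightarrow> (real \<Rightarrow> real ^ 'v) set" where
  "boundary_data T B = {a \<in> W12 T. \<forall>t\<in>{0..T}. \<forall>i. i \<notin> B \<longrightarrow> a t $ i = 0}"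

definition constraint_set ::
    "'v::finite set \<Rightarrow> (real \<Rightarrow> real ^ 'v) \<Rightarrow> real \<Rightarrow> (real ^ 'v) set" where
  "constraint_set B a t = {x. \<forall>j\<in>B. x $ j = a t $ j}"

definition boundary_part :: "'v::finite set \<Rightarrow> real ^ 'v \<Rightarrow> real ^ 'v" where
  "boundary_part B z = (\<chi> i. if i \<in> B then z $ i else 0)"

definition solves_P ::
    "'v::finite set set \<Rightarrow> ('v set \<Rightarrow> real) \<Rightarrow> 'v set \<Rightarrow> real \<Rightarrow> real \<Rightarrow>
     (real \<Rightarrow> real ^ 'v) \<Rightarrow> (real \<Rightarrow> real ^ 'v) \<Rightarrow> real ^ 'v \<Rightarrow> (real \<Rightarrow> real ^ 'v) \<Rightarrow> bool" where
  "solves_P E w B T p a h x0 x \<longleftrightarrow>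
     x \<in> W12 T \<and> (\<forall>t\<in>{0..T}. x t \<in> constraint_set B a t) \<and> x 0 = x0 \<and>
     (AE t in lebesgue_on {0<..<T}.
        \<exists>\<xi>\<in>subdifferential (\<lambda>y. ereal (energy E w p y)) (x t).
        \<exists>\<eta>\<in>subdifferential (convex_indicator (constraint_set B a t)) (x t).
          weak_deriv T x t + \<xi> + \<eta> = h t)"

definition solves_Pq ::
    "'v::finite set set \<Rightarrow> ('v set \<Rightarrow> real) \<Rightarrow> 'v set \<Rightarrow> real \<Rightarrow> real \<Rightarrow> real \<Rightarrow> real \<Rightarrow>
     (real \<Rightarrow> real ^ 'v) \<Rightarrow> (real \<Rightarrow> real ^ 'v) \<Rightarrow> real ^ 'v \<Rightarrow> (real \<Rightarrow> real ^ 'v) \<Rightarrow> bool" where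
  "solves_Pq E w B T p q l a h x0 x \<longleftrightarrow>
     x \<in> W12 T \<and> x 0 = x0 \<and>
     (AE t in lebesgue_on {0<..<T}.
        \<exists>D. (GDERIV (energy_q E w p q) (x t) :> D) \<and>
          weak_deriv T x t + D + (1 / l) *\<^sub>R (boundary_part B (x t) - a t) = h t)"

end

theory Submission
  imports Defs
begin

text \<open>
  Write \<open>u\<close> for the solution of the approximate problem with parameters \<open>q\<close>, \<open>\<lambda>\<close> and data \<open>b\<close>, \<open>k\<close> (boundary
  values and force), and \<open>x\<close> for the solution of the limit problem with data \<open>a\<close>, \<open>h\<close>. As \<open>x\<close> is
  given, \<open>u - x\<close> can be estimated directly, by an error that tends to \<open>0\<close>.

  The approximate energies are convex, and with \<open>N\<close> the number of vertices they satisfy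
  \<open>\<phi> \<le> \<phi>\<^sub>q \<le> N\<^bsup>2p/q\<^esup> \<phi>\<close>, where the factor tends to \<open>1\<close> (\<open>energy_le_energy_q\<close>,
  \<open>energy_q_le_energy\<close>). Hence gradients \<open>G\<close> of \<open>\<phi>\<^sub>q\<close> at \<open>u\<close> and subgradients \<open>\<xi>\<close> of \<open>\<phi>\<close> at \<open>x\<close> satisfy
  \<open>(u - x) \<bullet> (\<xi> - G) \<le> \<phi>\<^sub>q(x) - \<phi>(x)\<close>, which is uniformly small. With the penalty \<open>\<kappa> = (Hu - b) / \<lambda>\<close> and
  the multiplier \<open>\<eta>\<close> of the constraint, \<open>(u - x) \<bullet> (\<eta> - \<kappa>) = (\<lambda>\<kappa> + b - a) \<bullet> (\<eta> - \<kappa>)\<close>, which is at most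
  \<open>\<lambda>\<bar>\<eta>\<bar>\<^sup>2 / 4 + \<bar>b - a\<bar> (\<bar>\<eta>\<bar> + \<bar>\<kappa>\<bar>)\<close>. The forces \<open>k\<close> converge only weakly, but the primitive \<open>K\<close> of \<open>k - h\<close>
  converges to \<open>0\<close> uniformly (\<open>weakly_null_primitives_uniform\<close>), so \<open>u - x - K\<close> is estimated in place of
  \<open>u - x\<close> (\<open>solves_P_comparison\<close>).

  This needs \<open>u'\<close> and \<open>\<kappa>\<close> to be bounded in \<open>L\<^sup>2\<close>. Testing the approximate equation with \<open>u - b\<close> bounds \<open>u\<close>
  uniformly (\<open>solves_Pq_sup_bound\<close>), hence also the gradients; testing with \<open>u'\<close> then bounds \<open>u'\<close>
  (\<open>solves_Pq_derivative_bound\<close>). The second test uses \<open>\<phi>\<^sub>q(u(T)) - \<phi>\<^sub>q(u(0)) \<le> \<integral> G \<bullet> u'\<close>, which is proved for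
  convex functions and bounded measurable selections of subgradients by integrating
  backward difference quotients (\<open>subgradient_chain_inequality\<close>); its quadratic case serves all energy
  estimates. That the data \<open>b'\<close> and \<open>k\<close> are bounded in \<open>L\<^sup>2\<close> follows from their weak convergence
  by the uniform boundedness principle (\<open>uniform_boundedness_l2\<close>).

  Finally, uniform convergence together with bounded derivatives implies weak convergence in
  \<open>W\<^sup>1\<^sup>,\<^sup>2\<close>, because derivatives can be tested on polynomials (\<open>weakly_W12_I\<close>).
\<close>

section \<open>Square-integrable functions\<close>

definition sq_integrable :: "'b measure \<Rightarrow> ('b \<Rightarrow> 'a::euclidean_space) \<Rightarrow> bool" where
  "sq_integrable M v \<longleftrightarrow> v \<in> borel_measurable M \<and> integrable M (\<lambda>t. (norm (v t))\<^sup>2)"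

definition l2norm :: "'b measure \<Rightarrow> ('b \<Rightarrow> 'a::euclidean_space) \<Rightarrow> real" where
  "l2norm M v = sqrt (\<integral>t. (norm (v t))\<^sup>2 \<partial>M)"

lemma L2_iff: "v \<in> L2 T \<longleftrightarrow> sq_integrable (lebesgue_on {0<..<T}) v"
  by (simp add: L2_def sq_integrable_def)

lemma sq_integrable_measurable: "sq_integrable M v \<Longrightarrow> v \<in> borel_measurable M"
  by (simp add: sq_integrable_def)

lemma l2norm_nonneg: "0 \<le> l2norm M v"
  by (simp add: l2norm_def)

lemma l2norm_power2: "(l2norm M v)\<^sup>2 = (\<integral>t. (norm (v t))\<^sup>2 \<partial>M)"
  by (simp add: l2norm_def)

lemma l2norm_inner: "(\<integral>t. v t \<bullet> v t \<partial>M) = (l2norm M v)\<^sup>2"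
  by (simp add: l2norm_power2 dot_square_norm)

lemma sq_integrable_norm_mult:
  fixes u :: "'b \<Rightarrow> 'a::euclidean_space" and v :: "'b \<Rightarrow> 'c::euclidean_space"
  assumes "sq_integrable M u" "sq_integrable M v"
  shows "integrable M (\<lambda>t. norm (u t) * norm (v t))"
proof (rule Bochner_Integration.integrable_bound)
  show "integrable M (\<lambda>t. (norm (u t))\<^sup>2 + (norm (v t))\<^sup>2)"
    using assms by (auto simp: sq_integrable_def)
  show "(\<lambda>t. norm (u t) * norm (v t)) \<in> borel_measurable M"
    using assms by (auto simp: sq_integrable_def)
  have "x * y \<le> x\<^sup>2 + y\<^sup>2" for x y :: real
    using sum_squares_bound[of x y] zero_le_power2[of x] zero_le_power2[of y] by linarith
  then show "AE t in M. norm (norm (u t) * norm (v t)) \<le> norm ((norm (u t))\<^sup>2 + (norm (v t))\<^sup>2)"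
    by simp
qed

lemma sq_integrable_inner:
  assumes "sq_integrable M u" "sq_integrable M v"
  shows "integrable M (\<lambda>t. u t \<bullet> v t)"
proof (rule Bochner_Integration.integrable_bound[OF sq_integrable_norm_mult[OF assms]])
  show "(\<lambda>t. u t \<bullet> v t) \<in> borel_measurable M"
    using assms by (auto simp: sq_integrable_def)
qed (simp add: Cauchy_Schwarz_ineq2)

lemma sq_integrable_norm:
  "sq_integrable M v \<Longrightarrow> sq_integrable M (\<lambda>t. norm (v t))"
  by (auto simp: sq_integrable_def)

lemma sq_integrable_scaleR:
  "sq_integrable M v \<Longrightarrow> sq_integrable M (\<lambda>t. c *\<^sub>R v t)"
  by (auto simp: sq_integrable_def power_mult_distrib)

lemma l2norm_scaleR: "l2norm M (\<lambda>t. c *\<^sub>R v t) = \<bar>c\<bar> * l2norm M v"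
  by (simp add: l2norm_def power_mult_distrib real_sqrt_mult)

lemma sq_integrable_add:
  assumes "sq_integrable M u" "sq_integrable M v"
  shows "sq_integrable M (\<lambda>t. u t + v t)"
proof -
  have "integrable M (\<lambda>t. (norm (u t))\<^sup>2 + (norm (v t))\<^sup>2 + 2 * (u t \<bullet> v t))"
    using assms sq_integrable_inner[OF assms] by (auto simp: sq_integrable_def)
  moreover have "(norm (u t + v t))\<^sup>2 = (norm (u t))\<^sup>2 + (norm (v t))\<^sup>2 + 2 * (u t \<bullet> v t)" for t
    by (simp add: power2_norm_eq_inner algebra_simps inner_commute)
  ultimately show ?thesis
    using assms by (auto simp: sq_integrable_def)
qed

lemma sq_integrable_minus:
  "sq_integrable M v \<Longrightarrow> sq_integrable M (\<lambda>t. - v t)"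
  by (auto simp: sq_integrable_def)

lemma sq_integrable_diff:
  assumes "sq_integrable M u" "sq_integrable M v"
  shows "sq_integrable M (\<lambda>t. u t - v t)"
  using sq_integrable_add[OF assms(1) sq_integrable_minus[OF assms(2)]] by simp

lemma sq_integrable_zero: "sq_integrable M (\<lambda>t. 0)"
  by (simp add: sq_integrable_def)

lemma sq_integrable_bounded_by:
  fixes u :: "'b \<Rightarrow> 'a::euclidean_space" and v :: "'b \<Rightarrow> 'c::euclidean_space"
  assumes "u \<in> borel_measurable M" "sq_integrable M v" "AE t in M. norm (u t) \<le> norm (v t)"
  shows "sq_integrable M u"
  unfolding sq_integrable_def
proof
  show "integrable M (\<lambda>t. (norm (u t))\<^sup>2)"
  proof (rule Bochner_Integration.integrable_bound)
    show "integrable M (\<lambda>t. (norm (v t))\<^sup>2)"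
      using assms by (simp add: sq_integrable_def)
    show "AE t in M. norm ((norm (u t))\<^sup>2) \<le> norm ((norm (v t))\<^sup>2)"
      using assms(3) by eventually_elim (simp add: power_mono)
  qed (use assms in auto)
qed (use assms in auto)

lemma sq_integrable_bounded_linear:
  assumes "bounded_linear f" "sq_integrable M v"
  shows "sq_integrable M (\<lambda>t. f (v t))"
proof -
  obtain K where K: "\<And>x. norm (f x) \<le> norm x * K" "K > 0"
    using bounded_linear.pos_bounded[OF assms(1)] by blast
  show ?thesis
  proof (rule sq_integrable_bounded_by)
    show "(\<lambda>t. f (v t)) \<in> borel_measurable M"
      using assms by (intro borel_measurable_continuous_on[of f])
        (auto simp: sq_integrable_def linear_continuous_on)
    show "sq_integrable M (\<lambda>t. K *\<^sub>R v t)"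
      by (rule sq_integrable_scaleR[OF assms(2)])
    show "AE t in M. norm (f (v t)) \<le> norm (K *\<^sub>R v t)"
      using K by (simp add: mult.commute)
  qed
qed

lemma sq_integrable_const:
  "finite_measure M \<Longrightarrow> sq_integrable M (\<lambda>t. c)"
  by (simp add: sq_integrable_def finite_measure.integrable_const)

lemma l2norm_eq_0D:
  assumes "sq_integrable M v" "l2norm M v = 0"
  shows "AE t in M. v t = 0"
proof -
  have "(\<integral>t. (norm (v t))\<^sup>2 \<partial>M) = 0"
    using assms(2) by (simp add: l2norm_def)
  then have "AE t in M. (norm (v t))\<^sup>2 = 0"
    using assms(1) integral_nonneg_eq_0_iff_AE[of M "\<lambda>t. (norm (v t))\<^sup>2"]
    by (auto simp: sq_integrable_def)
  then show ?thesis
    by simp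
qed

text \<open>Expanding \<open>0 \<le> \<integral> (\<beta>\<bar>u\<bar> - \<alpha>\<bar>v\<bar>)\<^sup>2\<close> with \<open>\<alpha>\<close> and \<open>\<beta>\<close> the two norms leaves, after
  cancelling \<open>\<alpha>\<beta>\<close>, the inequality; if one of the norms vanishes then so does the integrand.\<close>

lemma l2_Cauchy_Schwarz_norm:
  fixes u :: "'b \<Rightarrow> 'a::euclidean_space" and v :: "'b \<Rightarrow> 'c::euclidean_space"
  assumes u: "sq_integrable M u" and v: "sq_integrable M v"
  shows "(\<integral>t. norm (u t) * norm (v t) \<partial>M) \<le> l2norm M u * l2norm M v"
proof (cases "l2norm M u = 0 \<or> l2norm M v = 0")
  case True
  then have "AE t in M. norm (u t) * norm (v t) = 0"
    using l2norm_eq_0D[OF u] l2norm_eq_0D[OF v] by auto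
  then have "(\<integral>t. norm (u t) * norm (v t) \<partial>M) = 0"
    by (rule integral_eq_zero_AE)
  then show ?thesis
    by (simp add: l2norm_nonneg)
next
  case False
  define \<alpha> \<beta> where "\<alpha> = l2norm M u" and "\<beta> = l2norm M v"
  have pos: "\<alpha> > 0" "\<beta> > 0"
    using False l2norm_nonneg[of M u] l2norm_nonneg[of M v] by (auto simp: \<alpha>_def \<beta>_def)
  have "0 \<le> (\<integral>t. (\<beta> * norm (u t) - \<alpha> * norm (v t))\<^sup>2 \<partial>M)"
    by simp
  also have "\<dots> = (\<integral>t. \<beta>\<^sup>2 * (norm (u t))\<^sup>2 + \<alpha>\<^sup>2 * (norm (v t))\<^sup>2
      - 2 * \<alpha> * \<beta> * (norm (u t) * norm (v t)) \<partial>M)"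
    by (simp add: power2_eq_square algebra_simps)
  also have "\<dots> = \<beta>\<^sup>2 * \<alpha>\<^sup>2 + \<alpha>\<^sup>2 * \<beta>\<^sup>2 - 2 * \<alpha> * \<beta> * (\<integral>t. norm (u t) * norm (v t) \<partial>M)"
    using u v sq_integrable_norm_mult[OF u v]
    by (simp add: sq_integrable_def l2norm_power2 \<alpha>_def \<beta>_def)
  finally have "\<alpha> * \<beta> * (\<integral>t. norm (u t) * norm (v t) \<partial>M) \<le> \<alpha> * \<beta> * (\<alpha> * \<beta>)"
    by (simp add: power2_eq_square algebra_simps)
  then show ?thesis
    using pos by (simp add: \<alpha>_def \<beta>_def)
qed

lemma l2_Cauchy_Schwarz:
  assumes "sq_integrable M u" "sq_integrable M v"
  shows "\<bar>\<integral>t. u t \<bullet> v t \<partial>M\<bar> \<le> l2norm M u * l2norm M v"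
proof -
  have "\<bar>\<integral>t. u t \<bullet> v t \<partial>M\<bar> \<le> (\<integral>t. \<bar>u t \<bullet> v t\<bar> \<partial>M)"
    by (rule integral_abs_bound)
  also have "\<dots> \<le> (\<integral>t. norm (u t) * norm (v t) \<partial>M)"
    using sq_integrable_inner[OF assms] sq_integrable_norm_mult[OF assms]
    by (intro integral_mono) (auto simp: Cauchy_Schwarz_ineq2)
  also have "\<dots> \<le> l2norm M u * l2norm M v"
    by (rule l2_Cauchy_Schwarz_norm[OF assms])
  finally show ?thesis .
qed

lemma l2norm_triangle:
  assumes u: "sq_integrable M u" and v: "sq_integrable M v"
  shows "l2norm M (\<lambda>t. u t + v t) \<le> l2norm M u + l2norm M v"
proof (rule power2_le_imp_le)
  have "(l2norm M (\<lambda>t. u t + v t))\<^sup>2 = (\<integral>t. (norm (u t))\<^sup>2 + (norm (v t))\<^sup>2 + 2 * (u t \<bullet> v t) \<partial>M)"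
    unfolding l2norm_power2
    by (rule Bochner_Integration.integral_cong) (simp_all add: power2_norm_eq_inner algebra_simps inner_commute)
  also have "\<dots> = (l2norm M u)\<^sup>2 + (l2norm M v)\<^sup>2 + 2 * (\<integral>t. u t \<bullet> v t \<partial>M)"
    using u v sq_integrable_inner[OF u v] by (simp add: l2norm_power2 sq_integrable_def)
  also have "\<dots> \<le> (l2norm M u + l2norm M v)\<^sup>2"
    using l2_Cauchy_Schwarz[OF u v] by (simp add: power2_eq_square algebra_simps)
  finally show "(l2norm M (\<lambda>t. u t + v t))\<^sup>2 \<le> (l2norm M u + l2norm M v)\<^sup>2" .
qed (simp add: l2norm_nonneg)

lemma l2norm_triangle_diff:
  assumes u: "sq_integrable M u" and v: "sq_integrable M v"
  shows "l2norm M (\<lambda>t. u t - v t) \<le> l2norm M u + l2norm M v"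
proof -
  have "l2norm M (\<lambda>t. - v t) = l2norm M v"
    by (simp add: l2norm_def)
  then show ?thesis
    using l2norm_triangle[OF u sq_integrable_minus[OF v]] by simp
qed

lemma l2norm_mono:
  fixes u :: "'b \<Rightarrow> 'a::euclidean_space" and v :: "'b \<Rightarrow> 'c::euclidean_space"
  assumes "sq_integrable M u" "sq_integrable M v" "AE t in M. norm (u t) \<le> norm (v t)"
  shows "l2norm M u \<le> l2norm M v"
  unfolding l2norm_def
proof (intro real_sqrt_le_mono integral_mono_AE)
  show "AE t in M. (norm (u t))\<^sup>2 \<le> (norm (v t))\<^sup>2"
    using assms(3) by eventually_elim (simp add: power_mono)
qed (use assms in \<open>auto simp: sq_integrable_def\<close>)

lemma l2norm_dominated_convergence:
  fixes f :: "nat \<Rightarrow> 'b \<Rightarrow> 'a::euclidean_space" and g :: "'b \<Rightarrow> 'c::euclidean_space"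
  assumes f: "\<And>n. f n \<in> borel_measurable M" and g: "sq_integrable M g"
    and le: "\<And>n. AE t in M. norm (f n t) \<le> norm (g t)" and lim: "AE t in M. (\<lambda>n. f n t) \<longlonglongrightarrow> 0"
  shows "(\<lambda>n. l2norm M (f n)) \<longlonglongrightarrow> 0"
proof -
  have "(\<lambda>n. \<integral>t. (norm (f n t))\<^sup>2 \<partial>M) \<longlonglongrightarrow> (\<integral>t. 0 \<partial>M)"
  proof (rule integral_dominated_convergence[where w = "\<lambda>t. (norm (g t))\<^sup>2"])
    show "integrable M (\<lambda>t. (norm (g t))\<^sup>2)"
      using g by (simp add: sq_integrable_def)
    show "AE t in M. norm ((norm (f n t))\<^sup>2) \<le> (norm (g t))\<^sup>2" for n
      using le[of n] by eventually_elim (simp add: power_mono)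
    show "AE t in M. (\<lambda>n. (norm (f n t))\<^sup>2) \<longlonglongrightarrow> 0"
      using lim
    proof eventually_elim
      case (elim t)
      from tendsto_power[OF tendsto_norm[OF elim], of 2] show ?case by simp
    qed
  qed (use f in auto)
  then show ?thesis
    unfolding l2norm_def by (auto dest: tendsto_real_sqrt)
qed

section \<open>Uniform boundedness in \<open>L\<^sup>2\<close>\<close>

text \<open>The argument uses that for every vector \<open>s\<close> one of \<open>s \<pm> r e\<close> pairs with a functional at least as well as
  \<open>\<plusminus> r e\<close> alone. Choosing signs in this way, the sum of the \<open>\<plusminus> 3\<^sup>-\<^sup>k e\<^sub>k\<close>, with \<open>e\<^sub>k\<close> the
  normalisation of a member of norm at least \<open>(k + 1) 3\<^sup>k\<close>, is a vector on which the pairings are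
  unbounded: the tail after stage \<open>k\<close> is at most half of the \<open>k\<close>-th step.\<close>

theorem uniform_boundedness_l2:
  fixes g :: "nat \<Rightarrow> 'b \<Rightarrow> 'a::euclidean_space"
  assumes M: "finite_measure M" and g: "\<And>i. sq_integrable M (g i)"
    and bdd: "\<And>z. sq_integrable M z \<Longrightarrow> bounded (range (\<lambda>i. \<integral>t. g i t \<bullet> z t \<partial>M))"
  obtains C where "\<And>i. l2norm M (g i) \<le> C"
proof -
  interpret finite_measure M by (rule M)
  have "\<exists>C. \<forall>i. l2norm M (g i) \<le> C"
  proof (rule ccontr)
    assume "\<not> ?thesis"
    then have "\<forall>k::nat. \<exists>i. (real k + 1) * 3 ^ k < l2norm M (g i)"
      by (metis not_le)
    then obtain n where n: "\<And>k. (real k + 1) * 3 ^ k < l2norm M (g (n k))"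
      by metis
    define G where "G k = g (n k)" for k
    define e where "e k t = (1 / l2norm M (G k)) *\<^sub>R G k t" for k t
    have Gpos: "0 < l2norm M (G k)" for k
    proof -
      have "0 \<le> (real k + 1) * 3 ^ k" by simp
      then show ?thesis using n[of k] unfolding G_def by linarith
    qed
    have G: "sq_integrable M (G k)" for k
      by (simp add: G_def g)
    have e: "sq_integrable M (e k)" for k
      unfolding e_def by (rule sq_integrable_scaleR[OF G])
    have e1: "l2norm M (e k) = 1" for k
      using Gpos[of k] unfolding e_def l2norm_scaleR by simp
    have e_meas[measurable]: "e k \<in> borel_measurable M" and G_meas[measurable]: "G k \<in> borel_measurable M" for k
      using e[of k] G[of k] by (auto simp: sq_integrable_def)
    define ip where "ip u v = (\<integral>t. u t \<bullet> v t \<partial>M)" for u v :: "'b \<Rightarrow> 'a"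
    have ipGe: "ip (G k) (e k) = l2norm M (G k)" for k
    proof -
      have "ip (G k) (e k) = (1 / l2norm M (G k)) * (l2norm M (G k))\<^sup>2"
        unfolding ip_def e_def using l2norm_inner[where v="G k" and M=M] by simp
      then show ?thesis using Gpos[of k] by (simp add: power2_eq_square)
    qed
    \<comment> \<open>The sign of the next term is that of the pairing with the partial sum \<open>s\<close> reached so far, so
      that the two contributions do not cancel.\<close>
    define step where "step s k = (if 0 \<le> ip (G k) s then 1 else -1::real)" for s k
    define s where "s = rec_nat (\<lambda>t. 0) (\<lambda>k s t. s t + (step s k / 3 ^ k) *\<^sub>R e k t)"
    have s0: "s 0 = (\<lambda>t. 0)" and sS: "s (Suc k) = (\<lambda>t. s k t + (step (s k) k / 3 ^ k) *\<^sub>R e k t)" for k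
      by (simp_all add: s_def)
    define c where "c k = step (s k) k / 3 ^ k" for k
    have c_abs: "\<bar>c k\<bar> = 1 / 3 ^ k" for k
      by (simp add: c_def step_def)
    have s: "sq_integrable M (s k)" for k
      by (induction k) (auto simp: s0 sS sq_integrable_zero intro!: sq_integrable_add sq_integrable_scaleR e)
    have s_sum: "s k t = (\<Sum>j<k. c j *\<^sub>R e j t)" for k t
      by (induction k) (simp_all add: s0 sS c_def)
    have ip_step: "1 / 3 ^ k * l2norm M (G k) \<le> \<bar>ip (G k) (s (Suc k))\<bar>" for k
    proof -
      have "ip (G k) (s (Suc k)) = ip (G k) (s k) + c k * ip (G k) (e k)"
        unfolding ip_def sS c_def inner_add_right inner_scaleR_right
        using sq_integrable_inner[OF G s] sq_integrable_inner[OF G e]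
        by (subst Bochner_Integration.integral_add) auto
      then show ?thesis
        unfolding ipGe using Gpos[of k] unfolding c_def step_def by (auto simp: abs_if)
    qed
    have geo: "summable (\<lambda>k. 1 / 3 ^ k :: real)"
      using summable_geometric[of "1/3 :: real"] by (simp add: power_divide)
    have norm_e_int: "integrable M (\<lambda>t. norm (e k t))" and norm_e_le: "(\<integral>t. norm (e k t) \<partial>M) \<le> l2norm M (\<lambda>t. 1::real)" for k
    proof -
      have one: "sq_integrable M (\<lambda>t. 1::real)"
        by (rule sq_integrable_const[OF M])
      show "integrable M (\<lambda>t. norm (e k t))"
        using sq_integrable_norm_mult[OF e one] by simp
      show "(\<integral>t. norm (e k t) \<partial>M) \<le> l2norm M (\<lambda>t. 1::real)"
        using l2_Cauchy_Schwarz_norm[OF e one, of k] e1[of k] by simp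
    qed
    \<comment> \<open>The series converges absolutely in \<open>L\<^sup>1\<close>, hence almost everywhere.\<close>
    have ae: "AE t in M. summable (\<lambda>k. norm (c k *\<^sub>R e k t))"
    proof -
      have "(\<integral>\<^sup>+ t. (\<Sum>k. ennreal (norm (c k *\<^sub>R e k t))) \<partial>M)
          = (\<Sum>k. (\<integral>\<^sup>+ t. ennreal (norm (c k *\<^sub>R e k t)) \<partial>M))"
        by (intro nn_integral_suminf) measurable
      also have "\<dots> = (\<Sum>k. ennreal (\<bar>c k\<bar> * (\<integral>t. norm (e k t) \<partial>M)))"
        using norm_e_int by (subst nn_integral_eq_integral) auto
      also have "\<dots> \<le> (\<Sum>k. ennreal (1 / 3 ^ k * l2norm M (\<lambda>t. 1::real)))"
        by (intro suminf_le) (auto intro!: ennreal_leI divide_right_mono norm_e_le simp: c_abs)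
      also have "\<dots> < \<infinity>"
        using summable_mult[OF geo, of "l2norm M (\<lambda>t. 1::real)"] l2norm_nonneg[of M "\<lambda>t. 1::real"]
          by (subst suminf_ennreal2) auto
      finally have "AE t in M. (\<Sum>k. ennreal (norm (c k *\<^sub>R e k t))) \<noteq> \<infinity>"
        by (intro nn_integral_PInf_AE) auto
      then show ?thesis
        by eventually_elim (auto intro!: summable_suminf_not_top)
    qed
    define z where "z t = (\<Sum>k. c k *\<^sub>R e k t)" for t
    have ae_lim: "AE t in M. (\<lambda>k. s k t) \<longlonglongrightarrow> z t"
      using ae
    proof eventually_elim
      case (elim t)
      show ?case
        unfolding s_sum z_def using summable_LIMSEQ[OF summable_norm_cancel[OF elim]] .
    qed
    have z_meas: "z \<in> borel_measurable M"
      unfolding z_def by measurable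
    have s_norm: "l2norm M (s k) \<le> (\<Sum>j<k. 1 / 3 ^ j)" for k
    proof (induction k)
      case (Suc k)
      have "l2norm M (s (Suc k)) \<le> l2norm M (s k) + l2norm M (\<lambda>t. c k *\<^sub>R e k t)"
        using l2norm_triangle[OF s[of k] sq_integrable_scaleR[OF e[of k], of "c k"]]
        unfolding sS c_def .
      then show ?case
        using Suc by (simp add: l2norm_scaleR e1 c_abs)
    qed (simp add: s0 l2norm_def)
    have s_norm2: "l2norm M (s k) \<le> 2" for k
    proof -
      have "(\<Sum>j<k. 1 / 3 ^ j :: real) \<le> (\<Sum>j. 1 / 3 ^ j)"
        using geo by (intro sum_le_suminf) auto
      also have "\<dots> \<le> 2"
        using suminf_geometric[of "1/3 :: real"] by (simp add: power_divide)
      finally show ?thesis using s_norm[of k] by linarith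
    qed
    have z: "sq_integrable M z"
      unfolding sq_integrable_def
    proof
      show "integrable M (\<lambda>t. (norm (z t))\<^sup>2)"
      proof (rule integrableI_bounded)
        have "(\<integral>\<^sup>+ t. ennreal (norm ((norm (z t))\<^sup>2)) \<partial>M)
            \<le> (\<integral>\<^sup>+ t. liminf (\<lambda>k. ennreal ((norm (s k t))\<^sup>2)) \<partial>M)"
        proof (rule nn_integral_mono_AE)
          show "AE t in M. ennreal (norm ((norm (z t))\<^sup>2)) \<le> liminf (\<lambda>k. ennreal ((norm (s k t))\<^sup>2))"
            using ae_lim
          proof eventually_elim
            case (elim t)
            have "(\<lambda>k. ennreal ((norm (s k t))\<^sup>2)) \<longlonglongrightarrow> ennreal ((norm (z t))\<^sup>2)"
              using elim by (intro tendsto_intros)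
            from lim_imp_Liminf[OF _ this] show ?case by simp
          qed
        qed
        also have "\<dots> \<le> liminf (\<lambda>k. \<integral>\<^sup>+ t. ennreal ((norm (s k t))\<^sup>2) \<partial>M)"
          using s by (intro nn_integral_liminf) (auto simp: sq_integrable_def)
        also have "\<dots> = liminf (\<lambda>k. ennreal ((l2norm M (s k))\<^sup>2))"
          using s by (subst nn_integral_eq_integral) (auto simp: sq_integrable_def l2norm_power2)
        also have "\<dots> \<le> ennreal (2\<^sup>2)"
        proof -
          have "ennreal ((l2norm M (s k))\<^sup>2) \<le> ennreal (2\<^sup>2)" for k
            using s_norm2[of k] l2norm_nonneg[of M "s k"] by (intro ennreal_leI power_mono)
          then show ?thesis
            by (intro Liminf_le) (auto)
        qed
        also have "\<dots> < \<infinity>" by simp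
        finally show "(\<integral>\<^sup>+ t. ennreal (norm ((norm (z t))\<^sup>2)) \<partial>M) < \<infinity>" .
      qed (use z_meas in auto)
    qed (rule z_meas)
    \<comment> \<open>The pairing with \<open>z\<close> is computed term by term, and the tail is dominated by a geometric series.\<close>
    have tail: "\<bar>ip (G k) z - ip (G k) (s (Suc k))\<bar> \<le> l2norm M (G k) * (1 / 2 / 3 ^ k)" for k
    proof -
      have int: "integrable M (\<lambda>t. G k t \<bullet> (c j *\<^sub>R e j t))" for j
        by (intro sq_integrable_inner G sq_integrable_scaleR e)
      have bd: "(\<integral>t. norm (G k t \<bullet> (c j *\<^sub>R e j t)) \<partial>M) \<le> 1 / 3 ^ j * l2norm M (G k)" for j
      proof -
        have "(\<integral>t. norm (G k t \<bullet> (c j *\<^sub>R e j t)) \<partial>M) \<le> (\<integral>t. norm (G k t) * norm (c j *\<^sub>R e j t) \<partial>M)"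
          by (rule integral_mono) (use int in \<open>auto intro!: sq_integrable_norm_mult G sq_integrable_scaleR e
              simp del: norm_scaleR inner_scaleR_right simp: Cauchy_Schwarz_ineq2\<close>)
        also have "\<dots> \<le> l2norm M (G k) * l2norm M (\<lambda>t. c j *\<^sub>R e j t)"
          by (intro l2_Cauchy_Schwarz_norm G sq_integrable_scaleR e)
        finally show ?thesis by (simp add: l2norm_scaleR e1 c_abs)
      qed
      have sums: "(\<lambda>j. \<integral>t. G k t \<bullet> (c j *\<^sub>R e j t) \<partial>M) sums (\<integral>t. (\<Sum>j. G k t \<bullet> (c j *\<^sub>R e j t)) \<partial>M)"
      proof (rule sums_integral[OF int])
        show "AE t in M. summable (\<lambda>j. norm (G k t \<bullet> (c j *\<^sub>R e j t)))"
          using ae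
        proof eventually_elim
          case (elim t)
          show ?case
          proof (rule summable_comparison_test[OF _ summable_mult[OF elim, of "norm (G k t)"]])
            show "\<exists>N. \<forall>j\<ge>N. norm (norm (G k t \<bullet> (c j *\<^sub>R e j t))) \<le> norm (G k t) * norm (c j *\<^sub>R e j t)"
              by (simp del: norm_scaleR inner_scaleR_right add: Cauchy_Schwarz_ineq2)
          qed
        qed
        show "summable (\<lambda>j. \<integral>t. norm (G k t \<bullet> (c j *\<^sub>R e j t)) \<partial>M)"
        proof (rule summable_comparison_test[OF _ summable_mult2[OF geo, of "l2norm M (G k)"]])
          show "\<exists>N. \<forall>j\<ge>N. norm (\<integral>t. norm (G k t \<bullet> (c j *\<^sub>R e j t)) \<partial>M) \<le> 1 / 3 ^ j * l2norm M (G k)"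
            using bd by auto
        qed
      qed
      have "(\<integral>t. (\<Sum>j. G k t \<bullet> (c j *\<^sub>R e j t)) \<partial>M) = ip (G k) z"
        unfolding ip_def
      proof (rule integral_cong_AE)
        show "AE t in M. (\<Sum>j. G k t \<bullet> (c j *\<^sub>R e j t)) = G k t \<bullet> z t"
          using ae
        proof eventually_elim
          case (elim t)
          show ?case
            unfolding z_def
            by (rule bounded_linear.suminf[OF bounded_linear_inner_right summable_norm_cancel[OF elim], symmetric])
        qed
        show "(\<lambda>t. \<Sum>j. G k t \<bullet> (c j *\<^sub>R e j t)) \<in> borel_measurable M"
          by measurable
        show "(\<lambda>t. G k t \<bullet> z t) \<in> borel_measurable M"
          using G[of k] z_meas by (auto simp: sq_integrable_def)
      qed
      then have sums': "(\<lambda>j. \<integral>t. G k t \<bullet> (c j *\<^sub>R e j t) \<partial>M) sums ip (G k) z"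
        using sums by simp
      have part: "ip (G k) (s (Suc k)) = (\<Sum>j<Suc k. \<integral>t. G k t \<bullet> (c j *\<^sub>R e j t) \<partial>M)"
        unfolding ip_def s_sum inner_sum_right by (rule Bochner_Integration.integral_sum[OF int])
      have "(\<lambda>j. \<integral>t. G k t \<bullet> (c (j + Suc k) *\<^sub>R e (j + Suc k) t) \<partial>M) sums (ip (G k) z - ip (G k) (s (Suc k)))"
        unfolding part by (rule sums_split_initial_segment[OF sums'])
      moreover have "(\<lambda>j. l2norm M (G k) * (1 / 3 ^ Suc k * (1 / 3) ^ j)) sums (l2norm M (G k) * (1 / 3 ^ Suc k * (1 / (1 - 1 / 3))))"
        by (intro sums_mult geometric_sums) simp
      moreover have "norm (\<integral>t. G k t \<bullet> (c (j + Suc k) *\<^sub>R e (j + Suc k) t) \<partial>M) \<le> l2norm M (G k) * (1 / 3 ^ Suc k * (1 / 3) ^ j)" for j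
      proof -
        have "norm (\<integral>t. G k t \<bullet> (c (j + Suc k) *\<^sub>R e (j + Suc k) t) \<partial>M)
          \<le> 1 / 3 ^ (j + Suc k) * l2norm M (G k)"
          by (rule order_trans[OF integral_norm_bound bd])
        then show ?thesis by (simp add: power_add power_divide field_simps)
      qed
      ultimately have "norm (ip (G k) z - ip (G k) (s (Suc k))) \<le> l2norm M (G k) * (1 / 3 ^ Suc k * (1 / (1 - 1 / 3)))"
        by (metis (no_types, lifting) sums_unique sums_summable suminf_le norm_suminf_le)
      then show ?thesis by simp
    qed
    have big: "(real k + 1) / 2 \<le> \<bar>\<integral>t. g (n k) t \<bullet> z t \<partial>M\<bar>" for k
    proof -
      have "1 / 3 ^ k * l2norm M (G k) - l2norm M (G k) * (1 / 2 / 3 ^ k) \<le> \<bar>ip (G k) z\<bar>"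
        using ip_step[of k] tail[of k] by linarith
      moreover have "(real k + 1) / 2 \<le> 1 / 3 ^ k * l2norm M (G k) - l2norm M (G k) * (1 / 2 / 3 ^ k)"
        using n[of k] by (simp add: G_def field_simps)
      ultimately show ?thesis
        unfolding ip_def G_def by linarith
    qed
    obtain C where C: "\<And>i. \<bar>\<integral>t. g i t \<bullet> z t \<partial>M\<bar> \<le> C"
      using bdd[OF z] by (auto simp: bounded_iff)
    obtain k :: nat where "2 * C < real k"
      using reals_Archimedean2 by blast
    then show False
      using order_trans[OF big[of k] C[of "n k"]] by simp
  qed
  then show ?thesis using that by blast
qed

section \<open>Square-integrable functions on an interval\<close>

abbreviation leb :: "real \<Rightarrow> real measure" where
  "leb T \<equiv> lebesgue_on {0<..<T}"

lemma finite_measure_leb: "finite_measure (leb T)"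
  by (rule finite_measure_lebesgue_on) (simp add: bounded_set_imp_lmeasurable)

lemma integrable_lebesgue_on_subset:
  fixes f :: "'b::euclidean_space \<Rightarrow> 'a::euclidean_space"
  assumes "integrable (lebesgue_on S) f" "S' \<subseteq> S" "S \<in> sets lebesgue" "S' \<in> sets lebesgue"
  shows "integrable (lebesgue_on S') f"
  using assms set_integrable_subset[of lebesgue S f S']
  by (simp add: set_integrable_def integrable_restrict_space)

lemma sq_integrable_subset:
  fixes v :: "'b::euclidean_space \<Rightarrow> 'a::euclidean_space"
  assumes "sq_integrable (lebesgue_on S) v" "S' \<subseteq> S" "S \<in> sets lebesgue" "S' \<in> sets lebesgue"
  shows "sq_integrable (lebesgue_on S') v"
proof -
  have "v \<in> borel_measurable (lebesgue_on S')"
    by (rule measurable_restrict_mono[OF sq_integrable_measurable[OF assms(1)] assms(2)])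
  moreover have "integrable (lebesgue_on S) (\<lambda>t. (norm (v t))\<^sup>2)"
    using assms(1) by (simp add: sq_integrable_def)
  then have "integrable (lebesgue_on S') (\<lambda>t. (norm (v t))\<^sup>2)"
    by (rule integrable_lebesgue_on_subset[OF _ assms(2-4)])
  ultimately show ?thesis
    by (simp add: sq_integrable_def)
qed

lemma l2norm_subset:
  fixes v :: "'b::euclidean_space \<Rightarrow> 'a::euclidean_space"
  assumes "sq_integrable (lebesgue_on S) v" "S' \<subseteq> S" "S \<in> sets lebesgue" "S' \<in> sets lebesgue"
  shows "l2norm (lebesgue_on S') v \<le> l2norm (lebesgue_on S) v"
  unfolding l2norm_def
  by (intro real_sqrt_le_mono integral_mono_lebesgue_on_AE) (use assms in \<open>auto simp: sq_integrable_def\<close>)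

lemma AE_lebesgue_on_subset:
  assumes "AE t in lebesgue_on S. P t" "S' \<subseteq> S" "S \<in> sets lebesgue" "S' \<in> sets lebesgue"
  shows "AE t in lebesgue_on S'. P t"
  using assms by (auto simp: AE_restrict_space_iff elim!: eventually_mono)

lemma sq_integrable_leb_mono:
  "sq_integrable (leb T) v \<Longrightarrow> t \<le> T \<Longrightarrow> sq_integrable (leb t) v"
  by (rule sq_integrable_subset) auto

lemma AE_leb_mono:
  "AE \<tau> in leb T. P \<tau> \<Longrightarrow> t \<le> T \<Longrightarrow> AE \<tau> in leb t. P \<tau>"
  by (rule AE_lebesgue_on_subset) auto

lemma AE_leb_I: "(\<And>t. 0 < t \<Longrightarrow> t < T \<Longrightarrow> P t) \<Longrightarrow> AE t in leb T. P t"
  by (rule AE_I2) auto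

lemma AE_leb_interior:
  "AE t in leb T. P t \<Longrightarrow> AE t in leb T. P t \<and> 0 < t \<and> t < T"
  by (rule lebesgue_on_mono) auto

lemma l2norm_one_interval:
  "s \<le> t \<Longrightarrow> l2norm (lebesgue_on {s<..<t}) (\<lambda>_. 1::real) = sqrt (t - s)"
  by (simp add: l2norm_def measure_restrict_space)

lemma sq_integrable_imp_integrable:
  fixes v :: "real \<Rightarrow> 'a::euclidean_space"
  assumes "sq_integrable (lebesgue_on {s<..<t}) v"
  shows "integrable (lebesgue_on {s<..<t}) v"
proof -
  have "finite_measure (lebesgue_on {s<..<t})"
    by (rule finite_measure_lebesgue_on) (simp add: bounded_set_imp_lmeasurable)
  then have one: "sq_integrable (lebesgue_on {s<..<t}) (\<lambda>_. 1::real)"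
    by (rule sq_integrable_const)
  have "integrable (lebesgue_on {s<..<t}) (\<lambda>\<tau>. norm (v \<tau>))"
    using sq_integrable_norm_mult[OF assms one] by simp
  then show ?thesis
    by (rule integrable_norm_cancel) (rule sq_integrable_measurable[OF assms])
qed

lemma integral_norm_le_l2norm:
  fixes v :: "real \<Rightarrow> 'a::euclidean_space"
  assumes "sq_integrable (lebesgue_on {s<..<t}) v" "s \<le> t"
  shows "(\<integral>\<tau>. norm (v \<tau>) \<partial>lebesgue_on {s<..<t}) \<le> sqrt (t - s) * l2norm (lebesgue_on {s<..<t}) v"
proof -
  have "finite_measure (lebesgue_on {s<..<t})"
    by (rule finite_measure_lebesgue_on) (simp add: bounded_set_imp_lmeasurable)
  then have one: "sq_integrable (lebesgue_on {s<..<t}) (\<lambda>_. 1::real)"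
    by (rule sq_integrable_const)
  show ?thesis
    using l2_Cauchy_Schwarz_norm[OF assms(1) one] l2norm_one_interval[OF assms(2)] by (simp add: mult.commute)
qed

lemma integral_const_leb: "0 \<le> T \<Longrightarrow> (\<integral>t. c \<partial>leb T) = T * (c::real)"
  by (simp add: measure_restrict_space)

lemma l2norm_le_of_bound:
  assumes T: "0 \<le> T" and f: "sq_integrable (leb T) f" and C: "0 \<le> C" "AE t in leb T. norm (f t) \<le> C"
  shows "l2norm (leb T) f \<le> sqrt T * C"
proof -
  have "l2norm (leb T) f \<le> l2norm (leb T) (\<lambda>t. C)"
    using C by (intro l2norm_mono f sq_integrable_const finite_measure_leb) (auto elim: eventually_mono)
  also have "\<dots> = sqrt T * C"
    using C T by (simp add: l2norm_def measure_restrict_space real_sqrt_mult)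
  finally show ?thesis .
qed

lemma integral_norm_leb_le:
  assumes "0 \<le> T" "sq_integrable (leb T) f"
  shows "(\<integral>t. norm (f t) \<partial>leb T) \<le> sqrt T * l2norm (leb T) f"
  using integral_norm_le_l2norm[OF assms(2,1)] by simp

lemma integrable_leb_imp_integrable_on:
  fixes f :: "real \<Rightarrow> 'a::euclidean_space"
  assumes "integrable (leb T) f"
  shows "f integrable_on {0..T}"
  using integrable_on_lebesgue_on[OF assms] by (simp add: integrable_on_open_interval_real)

lemma integral_leb_eq:
  fixes f :: "real \<Rightarrow> 'a::euclidean_space"
  assumes "integrable (leb T) f" "t \<le> T"
  shows "(\<integral>\<tau>. f \<tau> \<partial>leb t) = integral {0..t} f"
proof -
  have "integrable (leb t) f"
    by (rule integrable_lebesgue_on_subset[OF assms(1)]) (use assms(2) in auto)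
  then have "(\<integral>\<tau>. f \<tau> \<partial>leb t) = integral {0<..<t} f"
    by (rule lebesgue_integral_eq_integral) auto
  then show ?thesis
    by (simp add: integral_open_interval_real)
qed

lemma continuous_on_imp_borel_leb:
  fixes f :: "real \<Rightarrow> 'a::euclidean_space"
  assumes "continuous_on {0..T} f"
  shows "f \<in> borel_measurable (leb T)"
  by (rule continuous_imp_measurable_on_sets_lebesgue)
     (use assms continuous_on_subset in \<open>auto intro: continuous_on_subset\<close>)

lemma continuous_on_imp_sq_integrable:
  fixes f :: "real \<Rightarrow> 'a::euclidean_space"
  assumes "continuous_on {0..T} f"
  shows "sq_integrable (leb T) f"
proof -
  have "bounded (f ` {0..T})"
    using assms by (intro compact_imp_bounded compact_continuous_image) auto
  then obtain K where K: "\<And>t. t \<in> {0..T} \<Longrightarrow> norm (f t) \<le> K"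
    unfolding bounded_iff by blast
  show ?thesis
  proof (rule sq_integrable_bounded_by)
    show "sq_integrable (leb T) (\<lambda>t. K)"
      by (rule sq_integrable_const[OF finite_measure_leb])
    show "AE t in leb T. norm (f t) \<le> norm K"
    proof (rule AE_leb_I)
      fix t assume "0 < t" "t < T"
      then show "norm (f t) \<le> norm K"
        using K[of t] abs_ge_self[of K] by simp
    qed
  qed (rule continuous_on_imp_borel_leb[OF assms])
qed

lemma continuous_on_imp_integrable_leb:
  fixes f :: "real \<Rightarrow> 'a::euclidean_space"
  shows "continuous_on {0..T} f \<Longrightarrow> integrable (leb T) f"
  by (intro sq_integrable_imp_integrable continuous_on_imp_sq_integrable)

text \<open>Two approximations are composed: truncating \<open>v\<close> at a high level by projecting onto a ball
  changes it little, and the same truncation applied to continuous functions converging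
  almost everywhere makes the convergence dominated.\<close>

lemma continuous_dense_l2:
  fixes v :: "real \<Rightarrow> 'a::euclidean_space"
  assumes v: "sq_integrable (leb T) v" and "0 < \<epsilon>"
  obtains c where "continuous_on UNIV c" "l2norm (leb T) (\<lambda>t. v t - c t) < \<epsilon>"
proof -
  define clip where "clip m = closest_point (cball (0::'a) (real m))" for m :: nat
  have clip_cont: "continuous_on A (clip m)" for m A
    unfolding clip_def by (rule continuous_on_closest_point) auto
  have clip_le: "norm (clip m y) \<le> real m" for m y
    using closest_point_in_set[of "cball (0::'a) (real m)" y] by (simp add: clip_def)
  have clip_id: "clip m y = y" if "norm y \<le> real m" for m y
    unfolding clip_def by (rule closest_point_self) (use that in simp)
  have clip_norm: "norm (clip m y) \<le> norm y" for m y
    using closest_point_lipschitz[of "cball (0::'a) (real m)" y 0] clip_id[of 0 m]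
    by (simp add: clip_def)
  have clip_meas: "(\<lambda>t. clip m (f t)) \<in> borel_measurable M" if "f \<in> borel_measurable M" for m f and M :: "real measure"
    by (rule borel_measurable_continuous_on[OF clip_cont that])
  have v_meas: "v \<in> borel_measurable (leb T)"
    by (rule sq_integrable_measurable[OF v])
  have vm: "sq_integrable (leb T) (\<lambda>t. clip m (v t))" for m
    by (rule sq_integrable_bounded_by[OF clip_meas[OF v_meas] v]) (simp add: clip_norm)
  have "(\<lambda>m. l2norm (leb T) (\<lambda>t. v t - clip m (v t))) \<longlonglongrightarrow> 0"
  proof (rule l2norm_dominated_convergence[OF _ sq_integrable_scaleR[OF v, of 2]])
    show "(\<lambda>t. v t - clip m (v t)) \<in> borel_measurable (leb T)" for m
      by (rule sq_integrable_measurable[OF sq_integrable_diff[OF v vm]])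
    show "AE t in leb T. norm (v t - clip m (v t)) \<le> norm (2 *\<^sub>R v t)" for m
    proof (rule AE_I2)
      show "norm (v t - clip m (v t)) \<le> norm (2 *\<^sub>R v t)" for t
        using norm_triangle_ineq4[of "v t" "clip m (v t)"] clip_norm[of m "v t"] by simp
    qed
    show "AE t in leb T. (\<lambda>m. v t - clip m (v t)) \<longlonglongrightarrow> 0"
    proof (rule AE_I2)
      fix t
      have "\<forall>\<^sub>F m in sequentially. norm (v t) \<le> real m"
        using filterlim_real_sequentially by (simp add: filterlim_at_top)
      then have "\<forall>\<^sub>F m in sequentially. v t - clip m (v t) = 0"
        by eventually_elim (simp add: clip_id)
      then show "(\<lambda>m. v t - clip m (v t)) \<longlonglongrightarrow> 0"
        by (rule tendsto_eventually)
    qed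
  qed
  then have "\<forall>\<^sub>F m in sequentially. l2norm (leb T) (\<lambda>t. v t - clip m (v t)) < \<epsilon> / 2"
    by (rule order_tendstoD) (use \<open>0 < \<epsilon>\<close> in simp)
  then obtain m where m: "l2norm (leb T) (\<lambda>t. v t - clip m (v t)) < \<epsilon> / 2"
    by (auto simp: eventually_sequentially)
  have "v measurable_on {0<..<T}"
    using v_meas by (subst measurable_on_iff_borel_measurable) auto
  then obtain N g where N: "negligible N" and g: "\<And>n. continuous_on UNIV (g n)"
    and lim: "\<And>t. t \<notin> N \<Longrightarrow> (\<lambda>n. g n t) \<longlonglongrightarrow> (if t \<in> {0<..<T} then v t else 0)"
    unfolding measurable_on_def by blast
  have c_cont: "continuous_on UNIV (\<lambda>t. clip m (g n t))" for n
    using continuous_on_compose2[OF clip_cont[of UNIV m] g[of n]] by auto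
  have c_sq: "sq_integrable (leb T) (\<lambda>t. clip m (g n t))" for n
    by (rule continuous_on_imp_sq_integrable) (use continuous_on_subset[OF c_cont[of n]] in auto)
  have "(\<lambda>n. l2norm (leb T) (\<lambda>t. clip m (v t) - clip m (g n t))) \<longlonglongrightarrow> 0"
  proof (rule l2norm_dominated_convergence[OF _ sq_integrable_const[OF finite_measure_leb, of T "2 * real m"]])
    show "(\<lambda>t. clip m (v t) - clip m (g n t)) \<in> borel_measurable (leb T)" for n
      by (rule sq_integrable_measurable[OF sq_integrable_diff[OF vm c_sq]])
    show "AE t in leb T. norm (clip m (v t) - clip m (g n t)) \<le> norm (2 * real m)" for n
    proof (rule AE_I2)
      show "norm (clip m (v t) - clip m (g n t)) \<le> norm (2 * real m)" for t
        using norm_triangle_ineq4[of "clip m (v t)" "clip m (g n t)"] clip_le[of m "v t"] clip_le[of m "g n t"]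
        by simp
    qed
    have "AE t in lebesgue. t \<notin> N"
      using N by (simp add: negligible_iff_null_sets AE_not_in)
    then have "AE t in leb T. t \<notin> N"
      by (auto simp: AE_restrict_space_iff elim!: eventually_mono)
    then have "AE t in leb T. t \<notin> N \<and> 0 < t \<and> t < T"
      by (rule AE_leb_interior)
    then show "AE t in leb T. (\<lambda>n. clip m (v t) - clip m (g n t)) \<longlonglongrightarrow> 0"
    proof eventually_elim
      case (elim t)
      then have "(\<lambda>n. g n t) \<longlonglongrightarrow> v t"
        using lim[of t] by simp
      then have "(\<lambda>n. clip m (g n t)) \<longlonglongrightarrow> clip m (v t)"
        by (rule continuous_on_tendsto_compose[OF clip_cont[of UNIV m]]) auto
      from tendsto_diff[OF tendsto_const this, of "clip m (v t)"] show ?case by simp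
    qed
  qed
  then have "\<forall>\<^sub>F n in sequentially. l2norm (leb T) (\<lambda>t. clip m (v t) - clip m (g n t)) < \<epsilon> / 2"
    by (rule order_tendstoD) (use \<open>0 < \<epsilon>\<close> in simp)
  then obtain n where n: "l2norm (leb T) (\<lambda>t. clip m (v t) - clip m (g n t)) < \<epsilon> / 2"
    by (auto simp: eventually_sequentially)
  have "l2norm (leb T) (\<lambda>t. v t - clip m (g n t)) < \<epsilon>"
    using l2norm_triangle[OF sq_integrable_diff[OF v vm[of m]] sq_integrable_diff[OF vm[of m] c_sq[of n]]] m n
    by simp
  then show ?thesis
    using that c_cont by blast
qed

section \<open>Primitives of square-integrable functions\<close>

text \<open>The fundamental theorem of calculus is taken as the definition of a derivative in \<open>L\<^sup>2\<close>. In this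
  form it passes at once to the shorter intervals \<open>[0, t]\<close>, on which the estimates at time \<open>t\<close> are made.\<close>

definition primitive :: "real \<Rightarrow> (real \<Rightarrow> 'a::euclidean_space) \<Rightarrow> (real \<Rightarrow> 'a) \<Rightarrow> bool" where
  "primitive T u v \<longleftrightarrow>
     sq_integrable (leb T) v \<and> (\<forall>t\<in>{0..T}. u t - u 0 = (\<integral>\<tau>. v \<tau> \<partial>leb t))"

lemma primitive_sq_integrable: "primitive T u v \<Longrightarrow> sq_integrable (leb T) v"
  by (simp add: primitive_def)

lemma primitive_indefinite_integral:
  "sq_integrable (leb T) v \<Longrightarrow> primitive T (\<lambda>t. c + (\<integral>\<tau>. v \<tau> \<partial>leb t)) v"
  by (simp add: primitive_def)

lemma primitive_sq_integrable_leb: "primitive T u v \<Longrightarrow> t \<le> T \<Longrightarrow> sq_integrable (leb t) v"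
  by (rule sq_integrable_leb_mono[OF primitive_sq_integrable])

lemma primitive_integrable_leb: "primitive T u v \<Longrightarrow> t \<le> T \<Longrightarrow> integrable (leb t) v"
  by (rule sq_integrable_imp_integrable[OF primitive_sq_integrable_leb])

lemma primitive_mono: "primitive T u v \<Longrightarrow> t \<le> T \<Longrightarrow> primitive t u v"
  using primitive_sq_integrable_leb[of T u v t] by (simp add: primitive_def)

lemma primitive_integral:
  assumes "primitive T u v" "t \<in> {0..T}"
  shows "u t - u 0 = integral {0..t} v"
  using assms integral_leb_eq[OF sq_integrable_imp_integrable[OF primitive_sq_integrable[OF assms(1)]], of t]
  by (auto simp: primitive_def)

lemma primitive_increment:
  assumes "primitive T u v" "0 \<le> s" "s \<le> t" "t \<le> T"
  shows "u t - u s = integral {s..t} v"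
proof -
  have "v integrable_on {0..t}"
    by (rule integrable_leb_imp_integrable_on[OF primitive_integrable_leb[OF assms(1,4)]])
  then have "integral {0..s} v + integral {s..t} v = integral {0..t} v"
    using assms by (intro Henstock_Kurzweil_Integration.integral_combine)
  then show ?thesis
    using primitive_integral[OF assms(1), of t] primitive_integral[OF assms(1), of s] assms
    by (metis (no_types, lifting) add_diff_cancel_left' atLeastAtMost_iff diff_add_cancel diff_diff_eq2 order_trans)
qed

lemma primitive_continuous:
  assumes "primitive T u v"
  shows "continuous_on {0..T} u"
proof -
  have "continuous_on {0..T} (\<lambda>t. u 0 + integral {0..t} v)"
    by (intro continuous_intros indefinite_integral_continuous_1 integrable_leb_imp_integrable_on
        sq_integrable_imp_integrable primitive_sq_integrable[OF assms])
  then show ?thesis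
    by (rule continuous_on_eq) (simp add: primitive_integral[OF assms, symmetric])
qed

lemma primitive_sq_integrable_fun: "primitive T u v \<Longrightarrow> sq_integrable (leb T) u"
  by (intro continuous_on_imp_sq_integrable primitive_continuous)

lemma primitive_increment_le:
  assumes "primitive T u v" "0 \<le> s" "s \<le> t" "t \<le> T"
  shows "norm (u t - u s) \<le> sqrt (t - s) * l2norm (leb T) v"
proof -
  have v: "sq_integrable (lebesgue_on {s<..<t}) v"
    by (rule sq_integrable_subset[OF primitive_sq_integrable[OF assms(1)]]) (use assms in auto)
  have "u t - u s = integral {s<..<t} v"
    using primitive_increment[OF assms] by (simp add: integral_open_interval_real)
  also have "\<dots> = (\<integral>\<tau>. v \<tau> \<partial>lebesgue_on {s<..<t})"
    by (rule lebesgue_integral_eq_integral[symmetric, OF sq_integrable_imp_integrable[OF v]]) auto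
  finally have "norm (u t - u s) \<le> (\<integral>\<tau>. norm (v \<tau>) \<partial>lebesgue_on {s<..<t})"
    by simp
  also have "\<dots> \<le> sqrt (t - s) * l2norm (lebesgue_on {s<..<t}) v"
    by (rule integral_norm_le_l2norm[OF v assms(3)])
  also have "\<dots> \<le> sqrt (t - s) * l2norm (leb T) v"
    by (intro mult_left_mono l2norm_subset[OF primitive_sq_integrable[OF assms(1)]]) (use assms in auto)
  finally show ?thesis .
qed

lemma primitive_add:
  assumes "primitive T u v" "primitive T u' v'"
  shows "primitive T (\<lambda>t. u t + u' t) (\<lambda>t. v t + v' t)"
  unfolding primitive_def
proof (intro conjI ballI)
  show "sq_integrable (leb T) (\<lambda>t. v t + v' t)"
    by (intro sq_integrable_add primitive_sq_integrable[OF assms(1)] primitive_sq_integrable[OF assms(2)])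
  fix t assume t: "t \<in> {0..T}"
  have "(\<integral>\<tau>. v \<tau> + v' \<tau> \<partial>leb t) = (\<integral>\<tau>. v \<tau> \<partial>leb t) + (\<integral>\<tau>. v' \<tau> \<partial>leb t)"
    by (intro Bochner_Integration.integral_add primitive_integrable_leb[OF assms(1)] primitive_integrable_leb[OF assms(2)])
      (use t in auto)
  then show "u t + u' t - (u 0 + u' 0) = (\<integral>\<tau>. v \<tau> + v' \<tau> \<partial>leb t)"
    using assms t by (simp add: primitive_def add_diff_add)
qed

lemma primitive_bounded_linear:
  assumes "bounded_linear f" "primitive T u v"
  shows "primitive T (\<lambda>t. f (u t)) (\<lambda>t. f (v t))"
  unfolding primitive_def
proof (intro conjI ballI)
  show "sq_integrable (leb T) (\<lambda>t. f (v t))"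
    by (intro sq_integrable_bounded_linear[OF assms(1)] primitive_sq_integrable[OF assms(2)])
  fix t assume t: "t \<in> {0..T}"
  have "(\<integral>\<tau>. f (v \<tau>) \<partial>leb t) = f (\<integral>\<tau>. v \<tau> \<partial>leb t)"
    by (intro integral_bounded_linear assms(1) primitive_integrable_leb[OF assms(2)]) (use t in auto)
  moreover have "u t - u 0 = (\<integral>\<tau>. v \<tau> \<partial>leb t)"
    using assms t by (simp add: primitive_def)
  ultimately show "f (u t) - f (u 0) = (\<integral>\<tau>. f (v \<tau>) \<partial>leb t)"
    using linear_diff[OF bounded_linear.linear[OF assms(1)]] by metis
qed

lemma primitive_diff:
  assumes "primitive T u v" "primitive T u' v'"
  shows "primitive T (\<lambda>t. u t - u' t) (\<lambda>t. v t - v' t)"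
  using primitive_add[OF assms(1) primitive_bounded_linear[OF bounded_linear_minus[OF bounded_linear_ident] assms(2)]]
  by simp

text \<open>For continuous \<open>v\<close> this is the classical formula. The difference of the two sides is linear in \<open>u\<close> and \<open>v\<close>,
  and approximating \<open>v\<close> while keeping \<open>u(0)\<close> changes it by at most a multiple of the \<open>L\<^sup>2\<close> norm of the
  change, so that it vanishes by density.\<close>

lemma primitive_by_parts:
  fixes u v :: "real \<Rightarrow> 'a::euclidean_space" and g g' :: "real \<Rightarrow> 'b::euclidean_space"
    and prod :: "'a \<Rightarrow> 'b \<Rightarrow> 'c::euclidean_space"
  assumes bb: "bounded_bilinear prod" and T: "0 \<le> T" and uv: "primitive T u v"
    and g: "\<And>t. t \<in> {0..T} \<Longrightarrow> (g has_vector_derivative g' t) (at t within {0..T})"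
    and g': "continuous_on {0..T} g'"
  shows "(\<integral>t. prod (v t) (g t) \<partial>leb T) + (\<integral>t. prod (u t) (g' t) \<partial>leb T)
    = prod (u T) (g T) - prod (u 0) (g 0)"
proof -
  interpret bounded_bilinear prod by (rule bb)
  obtain K where K: "\<And>a b. norm (prod a b) \<le> norm a * norm b * K" "K > 0"
    using pos_bounded by blast
  have g_cont: "continuous_on {0..T} g"
    using g by (rule continuous_on_vector_derivative)
  have prod_meas: "(\<lambda>t. prod (x t) (y t)) \<in> borel_measurable M"
    if "x \<in> borel_measurable M" "y \<in> borel_measurable M" for x y and M :: "real measure"
    by (rule borel_measurable_continuous_Pair[OF that])
       (intro bounded_bilinear.continuous_on[OF bb] continuous_intros)
  have prod_int: "integrable (leb T) (\<lambda>t. prod (x t) (y t))"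
    and prod_le: "norm (\<integral>t. prod (x t) (y t) \<partial>leb T) \<le> K * (l2norm (leb T) x * l2norm (leb T) y)"
    if x: "sq_integrable (leb T) x" and y: "sq_integrable (leb T) y" for x y
  proof -
    show int: "integrable (leb T) (\<lambda>t. prod (x t) (y t))"
    proof (rule Bochner_Integration.integrable_bound)
      show "integrable (leb T) (\<lambda>t. norm (x t) * norm (y t) * K)"
        using sq_integrable_norm_mult[OF x y] by simp
      show "AE t in leb T. norm (prod (x t) (y t)) \<le> norm (norm (x t) * norm (y t) * K)"
        using K by (intro AE_I2) (auto intro: order_trans[OF _ abs_ge_self])
    qed (use x y in \<open>auto intro!: prod_meas simp: sq_integrable_def\<close>)
    have "norm (\<integral>t. prod (x t) (y t) \<partial>leb T) \<le> (\<integral>t. norm (x t) * norm (y t) * K \<partial>leb T)"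
      using sq_integrable_norm_mult[OF x y] int K by (intro Bochner_Integration.integral_norm_bound_integral) auto
    also have "\<dots> = K * (\<integral>t. norm (x t) * norm (y t) \<partial>leb T)"
      by simp
    also have "\<dots> \<le> K * (l2norm (leb T) x * l2norm (leb T) y)"
      using K by (intro mult_left_mono l2_Cauchy_Schwarz_norm x y) auto
    finally show "norm (\<integral>t. prod (x t) (y t) \<partial>leb T) \<le> K * (l2norm (leb T) x * l2norm (leb T) y)" .
  qed
  have gL: "sq_integrable (leb T) g" "sq_integrable (leb T) g'"
    by (intro continuous_on_imp_sq_integrable g_cont g')+
  define D where "D x y = (\<integral>t. prod (y t) (g t) \<partial>leb T) + (\<integral>t. prod (x t) (g' t) \<partial>leb T)
    - prod (x T) (g T) + prod (x 0) (g 0)" for x y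
  define C where "C = K * l2norm (leb T) g + K * (T * l2norm (leb T) g') + sqrt T * norm (g T) * K"
  have C: "C \<ge> 0"
    unfolding C_def using K T by (intro add_nonneg_nonneg mult_nonneg_nonneg l2norm_nonneg) auto
  have small: "norm (D u v) \<le> C * \<epsilon>" if eps: "\<epsilon> > 0" for \<epsilon>
  proof -
    obtain c where c: "continuous_on UNIV c" and vc: "l2norm (leb T) (\<lambda>t. v t - c t) < \<epsilon>"
      using continuous_dense_l2[OF primitive_sq_integrable[OF uv] eps] by blast
    have cT: "continuous_on {0..T} c"
      using c continuous_on_subset by blast
    define U where "U t = u 0 + integral {0..t} c" for t
    have cL: "sq_integrable (leb T) c"
      by (rule continuous_on_imp_sq_integrable[OF cT])
    have Uc: "primitive T U c"
      unfolding primitive_def U_def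
      using cL integral_leb_eq[OF sq_integrable_imp_integrable[OF cL]] by auto
    have DUc: "D U c = 0"
    proof -
      have der: "((\<lambda>t. prod (U t) (g t)) has_vector_derivative prod (U t) (g' t) + prod (c t) (g t)) (at t within {0..T})"
        if "t \<in> {0..T}" for t
      proof -
        have "(U has_vector_derivative c t) (at t within {0..T})"
          unfolding U_def using integral_has_vector_derivative[OF cT that]
          by (auto intro!: derivative_eq_intros)
        then show ?thesis
          by (rule has_vector_derivative[OF _ g[OF that]])
      qed
      have "((\<lambda>t. prod (U t) (g' t) + prod (c t) (g t)) has_integral prod (U T) (g T) - prod (U 0) (g 0)) {0..T}"
        by (rule fundamental_theorem_of_calculus[OF T der]) auto
      moreover have "integrable (leb T) (\<lambda>t. prod (U t) (g' t) + prod (c t) (g t))"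
        by (intro Bochner_Integration.integrable_add prod_int primitive_sq_integrable_fun[OF Uc] cL gL)
      ultimately have "(\<integral>t. prod (U t) (g' t) + prod (c t) (g t) \<partial>leb T) = prod (U T) (g T) - prod (U 0) (g 0)"
        using integral_leb_eq[of T "\<lambda>t. prod (U t) (g' t) + prod (c t) (g t)" T] by (simp add: integral_unique)
      moreover have "(\<integral>t. prod (U t) (g' t) + prod (c t) (g t) \<partial>leb T)
          = (\<integral>t. prod (U t) (g' t) \<partial>leb T) + (\<integral>t. prod (c t) (g t) \<partial>leb T)"
        by (intro Bochner_Integration.integral_add prod_int primitive_sq_integrable_fun[OF Uc] cL gL)
      ultimately show ?thesis
        by (simp add: D_def algebra_simps)
    qed
    define d where "d t = u t - U t" for t
    define \<delta> where "\<delta> t = v t - c t" for t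
    have \<delta>_le: "l2norm (leb T) \<delta> \<le> \<epsilon>"
      using vc by (simp add: \<delta>_def[abs_def])
    have d\<delta>: "primitive T d \<delta>"
      unfolding d_def \<delta>_def by (rule primitive_diff[OF uv Uc])
    have d0: "d 0 = 0"
      by (simp add: d_def U_def)
    have d_le: "norm (d t) \<le> sqrt T * \<epsilon>" if "t \<in> {0..T}" for t
    proof -
      have "norm (d t - d 0) \<le> sqrt (t - 0) * l2norm (leb T) \<delta>"
        by (rule primitive_increment_le[OF d\<delta>]) (use that in auto)
      also have "\<dots> \<le> sqrt T * \<epsilon>"
        using that \<delta>_le by (intro mult_mono) (auto simp: l2norm_nonneg)
      finally show ?thesis by (simp add: d0)
    qed
    have "l2norm (leb T) d \<le> l2norm (leb T) (\<lambda>t. sqrt T * \<epsilon>)"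
    proof (rule l2norm_mono)
      show "AE t in leb T. norm (d t) \<le> norm (sqrt T * \<epsilon>)"
        by (rule AE_leb_I) (use d_le T \<open>\<epsilon> > 0\<close> in auto)
    qed (auto intro: primitive_sq_integrable_fun[OF d\<delta>] sq_integrable_const[OF finite_measure_leb])
    also have "\<dots> = T * \<epsilon>"
      using T \<open>\<epsilon> > 0\<close> by (simp add: l2norm_def measure_restrict_space real_sqrt_mult power_mult_distrib)
    finally have d_l2: "l2norm (leb T) d \<le> T * \<epsilon>" .
    have "D u v = D d \<delta>"
    proof -
      have "D d \<delta> = D u v - D U c"
        unfolding D_def d_def \<delta>_def diff_left
        using Bochner_Integration.integral_diff[OF prod_int[OF primitive_sq_integrable[OF uv] gL(1)] prod_int[OF cL gL(1)]]
          Bochner_Integration.integral_diff[OF prod_int[OF primitive_sq_integrable_fun[OF uv] gL(2)] prod_int[OF primitive_sq_integrable_fun[OF Uc] gL(2)]]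
        by simp
      then show ?thesis by (simp add: DUc)
    qed
    also have "norm \<dots> \<le> norm (\<integral>t. prod (\<delta> t) (g t) \<partial>leb T) + norm (\<integral>t. prod (d t) (g' t) \<partial>leb T) + norm (prod (d T) (g T))"
      unfolding D_def d0 zero_left
      using norm_triangle_ineq[of "\<integral>t. prod (\<delta> t) (g t) \<partial>leb T" "\<integral>t. prod (d t) (g' t) \<partial>leb T"]
        norm_triangle_ineq4[of "(\<integral>t. prod (\<delta> t) (g t) \<partial>leb T) + (\<integral>t. prod (d t) (g' t) \<partial>leb T)" "prod (d T) (g T)"]
      by simp
    also have "\<dots> \<le> K * (\<epsilon> * l2norm (leb T) g) + K * ((T * \<epsilon>) * l2norm (leb T) g') + (sqrt T * \<epsilon>) * norm (g T) * K"
    proof (intro add_mono)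
      show "norm (\<integral>t. prod (\<delta> t) (g t) \<partial>leb T) \<le> K * (\<epsilon> * l2norm (leb T) g)"
        using prod_le[OF primitive_sq_integrable[OF d\<delta>] gL(1)] \<delta>_le K
        by (elim order_trans) (intro mult_left_mono mult_right_mono; simp add: l2norm_nonneg)
      show "norm (\<integral>t. prod (d t) (g' t) \<partial>leb T) \<le> K * ((T * \<epsilon>) * l2norm (leb T) g')"
        using prod_le[OF primitive_sq_integrable_fun[OF d\<delta>] gL(2)] d_l2 K
        by (elim order_trans) (intro mult_left_mono mult_right_mono; simp add: l2norm_nonneg)
      show "norm (prod (d T) (g T)) \<le> (sqrt T * \<epsilon>) * norm (g T) * K"
        using K(1)[of "d T" "g T"] d_le[of T] T K(2)
        by (elim order_trans) (intro mult_right_mono; simp)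
    qed
    also have "\<dots> = C * \<epsilon>"
      by (simp add: C_def algebra_simps)
    finally show ?thesis .
  qed
  have "norm (D u v) \<le> 0"
  proof (rule field_le_epsilon)
    fix e :: real assume "e > 0"
    then have "norm (D u v) \<le> C * (e / (C + 1))"
      using C by (intro small) simp
    also have "\<dots> \<le> e"
      using C \<open>e > 0\<close> by (simp add: field_simps)
    finally show "norm (D u v) \<le> 0 + e"
      by simp
  qed
  then show ?thesis
    by (simp add: D_def algebra_simps)
qed

section \<open>Weak derivatives\<close>

lemma test_function_deriv:
  assumes "\<psi> \<in> test_functions T"
  shows "(\<psi> has_vector_derivative deriv \<psi> t) (at t)" "continuous_on A (deriv \<psi>)"
    "\<psi> 0 = 0" "\<psi> T = 0"
proof -
  obtain D K where D: "\<And>t. (\<psi> has_vector_derivative D t) (at t)" "continuous_on UNIV D"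
    and K: "K \<subseteq> {0<..<T}" "\<And>t. t \<notin> K \<Longrightarrow> \<psi> t = 0"
    using assms unfolding test_functions_def C1_differentiable_on_def by blast
  have deriv: "deriv \<psi> = D"
    using D(1) by (intro ext DERIV_imp_deriv) (simp add: has_real_derivative_iff_has_vector_derivative)
  show "(\<psi> has_vector_derivative deriv \<psi> t) (at t)" "continuous_on A (deriv \<psi>)"
    unfolding deriv by (rule D(1), rule continuous_on_subset[OF D(2) subset_UNIV])
  have "0 \<notin> K" "T \<notin> K"
    using K by auto
  then show "\<psi> 0 = 0" "\<psi> T = 0"
    using K(2) by blast+
qed

lemma primitive_has_weak_deriv:
  assumes T: "0 < T" and uv: "primitive T u v"
  shows "has_weak_deriv T u v"
  unfolding has_weak_deriv_def
proof
  fix \<psi> assume \<psi>: "\<psi> \<in> test_functions T"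
  have "(\<integral>t. \<psi> t *\<^sub>R v t \<partial>leb T) + (\<integral>t. deriv \<psi> t *\<^sub>R u t \<partial>leb T) = \<psi> T *\<^sub>R u T - \<psi> 0 *\<^sub>R u 0"
    by (rule primitive_by_parts[OF bounded_bilinear.flip[OF bounded_bilinear_scaleR] less_imp_le[OF T] uv
        has_vector_derivative_at_within[OF test_function_deriv(1)[OF \<psi>]] test_function_deriv(2)[OF \<psi>]])
  then show "(\<integral>t. deriv \<psi> t *\<^sub>R u t \<partial>leb T) = - (\<integral>t. \<psi> t *\<^sub>R v t \<partial>leb T)"
    by (simp add: test_function_deriv(3,4)[OF \<psi>] eq_neg_iff_add_eq_0 add.commute)
qed

lemma DERIV_positive_part_squared:
  "((\<lambda>r::real. (max 0 r)\<^sup>2) has_real_derivative 2 * max 0 r) (at r)"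
proof -
  consider "r > 0" | "r < 0" | "r = 0" by linarith
  then show ?thesis
  proof cases
    case 1
    have "((\<lambda>r. r\<^sup>2) has_real_derivative 2 * max 0 r) (at r)"
      using 1 by (auto intro!: derivative_eq_intros)
    then show ?thesis
      by (rule has_field_derivative_transform_within_open[of _ _ _ "{0<..}"]) (use 1 in auto)
  next
    case 2
    have "((\<lambda>r. 0) has_real_derivative 2 * max 0 r) (at r)"
      using 2 by (auto intro!: derivative_eq_intros)
    then show ?thesis
      by (rule has_field_derivative_transform_within_open[of _ _ _ "{..<0}"]) (use 2 in auto)
  next
    case 3
    have "((\<lambda>y::real. max 0 y) \<longlongrightarrow> max 0 0) (at 0)"
      by (intro tendsto_intros)
    moreover have "\<forall>\<^sub>F y in at 0. max 0 y = ((max 0 y)\<^sup>2 - (max 0 0)\<^sup>2) / (y - 0 :: real)"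
      unfolding eventually_at by (intro exI[of _ 1]) (auto simp: max_def power2_eq_square)
    ultimately have "((\<lambda>y. ((max 0 y)\<^sup>2 - (max 0 0)\<^sup>2) / (y - 0 :: real)) \<longlongrightarrow> max 0 0) (at 0)"
      by (rule Lim_transform_eventually)
    then show ?thesis
      using 3 by (simp add: has_field_derivative_iff)
  qed
qed

text \<open>A quadratic spline that rises from \<open>0\<close> to \<open>1\<close> on the unit interval, and its derivative, a triangular
  pulse. Squares of positive parts make it continuously differentiable on the whole line.\<close>

definition switch :: "real \<Rightarrow> real" where
  "switch r = 2 * (max 0 r)\<^sup>2 - 4 * (max 0 (r - 1 / 2))\<^sup>2 + 2 * (max 0 (r - 1))\<^sup>2"

definition pulse :: "real \<Rightarrow> real" where
  "pulse r = 4 * max 0 r - 8 * max 0 (r - 1 / 2) + 4 * max 0 (r - 1)"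

lemma DERIV_switch: "(switch has_real_derivative pulse r) (at r)"
proof -
  have shift: "((\<lambda>r. (max 0 (r - c))\<^sup>2) has_real_derivative 2 * max 0 (r - c)) (at r)" for c
  proof -
    have "((\<lambda>r. r - c) has_real_derivative 1) (at r)"
      by (auto intro!: derivative_eq_intros)
    from DERIV_chain2[OF DERIV_positive_part_squared this] show ?thesis
      by simp
  qed
  show ?thesis
    unfolding switch_def[abs_def] pulse_def
    by (rule derivative_eq_intros DERIV_positive_part_squared shift refl | simp)+
qed

lemma switch_eq_0: "r \<le> 0 \<Longrightarrow> switch r = 0"
  by (simp add: switch_def)

lemma switch_eq_1: "1 \<le> r \<Longrightarrow> switch r = 1"
  by (simp add: switch_def power2_eq_square algebra_simps)

lemma pulse_nonneg: "0 \<le> pulse r"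
  by (simp add: pulse_def max_def)

lemma pulse_eq_0: "r \<notin> {0..1} \<Longrightarrow> pulse r = 0"
  by (auto simp: pulse_def max_def)

lemma continuous_on_scaled_pulse: "continuous_on A (\<lambda>\<tau>. k * pulse (k * (\<tau> - s)))"
  unfolding pulse_def by (intro continuous_intros)

text \<open>The rescaled pulses have integral one and concentrate to the right of \<open>s\<close>, so they approximate
  the evaluation at \<open>s\<close>.\<close>

lemma pulse_averages_tendsto:
  fixes d :: "real \<Rightarrow> 'a::euclidean_space"
  assumes d: "continuous_on {0..T} d" and s: "0 \<le> s" "s < T"
  shows "((\<lambda>k. \<integral>\<tau>. (k * pulse (k * (\<tau> - s))) *\<^sub>R d \<tau> \<partial>leb T) \<longlongrightarrow> d s) at_top"
proof (rule tendstoI)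
  fix e :: real assume e: "e > 0"
  then obtain \<delta> where \<delta>: "\<delta> > 0" "\<And>\<tau>. \<tau> \<in> {0..T} \<Longrightarrow> dist \<tau> s < \<delta> \<Longrightarrow> dist (d \<tau>) (d s) < e / 2"
    using d s unfolding continuous_on_iff by (metis atLeastAtMost_iff half_gt_zero less_imp_le)
  have "\<forall>\<^sub>F k in at_top. k > max 1 (max (2 / \<delta>) (1 / (T - s)))"
    by (rule eventually_gt_at_top)
  then show "\<forall>\<^sub>F k in at_top. dist (\<integral>\<tau>. (k * pulse (k * (\<tau> - s))) *\<^sub>R d \<tau> \<partial>leb T) (d s) < e"
  proof eventually_elim
    case (elim k)
    then have k: "k > 0" "1 / k < \<delta>" "k * (T - s) \<ge> 1"
      using \<delta> s by (auto simp: field_simps)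
    define \<rho> where "\<rho> \<tau> = k * pulse (k * (\<tau> - s))" for \<tau>
    have \<rho>_cont: "continuous_on A \<rho>" for A
      unfolding \<rho>_def by (rule continuous_on_scaled_pulse)
    have \<rho>_nonneg: "\<rho> \<tau> \<ge> 0" for \<tau>
      using k pulse_nonneg by (simp add: \<rho>_def)
    have "((\<lambda>\<tau>. switch (k * (\<tau> - s))) has_vector_derivative \<rho> \<tau>) (at \<tau> within {0..T})" for \<tau>
    proof -
      have "((\<lambda>\<tau>. switch (k * (\<tau> - s))) has_real_derivative pulse (k * (\<tau> - s)) * k) (at \<tau>)"
        by (rule DERIV_chain2[OF DERIV_switch]) (auto intro!: derivative_eq_intros)
      then have "((\<lambda>\<tau>. switch (k * (\<tau> - s))) has_vector_derivative \<rho> \<tau>) (at \<tau>)"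
        by (simp add: \<rho>_def[abs_def] mult.commute has_real_derivative_iff_has_vector_derivative)
      then show ?thesis
        by (rule has_vector_derivative_at_within)
    qed
    then have "(\<rho> has_integral switch (k * (T - s)) - switch (k * (0 - s))) {0..T}"
      using s by (intro fundamental_theorem_of_calculus) auto
    then have \<rho>_int: "(\<integral>\<tau>. \<rho> \<tau> \<partial>leb T) = 1"
      using integral_leb_eq[OF continuous_on_imp_integrable_leb[OF \<rho>_cont], of T T] k s
      by (simp add: integral_unique switch_eq_0 switch_eq_1 mult_nonneg_nonpos)
    have int1: "integrable (leb T) (\<lambda>\<tau>. \<rho> \<tau> *\<^sub>R d \<tau>)" and int2: "integrable (leb T) (\<lambda>\<tau>. \<rho> \<tau> *\<^sub>R d s)"
      and int3: "integrable (leb T) (\<lambda>\<tau>. \<rho> \<tau> * (e / 2))"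
      by (intro continuous_on_imp_integrable_leb continuous_intros \<rho>_cont d)+
    have "(\<integral>\<tau>. \<rho> \<tau> *\<^sub>R d s \<partial>leb T) = d s"
      by (subst integral_scaleR_left) (simp_all add: continuous_on_imp_integrable_leb[OF \<rho>_cont] \<rho>_int)
    then have "(\<integral>\<tau>. \<rho> \<tau> *\<^sub>R d \<tau> \<partial>leb T) - d s = (\<integral>\<tau>. \<rho> \<tau> *\<^sub>R d \<tau> - \<rho> \<tau> *\<^sub>R d s \<partial>leb T)"
      using Bochner_Integration.integral_diff[OF int1 int2] by simp
    also have "norm \<dots> \<le> (\<integral>\<tau>. \<rho> \<tau> * (e / 2) \<partial>leb T)"
    proof (rule Bochner_Integration.integral_norm_bound_integral[OF Bochner_Integration.integrable_diff[OF int1 int2] int3])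
      fix \<tau> assume "\<tau> \<in> space (leb T)"
      then have \<tau>: "\<tau> \<in> {0..T}" by auto
      show "norm (\<rho> \<tau> *\<^sub>R d \<tau> - \<rho> \<tau> *\<^sub>R d s) \<le> \<rho> \<tau> * (e / 2)"
      proof (cases "k * (\<tau> - s) \<in> {0..1}")
        case True
        then have "0 \<le> \<tau> - s" "\<tau> - s \<le> 1 / k"
          using k by (auto simp: field_simps zero_le_mult_iff)
        then have "norm (d \<tau> - d s) \<le> e / 2"
          using \<delta>(2)[OF \<tau>] k by (force simp: dist_norm)
        then show ?thesis
          using mult_left_mono[OF _ \<rho>_nonneg[of \<tau>]] \<rho>_nonneg[of \<tau>]
          by (simp flip: scaleR_diff_right del: times_divide_eq_right)
      qed (simp add: \<rho>_def pulse_eq_0)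
    qed
    also have "\<dots> < e"
      using \<rho>_int e by simp
    finally show ?case
      by (simp add: dist_norm \<rho>_def)
  qed
qed

text \<open>Testing with differences of two switches, which are localised at \<open>s\<close> and \<open>t\<close> in the limit,
  shows that a continuous function with vanishing weak derivative takes the same value at
  \<open>s\<close> and \<open>t\<close>.\<close>

lemma continuous_weak_deriv_0_const:
  fixes d :: "real \<Rightarrow> 'a::euclidean_space"
  assumes T: "0 < T" and d: "continuous_on {0..T} d"
    and weak: "\<And>\<psi>. \<psi> \<in> test_functions T \<Longrightarrow> (\<integral>t. deriv \<psi> t *\<^sub>R d t \<partial>leb T) = 0"
    and t: "t \<in> {0..T}"
  shows "d t = d 0"
proof -
  have same: "d s = d t" if st: "0 < s" "s < t" "t < T" for s t
  proof -
    define \<rho> where "\<rho> r k \<tau> = k * pulse (k * (\<tau> - r))" for r k \<tau> :: real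
    have "\<forall>\<^sub>F k in at_top. k > max 1 (1 / (T - t))"
      by (rule eventually_gt_at_top)
    then have ev: "\<forall>\<^sub>F k in at_top. (\<integral>\<tau>. \<rho> s k \<tau> *\<^sub>R d \<tau> \<partial>leb T) - (\<integral>\<tau>. \<rho> t k \<tau> *\<^sub>R d \<tau> \<partial>leb T) = 0"
    proof eventually_elim
      case (elim k)
      then have k: "k > 0" "t + 1 / k < T"
        using st by (auto simp: field_simps)
      define \<psi> where "\<psi> \<tau> = switch (k * (\<tau> - s)) - switch (k * (\<tau> - t))" for \<tau>
      have der: "(\<psi> has_real_derivative \<rho> s k \<tau> - \<rho> t k \<tau>) (at \<tau>)" for \<tau>
        unfolding \<psi>_def \<rho>_def
        by (auto intro!: derivative_eq_intros DERIV_chain2[OF DERIV_switch])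
      have \<rho>_cont: "continuous_on A (\<rho> r k)" for A r
        unfolding \<rho>_def by (rule continuous_on_scaled_pulse)
      have "\<psi> \<in> test_functions T"
        unfolding test_functions_def C1_differentiable_on_def
      proof (intro CollectI conjI exI[of _ "{s..t + 1 / k}"] exI[of _ "\<lambda>\<tau>. \<rho> s k \<tau> - \<rho> t k \<tau>"] ballI allI impI)
        show "(\<psi> has_vector_derivative \<rho> s k \<tau> - \<rho> t k \<tau>) (at \<tau>)" for \<tau>
          using der by (simp add: has_real_derivative_iff_has_vector_derivative)
        show "continuous_on UNIV (\<lambda>\<tau>. \<rho> s k \<tau> - \<rho> t k \<tau>)"
          by (intro continuous_intros \<rho>_cont)
        fix \<tau> assume "\<tau> \<notin> {s..t + 1 / k}"
        then consider "\<tau> < s" | "t + 1 / k < \<tau>" by fastforce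
        then show "\<psi> \<tau> = 0"
        proof cases
          case 1
          then have "k * (\<tau> - s) \<le> 0" "k * (\<tau> - t) \<le> 0"
            using k st by (auto intro!: mult_nonneg_nonpos)
          then show ?thesis by (simp add: \<psi>_def switch_eq_0)
        next
          case 2
          then have "1 / k \<le> \<tau> - t" "1 / k \<le> \<tau> - s"
            using st by linarith+
          then have "1 \<le> k * (\<tau> - s)" "1 \<le> k * (\<tau> - t)"
            using k by (auto simp: field_simps)
          then show ?thesis by (simp add: \<psi>_def switch_eq_1)
        qed
      qed (use st k in auto)
      then have "(\<integral>\<tau>. deriv \<psi> \<tau> *\<^sub>R d \<tau> \<partial>leb T) = 0"
        by (rule weak)
      moreover have "deriv \<psi> \<tau> = \<rho> s k \<tau> - \<rho> t k \<tau>" for \<tau>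
        by (rule DERIV_imp_deriv[OF der])
      moreover have "integrable (leb T) (\<lambda>\<tau>. \<rho> r k \<tau> *\<^sub>R d \<tau>)" for r
        by (intro continuous_on_imp_integrable_leb continuous_intros \<rho>_cont d)
      ultimately show ?case
        by (simp add: scaleR_diff_left)
    qed
    have "((\<lambda>k. (\<integral>\<tau>. \<rho> s k \<tau> *\<^sub>R d \<tau> \<partial>leb T) - (\<integral>\<tau>. \<rho> t k \<tau> *\<^sub>R d \<tau> \<partial>leb T)) \<longlongrightarrow> d s - d t) at_top"
      unfolding \<rho>_def by (intro tendsto_diff pulse_averages_tendsto d) (use st in auto)
    moreover have "((\<lambda>k. (\<integral>\<tau>. \<rho> s k \<tau> *\<^sub>R d \<tau> \<partial>leb T) - (\<integral>\<tau>. \<rho> t k \<tau> *\<^sub>R d \<tau> \<partial>leb T)) \<longlongrightarrow> 0) at_top"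
      by (rule tendsto_eventually[OF ev])
    ultimately have "d s - d t = 0"
      by (intro tendsto_unique[OF trivial_limit_at_top_linorder])
    then show ?thesis by simp
  qed
  have mid: "d s = d (T / 2)" if "s \<in> {0<..<T}" for s
  proof -
    consider "s < T / 2" | "s = T / 2" | "T / 2 < s" by linarith
    then show ?thesis
    proof cases
      case 1
      then show ?thesis using same[of s "T / 2"] that T by simp
    next
      case 3
      then show ?thesis using same[of "T / 2" s, symmetric] that T by simp
    qed (rule arg_cong)
  qed
  have "d s = d (T / 2)" if "s \<in> {0..T}" for s
  proof (rule continuous_constant_on_closure[of "{0<..<T}" d])
    show "continuous_on (closure {0<..<T}) d" "s \<in> closure {0<..<T}"
      using d T that by (simp_all add: closure_greaterThanLessThan)
  qed (rule mid)
  from this[OF t] this[of 0] show ?thesis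
    using T by simp
qed

text \<open>The weak derivative of the indefinite integral of \<open>v\<close> is \<open>v\<close> too, and the difference to \<open>u\<close>
  is then constant.\<close>

lemma has_weak_deriv_imp_primitive:
  assumes T: "0 < T" and u: "continuous_on {0..T} u"
    and v: "sq_integrable (leb T) v" and weak: "has_weak_deriv T u v"
  shows "primitive T u v"
proof -
  define U where "U t = 0 + (\<integral>\<tau>. v \<tau> \<partial>leb t)" for t
  have U: "primitive T U v"
    unfolding U_def by (rule primitive_indefinite_integral[OF v])
  have "(u t - U t) = (u 0 - U 0)" if "t \<in> {0..T}" for t
  proof (rule continuous_weak_deriv_0_const[OF T _ _ that])
    show "continuous_on {0..T} (\<lambda>t. u t - U t)"
      by (intro continuous_intros u primitive_continuous[OF U])
    fix \<psi> assume \<psi>: "\<psi> \<in> test_functions T"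
    have "(\<integral>t. deriv \<psi> t *\<^sub>R u t \<partial>leb T) = (\<integral>t. deriv \<psi> t *\<^sub>R U t \<partial>leb T)"
      using weak primitive_has_weak_deriv[OF T U] \<psi> by (simp add: has_weak_deriv_def)
    then show "(\<integral>t. deriv \<psi> t *\<^sub>R (u t - U t) \<partial>leb T) = 0"
      unfolding scaleR_diff_right
      by (subst Bochner_Integration.integral_diff)
         (auto intro!: continuous_on_imp_integrable_leb continuous_intros u primitive_continuous[OF U]
           test_function_deriv(2)[OF \<psi>])
  qed
  then have const: "u t - U t = u 0 - U 0" if "t \<in> {0..T}" for t
    using that .
  show ?thesis
    unfolding primitive_def
  proof (intro conjI ballI v)
    fix t assume t: "t \<in> {0..T}"
    have "u t - u 0 = (u t - U t) - (u 0 - U 0) + (U t - U 0)"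
      by simp
    also have "\<dots> = U t - U 0"
      unfolding const[OF t] by simp
    also have "\<dots> = (\<integral>\<tau>. v \<tau> \<partial>leb t)"
      using U t by (simp add: primitive_def)
    finally show "u t - u 0 = (\<integral>\<tau>. v \<tau> \<partial>leb t)" .
  qed
qed

lemma W12_primitive:
  assumes "0 < T" "u \<in> W12 T"
  shows "primitive T u (weak_deriv T u)"
proof -
  have "\<exists>v. v \<in> L2 T \<and> has_weak_deriv T u v"
    using assms by (auto simp: W12_def)
  then have "weak_deriv T u \<in> L2 T \<and> has_weak_deriv T u (weak_deriv T u)"
    unfolding weak_deriv_def by (rule someI_ex)
  moreover have "continuous_on {0..T} u"
    using assms by (simp add: W12_def)
  ultimately show ?thesis
    by (intro has_weak_deriv_imp_primitive[OF assms(1)]) (simp_all add: L2_iff)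
qed

lemma primitive_W12:
  assumes "0 < T" "primitive T u v"
  shows "u \<in> W12 T"
  unfolding W12_def L2_iff
  by (intro CollectI conjI bexI[of _ v] primitive_has_weak_deriv[OF assms] primitive_continuous[OF assms(2)]
      primitive_sq_integrable_fun[OF assms(2)])
     (simp_all add: L2_iff primitive_sq_integrable[OF assms(2)] primitive_sq_integrable_fun[OF assms(2)])

section \<open>Weak and uniform convergence\<close>

lemma polynomial_dense_l2:
  fixes v :: "real \<Rightarrow> 'a::euclidean_space"
  assumes T: "0 \<le> T" and v: "sq_integrable (leb T) v" and "0 < \<epsilon>"
  obtains P where "polynomial_function P" "l2norm (leb T) (\<lambda>t. v t - P t) < \<epsilon>"
proof -
  obtain c where c: "continuous_on UNIV c" "l2norm (leb T) (\<lambda>t. v t - c t) < \<epsilon> / 2"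
    using continuous_dense_l2[OF v half_gt_zero[OF \<open>0 < \<epsilon>\<close>]] by blast
  have cT: "continuous_on {0..T} c"
    using c(1) continuous_on_subset by blast
  define \<eta> where "\<eta> = \<epsilon> / (2 * (sqrt T + 1))"
  have "sqrt T + 1 > 0"
    using T by (simp add: add_nonneg_pos)
  then have \<eta>: "\<eta> > 0" "sqrt T * \<eta> \<le> \<epsilon> / 2"
    using \<open>0 < \<epsilon>\<close> by (auto simp: \<eta>_def field_simps)
  obtain P where P: "polynomial_function P" "\<And>t. t \<in> {0..T} \<Longrightarrow> norm (c t - P t) < \<eta>"
    using Stone_Weierstrass_polynomial_function[OF compact_Icc cT \<eta>(1)] by blast
  have cL: "sq_integrable (leb T) c" and PL: "sq_integrable (leb T) P"
    by (intro continuous_on_imp_sq_integrable cT continuous_on_polymonial_function P(1))+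
  have "l2norm (leb T) (\<lambda>t. c t - P t) \<le> l2norm (leb T) (\<lambda>t. \<eta>)"
  proof (rule l2norm_mono)
    show "AE t in leb T. norm (c t - P t) \<le> norm \<eta>"
      by (rule AE_leb_I) (use P(2) \<eta> in \<open>simp add: less_imp_le\<close>)
  qed (intro sq_integrable_diff cL PL sq_integrable_const finite_measure_leb)+
  also have "\<dots> = sqrt T * \<eta>"
    using T \<eta> by (simp add: l2norm_def measure_restrict_space real_sqrt_mult)
  finally have "l2norm (leb T) (\<lambda>t. v t - P t) < \<epsilon>"
    using l2norm_triangle[OF sq_integrable_diff[OF v cL] sq_integrable_diff[OF cL PL]] c(2) \<eta>(2)
    by simp
  then show ?thesis
    using that P(1) by blast
qed

lemma uniform_limit_inner_integral:
  fixes y :: "nat \<Rightarrow> real \<Rightarrow> 'a::euclidean_space"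
  assumes lim: "uniform_limit {0..T} y y0 sequentially"
    and y: "\<And>i. sq_integrable (leb T) (y i)" "sq_integrable (leb T) y0"
    and g: "sq_integrable (leb T) g"
  shows "(\<lambda>i. \<integral>t. y i t \<bullet> g t \<partial>leb T) \<longlonglongrightarrow> (\<integral>t. y0 t \<bullet> g t \<partial>leb T)"
proof (rule tendstoI)
  fix e :: real assume e: "e > 0"
  define G where "G = (\<integral>t. norm (g t) \<partial>leb T)"
  have G: "G \<ge> 0"
    by (simp add: G_def)
  have g_int: "integrable (leb T) (\<lambda>t. norm (g t))"
    by (intro integrable_norm sq_integrable_imp_integrable g)
  define \<eta> where "\<eta> = e / (G + 1)"
  have "G * \<eta> < e"
    using G e by (simp add: \<eta>_def field_simps)
  moreover have "\<eta> > 0"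
    using G e by (simp add: \<eta>_def)
  ultimately have \<eta>: "\<eta> > 0" "\<eta> * G < e"
    by (simp_all add: mult.commute)
  have "\<forall>\<^sub>F i in sequentially. \<forall>t\<in>{0..T}. dist (y i t) (y0 t) < \<eta>"
    using lim \<eta> by (simp add: uniform_limit_iff)
  then show "\<forall>\<^sub>F i in sequentially. dist (\<integral>t. y i t \<bullet> g t \<partial>leb T) (\<integral>t. y0 t \<bullet> g t \<partial>leb T) < e"
  proof eventually_elim
    case (elim i)
    have "(\<integral>t. y i t \<bullet> g t \<partial>leb T) - (\<integral>t. y0 t \<bullet> g t \<partial>leb T) = (\<integral>t. (y i t - y0 t) \<bullet> g t \<partial>leb T)"
      unfolding inner_diff_left
      by (rule Bochner_Integration.integral_diff[symmetric]) (intro sq_integrable_inner y g)+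
    also have "norm \<dots> \<le> (\<integral>t. \<eta> * norm (g t) \<partial>leb T)"
    proof (rule Bochner_Integration.integral_norm_bound_integral)
      fix t assume "t \<in> space (leb T)"
      then have "norm (y i t - y0 t) \<le> \<eta>"
        using elim[rule_format, of t] by (simp add: dist_norm)
      then show "norm ((y i t - y0 t) \<bullet> g t) \<le> \<eta> * norm (g t)"
        unfolding real_norm_def by (intro order_trans[OF Cauchy_Schwarz_ineq2] mult_right_mono) auto
    qed (use g_int in \<open>auto intro!: sq_integrable_inner sq_integrable_diff y g\<close>)
    also have "\<dots> < e"
      using \<eta> by (simp add: G_def)
    finally show ?case
      by (simp add: dist_norm)
  qed
qed

text \<open>Weak convergence needs to be tested only on polynomials, which are dense while the
  derivatives are bounded; integration by parts moves the derivative to the polynomial.\<close>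

lemma derivatives_weakly_convergent:
  fixes u v :: "nat \<Rightarrow> real \<Rightarrow> 'a::euclidean_space"
  assumes T: "0 < T" and uv: "\<And>i. primitive T (u i) (v i)" and uv0: "primitive T u0 v0"
    and bound: "\<And>i. l2norm (leb T) (v i) \<le> C"
    and lim: "uniform_limit {0..T} u u0 sequentially"
    and z: "sq_integrable (leb T) z"
  shows "(\<lambda>i. \<integral>t. v i t \<bullet> z t \<partial>leb T) \<longlonglongrightarrow> (\<integral>t. v0 t \<bullet> z t \<partial>leb T)"
proof (rule tendstoI)
  fix e :: real assume e: "e > 0"
  have v: "sq_integrable (leb T) (v i)" and v0: "sq_integrable (leb T) v0" for i
    using uv uv0 by (auto intro: primitive_sq_integrable)
  define R where "R = C + l2norm (leb T) v0 + 1"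
  have R: "R > 0"
    using order_trans[OF l2norm_nonneg bound[of 0]] l2norm_nonneg[of "leb T" v0] by (simp add: R_def)
  have d_le: "l2norm (leb T) (\<lambda>t. v i t - v0 t) \<le> R" for i
    using l2norm_triangle_diff[OF v v0, of i] bound[of i] by (simp add: R_def)
  obtain P where P: "polynomial_function P" "l2norm (leb T) (\<lambda>t. z t - P t) < e / (2 * R)"
    using polynomial_dense_l2[OF less_imp_le[OF T] z, of "e / (2 * R)"] e R by auto
  obtain P' where P': "polynomial_function P'" "\<And>t. (P has_vector_derivative P' t) (at t)"
    using has_vector_derivative_polynomial_function[OF P(1)] by blast
  have PL: "sq_integrable (leb T) P" "sq_integrable (leb T) P'"
    by (intro continuous_on_imp_sq_integrable continuous_on_polymonial_function P(1) P'(1))+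
  have parts: "(\<integral>t. b t \<bullet> P t \<partial>leb T) = a T \<bullet> P T - a 0 \<bullet> P 0 - (\<integral>t. a t \<bullet> P' t \<partial>leb T)"
    if "primitive T a b" for a b
    using primitive_by_parts[OF bounded_bilinear_inner less_imp_le[OF T] that, of P P']
      P'(2) continuous_on_polymonial_function[OF P'(1)]
    by (simp add: has_vector_derivative_at_within eq_diff_eq)
  have pt: "(\<lambda>i. u i t) \<longlonglongrightarrow> u0 t" if "t \<in> {0..T}" for t
    by (rule tendsto_uniform_limitI[OF lim that])
  have "(\<lambda>i. \<integral>t. v i t \<bullet> P t \<partial>leb T) \<longlonglongrightarrow> (\<integral>t. v0 t \<bullet> P t \<partial>leb T)"
    unfolding parts[OF uv] parts[OF uv0]
    by (intro tendsto_intros pt uniform_limit_inner_integral lim primitive_sq_integrable_fun[OF uv]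
        primitive_sq_integrable_fun[OF uv0] PL) (use T in auto)
  then have "\<forall>\<^sub>F i in sequentially. dist (\<integral>t. v i t \<bullet> P t \<partial>leb T) (\<integral>t. v0 t \<bullet> P t \<partial>leb T) < e / 2"
    using e by (intro tendstoD) auto
  then show "\<forall>\<^sub>F i in sequentially. dist (\<integral>t. v i t \<bullet> z t \<partial>leb T) (\<integral>t. v0 t \<bullet> z t \<partial>leb T) < e"
  proof eventually_elim
    case (elim i)
    have split: "(\<integral>t. v i t \<bullet> y t \<partial>leb T) - (\<integral>t. v0 t \<bullet> y t \<partial>leb T) = (\<integral>t. (v i t - v0 t) \<bullet> y t \<partial>leb T)"
      if "sq_integrable (leb T) y" for y
      unfolding inner_diff_left
      by (rule Bochner_Integration.integral_diff[symmetric]) (intro sq_integrable_inner v v0 that)+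
    have "(\<integral>t. (v i t - v0 t) \<bullet> (z t - P t) \<partial>leb T)
        = (\<integral>t. (v i t - v0 t) \<bullet> z t \<partial>leb T) - (\<integral>t. (v i t - v0 t) \<bullet> P t \<partial>leb T)"
      unfolding inner_diff_right
      by (rule Bochner_Integration.integral_diff) (intro sq_integrable_inner sq_integrable_diff v v0 z PL)+
    moreover have "\<bar>\<integral>t. (v i t - v0 t) \<bullet> (z t - P t) \<partial>leb T\<bar> \<le> R * (e / (2 * R))"
    proof -
      have "\<bar>\<integral>t. (v i t - v0 t) \<bullet> (z t - P t) \<partial>leb T\<bar>
          \<le> l2norm (leb T) (\<lambda>t. v i t - v0 t) * l2norm (leb T) (\<lambda>t. z t - P t)"
        by (intro l2_Cauchy_Schwarz sq_integrable_diff v v0 z PL)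
      also have "\<dots> \<le> R * (e / (2 * R))"
        using d_le P(2) R by (intro mult_mono) (auto simp: l2norm_nonneg)
      finally show ?thesis .
    qed
    ultimately have "\<bar>(\<integral>t. (v i t - v0 t) \<bullet> z t \<partial>leb T) - (\<integral>t. (v i t - v0 t) \<bullet> P t \<partial>leb T)\<bar> \<le> e / 2"
      using R by simp
    moreover have "\<bar>\<integral>t. (v i t - v0 t) \<bullet> P t \<partial>leb T\<bar> < e / 2"
      using elim split[OF PL(1)] by (simp add: dist_real_def)
    moreover have "\<bar>x\<bar> < e" if "\<bar>x - y\<bar> \<le> e / 2" "\<bar>y\<bar> < e / 2" for x y
      using that by linarith
    ultimately show ?case
      unfolding dist_real_def split[OF z] by blast
  qed
qed

text \<open>The constant sequence \<open>v - v'\<close> of derivatives of the zero function converges weakly to \<open>0\<close>, so its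
  pairing with itself vanishes.\<close>

lemma primitive_unique:
  assumes T: "0 < T" and "primitive T u v" "primitive T u v'"
  shows "AE t in leb T. v t = v' t"
proof -
  have d: "primitive T (\<lambda>t. 0) (\<lambda>t. v t - v' t)"
    using primitive_diff[OF assms(2,3)] by simp
  have zero: "primitive T (\<lambda>t. 0) (\<lambda>t. 0::'a)"
    by (simp add: primitive_def sq_integrable_zero)
  have "(\<lambda>i::nat. \<integral>t. (v t - v' t) \<bullet> (v t - v' t) \<partial>leb T) \<longlonglongrightarrow> (\<integral>t. 0 \<bullet> (v t - v' t) \<partial>leb T)"
    by (rule derivatives_weakly_convergent[OF T d zero order_refl _ primitive_sq_integrable[OF d]])
       (simp add: uniform_limit_const)
  then have "(l2norm (leb T) (\<lambda>t. v t - v' t))\<^sup>2 = 0"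
    by (simp add: LIMSEQ_const_iff l2norm_inner)
  then show ?thesis
    using l2norm_eq_0D[OF primitive_sq_integrable[OF d]] by simp
qed

lemma weak_deriv_AE_eq:
  assumes "0 < T" "primitive T u v"
  shows "AE t in leb T. weak_deriv T u t = v t"
  by (rule primitive_unique[OF assms(1) W12_primitive[OF assms(1) primitive_W12[OF assms]] assms(2)])

lemma weakly_L2_bounded:
  assumes "weakly_L2 T u v"
  obtains C where "\<And>i. l2norm (leb T) (u i) \<le> C"
proof (rule uniform_boundedness_l2[OF finite_measure_leb, of T u])
  show "sq_integrable (leb T) (u i)" for i
    using assms by (simp add: weakly_L2_def L2_iff)
  show "bounded (range (\<lambda>i. \<integral>t. u i t \<bullet> z t \<partial>leb T))" if "sq_integrable (leb T) z" for z
    using assms that by (intro convergent_imp_bounded) (auto simp: weakly_L2_def L2_iff inner_L2_def)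
qed (use that in blast)

text \<open>Every \<open>L\<^sup>2\<close> function is the derivative of some member of \<open>W\<^sup>1\<^sup>,\<^sup>2\<close>, so that, the functions
  themselves converging uniformly, their derivatives converge weakly in \<open>L\<^sup>2\<close>, and the uniform boundedness
  principle applies to them.\<close>

lemma weakly_W12_derivatives_bounded:
  fixes u :: "nat \<Rightarrow> real \<Rightarrow> 'a::euclidean_space"
  assumes T: "0 < T" and weak: "weakly_W12 T u u0" and unif: "uniform_limit {0..T} u u0 sequentially"
  obtains C where "\<And>i. l2norm (leb T) (weak_deriv T (u i)) \<le> C"
proof (rule weakly_L2_bounded)
  have W: "u i \<in> W12 T" and W0: "u0 \<in> W12 T" for i
    using weak by (auto simp: weakly_W12_def)
  note P = W12_primitive[OF T W] W12_primitive[OF T W0]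
  show "weakly_L2 T (\<lambda>i. weak_deriv T (u i)) (weak_deriv T u0)"
    unfolding weakly_L2_def L2_iff
  proof (intro conjI allI ballI)
    show "sq_integrable (leb T) (weak_deriv T (u i))" for i
      by (rule primitive_sq_integrable[OF P(1)])
    show "sq_integrable (leb T) (weak_deriv T u0)"
      by (rule primitive_sq_integrable[OF P(2)])
    fix \<zeta> :: "real \<Rightarrow> 'a" assume "\<zeta> \<in> L2 T"
    then have \<zeta>: "sq_integrable (leb T) \<zeta>" by (simp add: L2_iff)
    define z where "z t = 0 + (\<integral>\<tau>. \<zeta> \<tau> \<partial>leb t)" for t
    have z: "primitive T z \<zeta>"
      unfolding z_def by (rule primitive_indefinite_integral[OF \<zeta>])
    have zW: "z \<in> W12 T"
      by (rule primitive_W12[OF T z])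
    have z': "sq_integrable (leb T) (weak_deriv T z)"
      by (rule primitive_sq_integrable[OF W12_primitive[OF T zW]])
    have swap: "inner_L2 T y \<zeta> = inner_L2 T y (weak_deriv T z)" if "sq_integrable (leb T) y" for y
      unfolding inner_L2_def
    proof (rule integral_cong_AE)
      show "AE t in leb T. y t \<bullet> \<zeta> t = y t \<bullet> weak_deriv T z t"
        using weak_deriv_AE_eq[OF T z] by eventually_elim simp
    qed (use that \<zeta> z' in \<open>auto simp: sq_integrable_def\<close>)
    have "(\<lambda>i. inner_W12 T (u i) z - inner_L2 T (u i) z) \<longlonglongrightarrow> inner_W12 T u0 z - inner_L2 T u0 z"
      using weak zW unif unfolding inner_L2_def
      by (intro tendsto_diff uniform_limit_inner_integral primitive_sq_integrable_fun[OF P(1)]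
          primitive_sq_integrable_fun[OF P(2)] primitive_sq_integrable_fun[OF z])
         (auto simp: weakly_W12_def)
    then show "(\<lambda>i. inner_L2 T (weak_deriv T (u i)) \<zeta>) \<longlonglongrightarrow> inner_L2 T (weak_deriv T u0) \<zeta>"
      by (simp add: inner_W12_def swap primitive_sq_integrable[OF P(1)] primitive_sq_integrable[OF P(2)])
  qed
qed (use that in blast)

text \<open>Uniform convergence settles the part of the inner product that contains the functions, and
  \<open>derivatives_weakly_convergent\<close> the part that contains the derivatives.\<close>

lemma weakly_W12_I:
  fixes u :: "nat \<Rightarrow> real \<Rightarrow> 'a::euclidean_space"
  assumes T: "0 < T" and W: "\<And>i. u i \<in> W12 T" "u0 \<in> W12 T"
    and bound: "\<And>i. l2norm (leb T) (weak_deriv T (u i)) \<le> C"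
    and unif: "uniform_limit {0..T} u u0 sequentially"
  shows "weakly_W12 T u u0"
  unfolding weakly_W12_def
proof (intro conjI allI ballI W)
  fix z :: "real \<Rightarrow> 'a" assume "z \<in> W12 T"
  note z = W12_primitive[OF T this]
  show "(\<lambda>i. inner_W12 T (u i) z) \<longlonglongrightarrow> inner_W12 T u0 z"
    unfolding inner_W12_def inner_L2_def
    by (intro tendsto_add uniform_limit_inner_integral[OF unif]
        derivatives_weakly_convergent[OF T _ _ bound unif]
        W12_primitive[OF T W(1)] W12_primitive[OF T W(2)]
        primitive_sq_integrable_fun[OF W12_primitive[OF T W(1)]]
        primitive_sq_integrable_fun[OF W12_primitive[OF T W(2)]]
        primitive_sq_integrable[OF z] primitive_sq_integrable_fun[OF z])
qed

text \<open>Pointwise convergence holds by testing with indicators of \<open>(0, t)\<close>, and it is uniform because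
  the primitives are equicontinuous.\<close>

lemma weakly_null_primitives_uniform:
  fixes k :: "nat \<Rightarrow> real \<Rightarrow> 'a::euclidean_space"
  assumes T: "0 < T" and K: "\<And>i. primitive T (K i) (k i)" and K0: "\<And>i. K i 0 = 0"
    and bound: "\<And>i. l2norm (leb T) (k i) \<le> C"
    and weak: "\<And>z. sq_integrable (leb T) z \<Longrightarrow> (\<lambda>i. \<integral>t. k i t \<bullet> z t \<partial>leb T) \<longlonglongrightarrow> 0"
  shows "uniform_limit {0..T} K (\<lambda>t. 0) sequentially"
proof -
  have k: "sq_integrable (leb T) (k i)" for i
    by (rule primitive_sq_integrable[OF K])
  have pt: "(\<lambda>i. K i t) \<longlonglongrightarrow> 0" if t: "t \<in> {0..T}" for t
  proof -
    have "(\<lambda>i. K i t \<bullet> b) \<longlonglongrightarrow> 0" if "b \<in> Basis" for b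
    proof -
      define z where "z \<tau> = (if \<tau> \<in> {0<..<t} then b else 0)" for \<tau>
      have zL: "sq_integrable (leb T) z"
      proof (rule sq_integrable_bounded_by)
        show "z \<in> borel_measurable (leb T)"
          unfolding z_def[abs_def] by (intro measurable_If_set borel_measurable_const) (use t in \<open>auto simp: sets_restrict_space\<close>)
        show "AE t in leb T. norm (z t) \<le> norm b"
          by (simp add: z_def)
      qed (rule sq_integrable_const[OF finite_measure_leb])
      have "(\<integral>\<tau>. k i \<tau> \<bullet> z \<tau> \<partial>leb T) = K i t \<bullet> b" for i
      proof -
        have "(\<integral>\<tau>. k i \<tau> \<bullet> z \<tau> \<partial>leb T) = (\<integral>\<tau>. (if \<tau> \<in> {0<..<t} then k i \<tau> \<bullet> b else 0) \<partial>leb T)"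
          by (rule Bochner_Integration.integral_cong) (auto simp: z_def)
        also have "\<dots> = (\<integral>\<tau>. k i \<tau> \<bullet> b \<partial>leb t)"
          using t by (intro integral_restrict) auto
        also have "\<dots> = (\<integral>\<tau>. k i \<tau> \<partial>leb t) \<bullet> b"
          by (rule integral_inner_left) (rule primitive_integrable_leb[OF K], use t in auto)
        finally show ?thesis
          using K[of i] t K0[of i] by (simp add: primitive_def)
      qed
      then show ?thesis
        using weak[OF zL] by simp
    qed
    then have "(\<lambda>i. \<Sum>b\<in>Basis. (K i t \<bullet> b) *\<^sub>R b) \<longlonglongrightarrow> (\<Sum>b\<in>Basis. 0 *\<^sub>R b)"
      by (intro tendsto_intros)
    then show ?thesis
      by (simp add: euclidean_representation)
  qed
  show ?thesis
  proof (rule uniform_limitI)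
    fix e :: real assume e: "e > 0"
    have C: "C \<ge> 0"
      using order_trans[OF l2norm_nonneg bound[of 0]] .
    \<comment> \<open>Increments over a length \<open>\<delta>\<close> are at most \<open>C \<surd>\<delta>\<close>, which this choice makes at most \<open>e / 2\<close>.\<close>
    define \<delta> where "\<delta> = (e / (2 * (C + 1)))\<^sup>2"
    have \<delta>: "\<delta> > 0"
      using e C by (simp add: \<delta>_def)
    have close': "norm (K i t - K i s) \<le> e / 2" if "0 \<le> s" "s \<le> t" "t \<le> T" "t - s \<le> \<delta>" for i s t
    proof -
      have "norm (K i t - K i s) \<le> sqrt (t - s) * l2norm (leb T) (k i)"
        by (rule primitive_increment_le[OF K that(1-3)])
      also have "\<dots> \<le> sqrt \<delta> * C"
        using that bound by (intro mult_mono) (auto simp: l2norm_nonneg \<delta>[THEN less_imp_le])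
      also have "\<dots> = e / (2 * (C + 1)) * C"
        using e C by (simp add: \<delta>_def)
      also have "\<dots> \<le> e / 2"
        using e C by (simp add: field_simps)
      finally show ?thesis .
    qed
    have close: "norm (K i t - K i s) \<le> e / 2" if "s \<in> {0..T}" "t \<in> {0..T}" "dist s t < \<delta>" for i s t
      using close'[of s t i] close'[of t s i] that
      by (cases "s \<le> t") (auto simp: dist_real_def norm_minus_commute)
    obtain S where S: "finite S" "S \<subseteq> {0..T}" "{0..T} \<subseteq> (\<Union>s\<in>S. ball s \<delta>)"
      using seq_compact_imp_totally_bounded[of "{0..T}"] \<delta> compact_imp_seq_compact[of "{0..T}"] by auto
    have "\<forall>\<^sub>F i in sequentially. \<forall>s\<in>S. dist (K i s) 0 < e / 2"
      using e S(2) by (intro eventually_ball_finite S(1) ballI tendstoD[OF pt]) auto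
    then show "\<forall>\<^sub>F i in sequentially. \<forall>t\<in>{0..T}. dist (K i t) 0 < e"
    proof eventually_elim
      case (elim i)
      show ?case
      proof
        fix t assume t: "t \<in> {0..T}"
        then obtain s where s: "s \<in> S" "dist s t < \<delta>"
          using S(3) by auto
        then have "norm (K i s) < e / 2" "norm (K i t - K i s) \<le> e / 2"
          using elim S(2) t close[of s t i] by auto
        then show "dist (K i t) 0 < e"
          using norm_triangle_sub[of "K i t" "K i s"] by simp
      qed
    qed
  qed
qed

section \<open>A chain inequality for subgradients\<close>

text \<open>Extending \<open>F\<close> to negative times by \<open>F(0)\<close>, through \<open>max 0 (t - h)\<close>, keeps all backward increments on
  the same interval; only two boundary terms survive the shift.\<close>

lemma integral_backward_shift:
  fixes F :: "real \<Rightarrow> real"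
  assumes F: "continuous_on {0..T} F" and h: "0 < h" "h \<le> T"
  shows "(\<integral>t. F t - F (max 0 (t - h)) \<partial>leb T) = integral {T - h..T} F - h * F 0"
proof -
  have shifted: "continuous_on {0..T} (\<lambda>t. F (max 0 (t - h)))"
    by (rule continuous_on_compose2[OF F]) (use h in \<open>auto intro!: continuous_intros\<close>)
  note int = integrable_continuous_real[OF F] integrable_continuous_real[OF shifted]
  have "integral {0..h} (\<lambda>t. F (max 0 (t - h))) = integral {0..h} (\<lambda>t. F 0)"
    by (rule Henstock_Kurzweil_Integration.integral_cong) (auto simp: max_def)
  moreover have "integral {h..T} (\<lambda>t. F (max 0 (t - h))) = integral {h..T} (\<lambda>t. F (t + - h))"
    by (rule Henstock_Kurzweil_Integration.integral_cong) (auto simp: max_def)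
  moreover have "integral {h..T} (\<lambda>t. F (t + - h)) = integral {0..T - h} F"
    using integral_shift_real_ivl[of 0 "- h" "T - h" F] by simp
  moreover have "integral {0..h} (\<lambda>t. F (max 0 (t - h))) + integral {h..T} (\<lambda>t. F (max 0 (t - h)))
      = integral {0..T} (\<lambda>t. F (max 0 (t - h)))"
    by (rule Henstock_Kurzweil_Integration.integral_combine) (use h int in auto)
  moreover have "integral {0..T - h} F + integral {T - h..T} F = integral {0..T} F"
    by (rule Henstock_Kurzweil_Integration.integral_combine) (use h int in auto)
  moreover have "(\<integral>t. F t - F (max 0 (t - h)) \<partial>leb T) = integral {0..T} (\<lambda>t. F t - F (max 0 (t - h)))"
    by (rule integral_leb_eq[OF _ order_refl]) (intro continuous_on_imp_integrable_leb continuous_intros F shifted)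
  moreover have "integral {0..T} (\<lambda>t. F t - F (max 0 (t - h))) = integral {0..T} F - integral {0..T} (\<lambda>t. F (max 0 (t - h)))"
    by (rule Henstock_Kurzweil_Integration.integral_diff[OF int])
  ultimately show ?thesis
    using h by simp
qed

text \<open>The backward increments of a primitive are controlled on average by those of
  the indefinite integral \<open>W\<close> of \<open>\<bar>v\<bar>\<close>. As \<open>W\<close> is increasing, the average of its difference quotients
  is at most \<open>W(T)\<close>.\<close>

lemma integral_backward_increment_le:
  fixes u v :: "real \<Rightarrow> 'a::euclidean_space"
  assumes uv: "primitive T u v" and h: "0 < h" "h \<le> T"
  shows "(\<integral>t. norm (u t - u (max 0 (t - h))) \<partial>leb T) \<le> h * (\<integral>t. norm (v t) \<partial>leb T)"
proof -
  have v_int: "integrable (leb T) (\<lambda>t. norm (v t))"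
    by (intro integrable_norm primitive_integrable_leb[OF uv]) simp
  define W where "W t = integral {0..t} (\<lambda>s. norm (v s))" for t
  have v_HK: "(\<lambda>s. norm (v s)) integrable_on {0..T}"
    by (rule integrable_leb_imp_integrable_on[OF v_int])
  have W: "continuous_on {0..T} W"
    unfolding W_def by (rule indefinite_integral_continuous_1[OF v_HK])
  have u: "continuous_on {0..T} u"
    by (rule primitive_continuous[OF uv])
  have shift: "continuous_on {0..T} (\<lambda>t. f (max 0 (t - h)))" if "continuous_on {0..T} f"
    for f :: "real \<Rightarrow> 'c::topological_space"
    by (rule continuous_on_compose2[OF that]) (use h in \<open>auto intro!: continuous_intros\<close>)
  have incr: "norm (u t - u s) \<le> W t - W s" if "0 \<le> s" "s \<le> t" "t \<le> T" for s t
  proof -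
    have v_on: "v integrable_on {s..t}" "(\<lambda>s. norm (v s)) integrable_on {s..t}"
      using integrable_leb_imp_integrable_on[OF primitive_integrable_leb[OF uv order_refl]] v_HK that
      by (auto intro: integrable_subinterval_real)
    have "norm (u t - u s) \<le> integral {s..t} (\<lambda>s. norm (v s))"
      unfolding primitive_increment[OF uv that] by (rule integral_norm_bound_integral[OF v_on]) simp
    also have "\<dots> = W t - W s"
    proof -
      have "(\<lambda>s. norm (v s)) integrable_on {0..t}"
        using v_HK that by (auto intro: integrable_subinterval_real)
      then show ?thesis
        using Henstock_Kurzweil_Integration.integral_combine[of 0 s t "\<lambda>s. norm (v s)"] that
        unfolding W_def by simp
    qed
    finally show ?thesis .
  qed
  have "(\<integral>t. norm (u t - u (max 0 (t - h))) \<partial>leb T) \<le> (\<integral>t. W t - W (max 0 (t - h)) \<partial>leb T)"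
  proof (rule integral_mono)
    show "norm (u t - u (max 0 (t - h))) \<le> W t - W (max 0 (t - h))" if "t \<in> space (leb T)" for t
      using that h by (intro incr) auto
  qed (intro continuous_on_imp_integrable_leb continuous_intros u W shift)+
  also have "\<dots> = integral {T - h..T} W - h * W 0"
    by (rule integral_backward_shift[OF W h])
  also have "\<dots> = integral {T - h..T} W"
    by (simp add: W_def)
  also have "\<dots> \<le> integral {T - h..T} (\<lambda>t. W T)"
  proof (rule integral_le)
    show "W integrable_on {T - h..T}"
      by (rule integrable_continuous_real[OF continuous_on_subset[OF W]]) (use h in auto)
    show "W t \<le> W T" if "t \<in> {T - h..T}" for t
    proof -
      have "0 \<le> W T - W t"
        by (rule order_trans[OF norm_ge_zero incr]) (use that h in auto)
      then show ?thesis by simp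
    qed
  qed auto
  also have "\<dots> = h * W T"
    using h by simp
  also have "W T = (\<integral>t. norm (v t) \<partial>leb T)"
    unfolding W_def by (rule integral_leb_eq[symmetric, OF v_int order_refl])
  finally show ?thesis .
qed

text \<open>For continuous \<open>v\<close> the assertion is uniform continuity. Backward difference quotients and
  weights at most one are stable in \<open>L\<^sup>1\<close>, so that the general case follows by density.\<close>

lemma backward_quotients_converge:
  fixes u v :: "real \<Rightarrow> 'a::euclidean_space"
  assumes T: "0 < T" and uv: "primitive T u v" and e: "0 < e"
  shows "\<exists>\<delta>>0. \<forall>h. 0 < h \<and> h \<le> T \<and> h < \<delta> \<longrightarrow>
    (\<integral>t. norm (u t - u (max 0 (t - h)) - (t - max 0 (t - h)) *\<^sub>R v t) \<partial>leb T) \<le> h * e"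
proof -
  define \<eta> where "\<eta> = e / (3 * (sqrt T + 1))"
  have "sqrt T + 1 > 0"
    using T by (simp add: add_pos_pos)
  then have \<eta>: "\<eta> > 0" "sqrt T * \<eta> \<le> e / 3"
    using e by (auto simp: \<eta>_def field_simps)
  obtain c where c: "continuous_on UNIV c" "l2norm (leb T) (\<lambda>t. v t - c t) < \<eta>"
    using continuous_dense_l2[OF primitive_sq_integrable[OF uv] \<eta>(1)] by blast
  have cT: "continuous_on {0..T} c"
    using c(1) continuous_on_subset by blast
  note cL = continuous_on_imp_sq_integrable[OF cT]
  define U where "U t = u 0 + (\<integral>\<tau>. c \<tau> \<partial>leb t)" for t
  have Uc: "primitive T U c"
    unfolding U_def by (rule primitive_indefinite_integral[OF cL])
  note dw = primitive_diff[OF uv Uc]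
  define J where "J = (\<integral>t. norm (v t - c t) \<partial>leb T)"
  have J: "J \<le> e / 3"
  proof -
    have "J \<le> sqrt (T - 0) * l2norm (leb T) (\<lambda>t. v t - c t)"
      unfolding J_def by (rule integral_norm_le_l2norm[OF primitive_sq_integrable[OF dw]]) (use T in simp)
    also have "\<dots> \<le> sqrt T * \<eta>"
      using c(2) T by (intro mult_mono) (auto simp: l2norm_nonneg)
    finally show ?thesis using \<eta>(2) by linarith
  qed
  have "uniformly_continuous_on {0..T} c"
    by (rule compact_uniformly_continuous[OF cT]) simp
  then obtain \<delta> where \<delta>: "\<delta> > 0"
    "\<And>s t. s \<in> {0..T} \<Longrightarrow> t \<in> {0..T} \<Longrightarrow> dist s t < \<delta> \<Longrightarrow> dist (c s) (c t) < e / (3 * T)"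
    unfolding uniformly_continuous_on_def using e T by (metis divide_pos_pos mult_pos_pos zero_less_numeral)
  show ?thesis
  proof (intro exI[of _ \<delta>] conjI allI impI \<delta>(1))
    fix h assume h: "0 < h \<and> h \<le> T \<and> h < \<delta>"
    define \<tau> where "\<tau> t = max 0 (t - h)" for t
    have \<tau>: "\<tau> t \<in> {0..T}" "\<tau> t \<le> t" "t - \<tau> t \<le> h" if "t \<in> {0..T}" for t
      using that h by (auto simp: \<tau>_def)
    have \<tau>_cont: "continuous_on {0..T} \<tau>"
      unfolding \<tau>_def by (intro continuous_intros)
    have shift: "continuous_on {0..T} (\<lambda>t. f (\<tau> t))" if "continuous_on {0..T} f"
      for f :: "real \<Rightarrow> 'a"
      by (rule continuous_on_compose2[OF that \<tau>_cont]) (use \<tau> in auto)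
    have U_incr: "norm (U t - U (\<tau> t) - (t - \<tau> t) *\<^sub>R c t) \<le> h * (e / (3 * T))" if t: "t \<in> {0..T}" for t
    proof -
      have c_sub: "continuous_on {\<tau> t..t} c"
        by (rule continuous_on_subset[OF cT]) (use \<tau>[OF t] t in auto)
      have "U t - U (\<tau> t) - (t - \<tau> t) *\<^sub>R c t = integral {\<tau> t..t} (\<lambda>s. c s - c t)"
        using primitive_increment[OF Uc, of "\<tau> t" t] \<tau>[OF t] t
          Henstock_Kurzweil_Integration.integral_diff[OF integrable_continuous_real[OF c_sub]
            integrable_continuous_real[OF continuous_on_const[of _ "c t"]]]
        by simp
      also have "norm \<dots> \<le> e / (3 * T) * (t - \<tau> t)"
      proof (rule integral_bound)
        show "continuous_on {\<tau> t..t} (\<lambda>s. c s - c t)"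
          by (intro continuous_intros c_sub)
        fix s assume "s \<in> {\<tau> t..t}"
        then have "dist (c s) (c t) < e / (3 * T)"
          using \<tau>[OF t] t h by (intro \<delta>(2)) (auto simp: dist_real_def)
        then show "norm (c s - c t) \<le> e / (3 * T)"
          by (simp add: dist_norm)
      qed (rule \<tau>(2)[OF t])
      also have "\<dots> \<le> e / (3 * T) * h"
        using \<tau>[OF t] e T by (intro mult_left_mono) auto
      finally show ?thesis by (simp add: mult.commute)
    qed
    have w_int: "integrable (leb T) (\<lambda>t. norm (v t - c t))"
      by (intro integrable_norm primitive_integrable_leb[OF dw]) simp
    have d_cont: "continuous_on {0..T} (\<lambda>t. u t - U t)"
      by (rule primitive_continuous[OF dw])
    have u_cont: "continuous_on {0..T} u"
      by (rule primitive_continuous[OF uv])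
    have d_int: "integrable (leb T) (\<lambda>t. norm (u t - U t - (u (\<tau> t) - U (\<tau> t))))"
      by (intro continuous_on_imp_integrable_leb continuous_on_norm continuous_on_diff[OF d_cont shift[OF d_cont]])
    have v_meas: "v \<in> borel_measurable (leb T)"
      by (rule sq_integrable_measurable[OF primitive_sq_integrable[OF uv]])
    have "(\<integral>t. norm (u t - u (\<tau> t) - (t - \<tau> t) *\<^sub>R v t) \<partial>leb T)
      \<le> (\<integral>t. norm (u t - U t - (u (\<tau> t) - U (\<tau> t))) + h * norm (v t - c t) + h * (e / (3 * T)) \<partial>leb T)"
    proof (rule integral_mono')
      show "integrable (leb T) (\<lambda>t. norm (u t - U t - (u (\<tau> t) - U (\<tau> t))) + h * norm (v t - c t) + h * (e / (3 * T)))"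
        using d_int w_int finite_measure.integrable_const[OF finite_measure_leb]
        by (intro Bochner_Integration.integrable_add integrable_mult_right) auto
      fix t assume "t \<in> space (leb T)"
      then have t: "t \<in> {0..T}" by auto
      define A where "A = u t - U t - (u (\<tau> t) - U (\<tau> t))"
      define B where "B = (t - \<tau> t) *\<^sub>R (v t - c t)"
      define D where "D = U t - U (\<tau> t) - (t - \<tau> t) *\<^sub>R c t"
      have split: "u t - u (\<tau> t) - (t - \<tau> t) *\<^sub>R v t = A - B + D"
        by (simp add: A_def B_def D_def algebra_simps)
      have "norm B \<le> h * norm (v t - c t)"
        using \<tau>(2,3)[OF t] by (simp add: B_def mult_right_mono)
      moreover have "norm D \<le> h * (e / (3 * T))"
        unfolding D_def by (rule U_incr[OF t])
      moreover have "norm (A - B + D) \<le> norm A + norm B + norm D"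
        by (rule order_trans[OF norm_triangle_ineq add_right_mono[OF norm_triangle_ineq4]])
      ultimately have "norm (A - B + D) \<le> norm A + h * norm (v t - c t) + h * (e / (3 * T))"
        by linarith
      then show "norm (u t - u (\<tau> t) - (t - \<tau> t) *\<^sub>R v t)
          \<le> norm (u t - U t - (u (\<tau> t) - U (\<tau> t))) + h * norm (v t - c t) + h * (e / (3 * T))"
        unfolding split A_def .
    qed (use h e T in \<open>auto intro!: add_nonneg_nonneg divide_nonneg_pos mult_nonneg_nonneg\<close>)
    also have "\<dots> = (\<integral>t. norm (u t - U t - (u (\<tau> t) - U (\<tau> t))) \<partial>leb T) + h * J + h * (e / 3)"
    proof -
      have hw: "integrable (leb T) (\<lambda>t. h * norm (v t - c t))"
        by (rule integrable_mult_right) (use w_int in simp)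
      note const = finite_measure.integrable_const[OF finite_measure_leb, of T "h * (e / (3 * T))"]
      have "(\<integral>t. h * (e / (3 * T)) \<partial>leb T) = h * (e / 3)"
        using T by (simp add: measure_restrict_space)
      moreover have "(\<integral>t. h * norm (v t - c t) \<partial>leb T) = h * J"
        by (simp add: J_def)
      ultimately show ?thesis
        unfolding Bochner_Integration.integral_add[OF Bochner_Integration.integrable_add[OF d_int hw] const]
          Bochner_Integration.integral_add[OF d_int hw] by (simp only:)
    qed
    also have "(\<integral>t. norm (u t - U t - (u (\<tau> t) - U (\<tau> t))) \<partial>leb T) \<le> h * J"
      unfolding J_def \<tau>_def by (rule integral_backward_increment_le[OF dw]) (use h in auto)
    also have "h * J + h * J + h * (e / 3) \<le> h * e"
    proof -
      have "h * J \<le> h * (e / 3)"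
        using h J by (intro mult_left_mono) auto
      then have "h * J + h * J + h * (e / 3) \<le> 3 * (h * (e / 3))"
        by linarith
      then show ?thesis by simp
    qed
    finally show "(\<integral>t. norm (u t - u (max 0 (t - h)) - (t - max 0 (t - h)) *\<^sub>R v t) \<partial>leb T) \<le> h * e"
      by (simp add: \<tau>_def)
  qed
qed

text \<open>\<open>G\<close> is a bounded measurable selection of subgradients along the curve \<open>u\<close> of the convex function
  whose values along \<open>u\<close> are \<open>F\<close>. The subgradient inequality at time \<open>t\<close>, tested with the earlier point
  \<open>u (t - h)\<close>, is averaged over \<open>t\<close> and divided by \<open>h\<close>. As \<open>h\<close> tends to \<open>0\<close> the averages of the increments of \<open>F\<close>
  telescope to its boundary values, and the difference quotients of \<open>u\<close> converge to \<open>v\<close> in \<open>L\<^sup>1\<close>, against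
  which the bounded \<open>G\<close> may be paired.\<close>

theorem subgradient_chain_inequality:
  fixes u v G :: "real \<Rightarrow> 'a::euclidean_space"
  assumes T: "0 < T" and uv: "primitive T u v" and F: "continuous_on {0..T} F"
    and G: "G \<in> borel_measurable (leb T)" and G_le: "AE t in leb T. norm (G t) \<le> C"
    and sub: "AE t in leb T. \<forall>s\<in>{0..T}. F t + G t \<bullet> (u s - u t) \<le> F s"
  shows "F T - F 0 \<le> (\<integral>t. G t \<bullet> v t \<partial>leb T)"
proof -
  define h where "h n = T / (real n + 1)" for n :: nat
  have h: "0 < h n" "h n \<le> T" for n
    using T by (auto simp: h_def field_simps)
  have h_lim: "h \<longlonglongrightarrow> 0"
    using tendsto_mult[OF tendsto_const[of T] LIMSEQ_inverse_real_of_nat]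
    by (simp add: h_def[abs_def] divide_inverse add.commute)
  define \<tau> where "\<tau> n t = max 0 (t - h n)" for n t
  have \<tau>: "\<tau> n t \<in> {0..T}" "\<tau> n t \<le> t" "t - \<tau> n t \<le> h n" if "t \<in> {0..T}" for n t
    using that h[of n] by (auto simp: \<tau>_def)
  have \<tau>_cont: "continuous_on {0..T} (\<tau> n)" for n
    unfolding \<tau>_def by (intro continuous_intros)
  have u: "continuous_on {0..T} u"
    by (rule primitive_continuous[OF uv])
  have u_shift: "continuous_on {0..T} (\<lambda>t. u (\<tau> n t))" and F_shift: "continuous_on {0..T} (\<lambda>t. F (\<tau> n t))" for n
    using \<tau> by (auto intro!: continuous_on_compose2[OF u \<tau>_cont] continuous_on_compose2[OF F \<tau>_cont])
  have v: "sq_integrable (leb T) v"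
    by (rule primitive_sq_integrable[OF uv])
  have G_sq: "sq_integrable (leb T) G"
    by (rule sq_integrable_bounded_by[OF G sq_integrable_const[OF finite_measure_leb, of T C]])
       (use G_le in \<open>auto elim: eventually_mono\<close>)
  define \<theta> where "\<theta> n t = (t - \<tau> n t) / h n" for n t
  have \<theta>_meas: "\<theta> n \<in> borel_measurable (leb T)" for n
    unfolding \<theta>_def by (intro continuous_on_imp_borel_leb continuous_intros \<tau>_cont) (use h[of n] in auto)
  have \<theta>01: "0 \<le> \<theta> n t" "\<theta> n t \<le> 1" if "t \<in> {0..T}" for n t
    using \<tau>[OF that, of n] h[of n] by (auto simp: \<theta>_def field_simps)
  have \<theta>_le: "AE t in leb T. norm (\<theta> n t * (G t \<bullet> v t)) \<le> norm (G t \<bullet> v t)" for n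
    by (rule AE_leb_I) (use \<theta>01[of _ n] in \<open>simp add: abs_mult mult_left_le_one_le\<close>)
  define err where "err n = (\<integral>t. norm (u t - u (\<tau> n t) - (t - \<tau> n t) *\<^sub>R v t) \<partial>leb T) / h n" for n
  have C: "AE t in leb T. norm (G t) \<le> \<bar>C\<bar>"
    using G_le by (rule eventually_mono) simp
  \<comment> \<open>The averaged inequality for a fixed step: replacing the increment of \<open>u\<close> by \<open>v\<close>, weighted with the
    length of the step, costs the error \<open>err n\<close>.\<close>
  have ineq: "integral {T - h n..T} F / h n - F 0 \<le> (\<integral>t. \<theta> n t * (G t \<bullet> v t) \<partial>leb T) + \<bar>C\<bar> * err n" for n
  proof -
    define r where "r t = u t - u (\<tau> n t) - (t - \<tau> n t) *\<^sub>R v t" for t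
    have r_sq: "sq_integrable (leb T) r"
    proof -
      have "sq_integrable (leb T) (\<lambda>t. (t - \<tau> n t) *\<^sub>R v t)"
      proof (rule sq_integrable_bounded_by[OF _ sq_integrable_scaleR[OF v, of "h n"]])
        show "(\<lambda>t. (t - \<tau> n t) *\<^sub>R v t) \<in> borel_measurable (leb T)"
          by (intro borel_measurable_scaleR sq_integrable_measurable[OF v] continuous_on_imp_borel_leb
              continuous_intros \<tau>_cont)
        show "AE t in leb T. norm ((t - \<tau> n t) *\<^sub>R v t) \<le> norm (h n *\<^sub>R v t)"
        proof (rule AE_leb_I)
          fix t assume "0 < t" "t < T"
          then show "norm ((t - \<tau> n t) *\<^sub>R v t) \<le> norm (h n *\<^sub>R v t)"
            using \<tau>(2,3)[of t n] h[of n] by (simp add: mult_right_mono)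
        qed
      qed
      from sq_integrable_diff[OF continuous_on_imp_sq_integrable[OF continuous_on_diff[OF u u_shift]] this]
      show ?thesis
        unfolding r_def .
    qed
    have \<theta>_sq: "integrable (leb T) (\<lambda>t. \<theta> n t * (G t \<bullet> v t))"
    proof (rule Bochner_Integration.integrable_bound[OF sq_integrable_inner[OF G_sq v]])
      show "AE t in leb T. norm (\<theta> n t * (G t \<bullet> v t)) \<le> norm (G t \<bullet> v t)"
        by (rule \<theta>_le)
    qed (use \<theta>_meas G v in \<open>auto simp: sq_integrable_def\<close>)
    have "(\<integral>t. F t - F (\<tau> n t) \<partial>leb T) \<le> (\<integral>t. h n * (\<theta> n t * (G t \<bullet> v t)) + \<bar>C\<bar> * norm (r t) \<partial>leb T)"
    proof (rule integral_mono_AE)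
      show "integrable (leb T) (\<lambda>t. F t - F (\<tau> n t))"
        by (intro continuous_on_imp_integrable_leb continuous_intros F F_shift)
      show "integrable (leb T) (\<lambda>t. h n * (\<theta> n t * (G t \<bullet> v t)) + \<bar>C\<bar> * norm (r t))"
        using \<theta>_sq sq_integrable_imp_integrable[OF r_sq] by auto
      show "AE t in leb T. F t - F (\<tau> n t) \<le> h n * (\<theta> n t * (G t \<bullet> v t)) + \<bar>C\<bar> * norm (r t)"
        using AE_leb_interior[OF sub] C
      proof eventually_elim
        case (elim t)
        then have "F t + G t \<bullet> (u (\<tau> n t) - u t) \<le> F (\<tau> n t)"
          using \<tau>(1)[of t n] by auto
        then have "F t - F (\<tau> n t) \<le> G t \<bullet> (u t - u (\<tau> n t))"
          by (simp add: inner_diff_right)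
        also have "\<dots> = (t - \<tau> n t) * (G t \<bullet> v t) + G t \<bullet> r t"
          by (simp add: r_def inner_diff_right)
        also have "(t - \<tau> n t) * (G t \<bullet> v t) = h n * (\<theta> n t * (G t \<bullet> v t))"
          using h[of n] by (simp add: \<theta>_def)
        also have "G t \<bullet> r t \<le> \<bar>C\<bar> * norm (r t)"
          using elim by (intro order_trans[OF norm_cauchy_schwarz] mult_right_mono) auto
        finally show ?case by simp
      qed
    qed
    also have "\<dots> = h n * (\<integral>t. \<theta> n t * (G t \<bullet> v t) \<partial>leb T) + \<bar>C\<bar> * (h n * err n)"
      using \<theta>_sq sq_integrable_imp_integrable[OF r_sq] h[of n] by (simp add: err_def r_def[symmetric])
    also have "(\<integral>t. F t - F (\<tau> n t) \<partial>leb T) = integral {T - h n..T} F - h n * F 0"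
      unfolding \<tau>_def by (rule integral_backward_shift[OF F h])
    finally have "(integral {T - h n..T} F - h n * F 0) / h n
        \<le> (h n * (\<integral>t. \<theta> n t * (G t \<bullet> v t) \<partial>leb T) + \<bar>C\<bar> * (h n * err n)) / h n"
      using h[of n] by (intro divide_right_mono) auto
    then show ?thesis
      using h[of n] by (simp add: diff_divide_distrib add_divide_distrib)
  qed
  have lim_F: "(\<lambda>n. integral {T - h n..T} F / h n) \<longlonglongrightarrow> F T"
  proof -
    define \<Phi> where "\<Phi> t = integral {0..t} F" for t
    have "(\<Phi> has_vector_derivative F T) (at T within {0..T})"
      unfolding \<Phi>_def by (rule integral_has_vector_derivative[OF F]) (use T in simp)
    then have "(\<Phi> has_real_derivative F T) (at T within {0..T})"
      by (simp add: has_real_derivative_iff_has_vector_derivative)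
    then have "((\<lambda>y. (\<Phi> y - \<Phi> T) / (y - T)) \<longlongrightarrow> F T) (at T within {0..T})"
      by (simp add: has_field_derivative_iff)
    moreover have "filterlim (\<lambda>n. T - h n) (at T within {0..T}) sequentially"
      unfolding filterlim_at
    proof
      show "(\<lambda>n. T - h n) \<longlonglongrightarrow> T"
        using tendsto_diff[OF tendsto_const h_lim, of T] by simp
      show "\<forall>\<^sub>F n in sequentially. T - h n \<in> {0..T} \<and> T - h n \<noteq> T"
      proof (intro always_eventually allI)
        show "T - h n \<in> {0..T} \<and> T - h n \<noteq> T" for n
          using h[of n] by simp
      qed
    qed
    ultimately have "(\<lambda>n. (\<Phi> (T - h n) - \<Phi> T) / (T - h n - T)) \<longlonglongrightarrow> F T"
      by (rule filterlim_compose)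
    moreover have "(\<Phi> (T - h n) - \<Phi> T) / (T - h n - T) = integral {T - h n..T} F / h n" for n
    proof -
      have "\<Phi> (T - h n) + integral {T - h n..T} F = \<Phi> T"
        unfolding \<Phi>_def
        by (rule Henstock_Kurzweil_Integration.integral_combine) (use h[of n] integrable_continuous_real[OF F] in auto)
      then have diff: "\<Phi> (T - h n) - \<Phi> T = - integral {T - h n..T} F"
        by (simp add: algebra_simps)
      show ?thesis
        unfolding diff by simp
    qed
    ultimately show ?thesis by simp
  qed
  \<comment> \<open>The weight \<open>\<theta> n\<close> differs from \<open>1\<close> only on the initial interval of length \<open>h n\<close>.\<close>
  have lim_\<theta>: "(\<lambda>n. \<integral>t. \<theta> n t * (G t \<bullet> v t) \<partial>leb T) \<longlonglongrightarrow> (\<integral>t. G t \<bullet> v t \<partial>leb T)"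
  proof (rule integral_dominated_convergence[where w = "\<lambda>t. norm (G t \<bullet> v t)"])
    show "integrable (leb T) (\<lambda>t. norm (G t \<bullet> v t))"
      by (intro integrable_norm sq_integrable_inner G_sq v)
    show "AE t in leb T. norm (\<theta> n t * (G t \<bullet> v t)) \<le> norm (G t \<bullet> v t)" for n
      by (rule \<theta>_le)
    show "AE t in leb T. (\<lambda>n. \<theta> n t * (G t \<bullet> v t)) \<longlonglongrightarrow> G t \<bullet> v t"
    proof (rule AE_leb_I)
      fix t assume t: "0 < t" "t < T"
      have "\<forall>\<^sub>F n in sequentially. h n < t"
        by (rule order_tendstoD(2)[OF h_lim t(1)])
      then have "\<forall>\<^sub>F n in sequentially. \<theta> n t * (G t \<bullet> v t) = G t \<bullet> v t"
      proof eventually_elim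
        case (elim n)
        then show ?case
          using h[of n] by (simp add: \<theta>_def \<tau>_def)
      qed
      then show "(\<lambda>n. \<theta> n t * (G t \<bullet> v t)) \<longlonglongrightarrow> G t \<bullet> v t"
        by (rule tendsto_eventually)
    qed
  qed (use \<theta>_meas G v in \<open>auto simp: sq_integrable_def\<close>)
  have lim_err: "err \<longlonglongrightarrow> 0"
  proof (rule tendstoI)
    fix e :: real assume e: "e > 0"
    obtain \<delta> where \<delta>: "\<delta> > 0" "\<And>h. 0 < h \<Longrightarrow> h \<le> T \<Longrightarrow> h < \<delta> \<Longrightarrow>
      (\<integral>t. norm (u t - u (max 0 (t - h)) - (t - max 0 (t - h)) *\<^sub>R v t) \<partial>leb T) \<le> h * (e / 2)"
      using backward_quotients_converge[OF T uv half_gt_zero[OF e]] by blast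
    have "\<forall>\<^sub>F n in sequentially. h n < \<delta>"
      by (rule order_tendstoD(2)[OF h_lim \<delta>(1)])
    then show "\<forall>\<^sub>F n in sequentially. dist (err n) 0 < e"
    proof eventually_elim
      case (elim n)
      have "err n \<ge> 0"
        using h[of n] by (simp add: err_def)
      moreover have "err n \<le> e / 2"
        using \<delta>(2)[OF h elim] h[of n] by (simp add: err_def \<tau>_def field_simps)
      ultimately show ?case
        using e by simp
    qed
  qed
  have "F T - F 0 \<le> (\<integral>t. G t \<bullet> v t \<partial>leb T) + \<bar>C\<bar> * 0"
    by (rule LIMSEQ_le[OF tendsto_diff[OF lim_F tendsto_const] tendsto_add[OF lim_\<theta> tendsto_mult[OF tendsto_const lim_err]]])
       (use ineq in auto)
  then show ?thesis by simp
qed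

lemma half_norm_squared_chain_inequality:
  assumes "0 < T" "primitive T u v"
  shows "(norm (u T))\<^sup>2 / 2 - (norm (u 0))\<^sup>2 / 2 \<le> (\<integral>t. u t \<bullet> v t \<partial>leb T)"
proof -
  have u: "continuous_on {0..T} u"
    by (rule primitive_continuous[OF assms(2)])
  have "bounded (u ` {0..T})"
    using u by (intro compact_imp_bounded compact_continuous_image) auto
  then obtain C where C: "\<And>t. t \<in> {0..T} \<Longrightarrow> norm (u t) \<le> C"
    unfolding bounded_iff by blast
  show ?thesis
  proof (rule subgradient_chain_inequality[OF assms, where C = C])
    show "continuous_on {0..T} (\<lambda>t. (norm (u t))\<^sup>2 / 2)"
      by (intro continuous_intros u) simp
    show "AE t in leb T. norm (u t) \<le> C"
      by (rule AE_leb_I) (use C in auto)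
    have "(norm x)\<^sup>2 / 2 + x \<bullet> (y - x) \<le> (norm y)\<^sup>2 / 2" for x y :: 'a
      using inner_ge_zero[of "y - x"] by (simp add: power2_norm_eq_inner algebra_simps inner_commute)
    then show "AE t in leb T. \<forall>s\<in>{0..T}. (norm (u t))\<^sup>2 / 2 + u t \<bullet> (u s - u t) \<le> (norm (u s))\<^sup>2 / 2"
      by simp
  qed (rule continuous_on_imp_borel_leb[OF u])
qed

section \<open>Energies of a weighted hypergraph\<close>

lemma GDERIV_imp_subgradient:
  fixes f :: "'a::euclidean_space \<Rightarrow> real"
  assumes f: "convex_on UNIV f" and D: "GDERIV f x :> D"
  shows "f x + D \<bullet> (z - x) \<le> f z"
proof -
  define g where "g t = f (x + t *\<^sub>R (z - x))" for t :: real
  have "convex_on UNIV g"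
    unfolding convex_on_alt
  proof (intro conjI ballI allI impI)
    fix s t \<mu> :: real assume "0 \<le> \<mu> \<and> \<mu> \<le> 1"
    moreover have "x + (\<mu> *\<^sub>R s + (1 - \<mu>) *\<^sub>R t) *\<^sub>R (z - x)
        = \<mu> *\<^sub>R (x + s *\<^sub>R (z - x)) + (1 - \<mu>) *\<^sub>R (x + t *\<^sub>R (z - x))"
      by (simp add: algebra_simps)
    ultimately show "g (\<mu> *\<^sub>R s + (1 - \<mu>) *\<^sub>R t) \<le> \<mu> * g s + (1 - \<mu>) * g t"
      using f unfolding g_def convex_on_alt by auto
  qed simp
  moreover have "(g has_real_derivative D \<bullet> (z - x)) (at 0)"
  proof -
    have "((\<lambda>t. x + t *\<^sub>R (z - x)) has_derivative (\<lambda>t. t *\<^sub>R (z - x))) (at (0::real))"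
      by (auto intro!: derivative_eq_intros)
    moreover have "(f has_derivative (\<lambda>h. h \<bullet> D)) (at (x + 0 *\<^sub>R (z - x)))"
      using D by (simp add: gderiv_def)
    ultimately have "(g has_derivative (\<lambda>t. (t *\<^sub>R (z - x)) \<bullet> D)) (at 0)"
      unfolding g_def by (rule has_derivative_compose)
    moreover have "(\<lambda>t. (t *\<^sub>R (z - x)) \<bullet> D) = (*) (D \<bullet> (z - x))"
      by (simp add: fun_eq_iff inner_commute)
    ultimately show ?thesis
      unfolding has_field_derivative_def by simp
  qed
  ultimately have "D \<bullet> (z - x) * (1 - 0) \<le> g 1 - g 0"
    by (intro convex_on_imp_above_tangent[of UNIV]) auto
  then show ?thesis
    by (simp add: g_def)
qed

text \<open>Test with the point at distance one in the direction of the subgradient.\<close>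

lemma subgradient_norm_le:
  fixes f :: "'a::euclidean_space \<Rightarrow> real"
  assumes sub: "\<And>z. f x + G \<bullet> (z - x) \<le> f z" and nonneg: "0 \<le> f x"
    and x: "norm x \<le> R" and bound: "\<And>z. norm z \<le> R + 1 \<Longrightarrow> f z \<le> M"
  shows "norm G \<le> M"
proof (cases "G = 0")
  case True
  then show ?thesis
    using nonneg bound[of x] x by simp
next
  case False
  define z where "z = x + (1 / norm G) *\<^sub>R G"
  have "norm z \<le> norm x + norm ((1 / norm G) *\<^sub>R G)"
    unfolding z_def by (rule norm_triangle_ineq)
  then have "f z \<le> M"
    using False x by (intro bound) simp
  moreover have "G \<bullet> (z - x) = norm G"
    using False by (simp add: z_def dot_square_norm power2_eq_square)
  ultimately show ?thesis
    using sub[of z] nonneg by simp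
qed

lemma edge_max_ge:
  assumes "i \<in> e" "j \<in> e"
  shows "\<bar>x $ i - x $ j\<bar> \<le> edge_max e x"
  unfolding edge_max_def
proof (rule Max_ge)
  have "{\<bar>x $ i - x $ j\<bar> | i j. i \<in> e \<and> j \<in> e} = (\<lambda>(i, j). \<bar>x $ i - x $ j\<bar>) ` (e \<times> e)"
    by auto
  then show "finite {\<bar>x $ i - x $ j\<bar> | i j. i \<in> e \<and> j \<in> e}"
    by simp
qed (use assms in auto)

lemma edge_max_attained:
  assumes "e \<noteq> {}"
  obtains i j where "i \<in> e" "j \<in> e" "edge_max e x = \<bar>x $ i - x $ j\<bar>"
proof -
  have eq: "{\<bar>x $ i - x $ j\<bar> | i j. i \<in> e \<and> j \<in> e} = (\<lambda>(i, j). \<bar>x $ i - x $ j\<bar>) ` (e \<times> e)"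
    by auto
  have "edge_max e x \<in> {\<bar>x $ i - x $ j\<bar> | i j. i \<in> e \<and> j \<in> e}"
    unfolding edge_max_def by (rule Max_in) (use assms in \<open>auto simp: eq\<close>)
  then show ?thesis
    using that by auto
qed

lemma edge_max_nonneg: "e \<noteq> {} \<Longrightarrow> 0 \<le> edge_max e x"
  by (erule edge_max_attained[of e x]) simp

lemma edge_max_le_norm: "e \<noteq> {} \<Longrightarrow> edge_max e x \<le> 2 * norm x"
proof (erule edge_max_attained[of e x])
  fix i j assume "edge_max e x = \<bar>x $ i - x $ j\<bar>"
  then show ?thesis
    using component_le_norm_cart[of x i] component_le_norm_cart[of x j] by linarith
qed

definition edge_sum :: "real \<Rightarrow> 'v::finite set \<Rightarrow> real ^ 'v \<Rightarrow> real" where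
  "edge_sum q e x = (1 / 2) * (\<Sum>i\<in>e. \<Sum>j\<in>e. \<bar>x $ i - x $ j\<bar> powr q)"

lemma edge_sum_nonneg: "0 \<le> edge_sum q e x"
  by (simp add: edge_sum_def sum_nonneg)

lemma edge_norm_eq: "edge_norm q e x = edge_sum q e x powr (1 / q)"
  by (simp add: edge_norm_def edge_sum_def)

lemma edge_norm_nonneg: "0 \<le> edge_norm q e x"
  by (simp add: edge_norm_def)

lemma edge_norm_powr: "0 < q \<Longrightarrow> edge_norm q e x powr q = edge_sum q e x"
  by (simp add: edge_norm_eq powr_powr edge_sum_nonneg)

text \<open>A pair at which the maximum is attained occurs in both orders, which cancels the factor \<open>1/2\<close>.\<close>

lemma edge_max_le_edge_norm:
  assumes e: "e \<noteq> {}" and q: "0 < q"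
  shows "edge_max e x \<le> edge_norm q e x"
proof -
  obtain i j where ij: "i \<in> e" "j \<in> e" "edge_max e x = \<bar>x $ i - x $ j\<bar>"
    using edge_max_attained[OF e] by blast
  show ?thesis
  proof (cases "i = j")
    case True
    then show ?thesis
      using ij edge_norm_nonneg by simp
  next
    case False
    define f where "f k l = \<bar>x $ k - x $ l\<bar> powr q" for k l
    have "(\<Sum>k\<in>{i, j}. \<Sum>l\<in>e. f k l) \<le> (\<Sum>k\<in>e. \<Sum>l\<in>e. f k l)"
      using ij by (intro sum_mono2) (auto intro: sum_nonneg simp: f_def)
    moreover have "f i j \<le> (\<Sum>l\<in>e. f i l)" "f j i \<le> (\<Sum>l\<in>e. f j l)"
      using ij by (auto intro!: member_le_sum simp: f_def)
    moreover have "f j i = f i j"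
      by (simp add: f_def abs_minus_commute)
    ultimately have "f i j \<le> edge_sum q e x"
      using False by (simp add: edge_sum_def f_def)
    then have "f i j powr (1 / q) \<le> edge_sum q e x powr (1 / q)"
      using q by (intro powr_mono2) (auto simp: f_def)
    then show ?thesis
      using q ij by (simp add: f_def powr_powr edge_norm_eq)
  qed
qed

lemma edge_norm_le_edge_max:
  fixes x :: "real ^ 'v::finite"
  assumes e: "e \<noteq> {}" and q: "0 < q"
  shows "edge_norm q e x \<le> (real CARD('v))\<^sup>2 powr (1 / q) * edge_max e x"
proof -
  define m where "m = edge_max e x"
  have m: "m \<ge> 0"
    using edge_max_nonneg[OF e] by (simp add: m_def)
  have "(\<Sum>i\<in>e. \<Sum>j\<in>e. \<bar>x $ i - x $ j\<bar> powr q) \<le> (\<Sum>i\<in>e. \<Sum>j\<in>e. m powr q)"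
    using q by (intro sum_mono powr_mono2) (auto simp: m_def edge_max_ge)
  also have "\<dots> = (real (card e))\<^sup>2 * m powr q"
    by (simp add: power2_eq_square)
  also have "\<dots> \<le> (real CARD('v))\<^sup>2 * m powr q"
    by (intro mult_right_mono power_mono) (auto intro: card_mono)
  finally have "2 * edge_sum q e x \<le> (real CARD('v))\<^sup>2 * m powr q"
    by (simp add: edge_sum_def)
  then have "edge_sum q e x \<le> (real CARD('v))\<^sup>2 * m powr q"
    using edge_sum_nonneg[of q e x] by linarith
  then have "edge_norm q e x \<le> ((real CARD('v))\<^sup>2 * m powr q) powr (1 / q)"
    unfolding edge_norm_eq using q by (intro powr_mono2) (auto simp: edge_sum_nonneg)
  also have "\<dots> = (real CARD('v))\<^sup>2 powr (1 / q) * m"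
    using q m by (simp add: powr_mult powr_powr)
  finally show ?thesis
    by (simp add: m_def)
qed

lemma convex_powr_nonneg:
  fixes x y t p :: real
  assumes "0 \<le> x" "0 \<le> y" "0 \<le> t" "t \<le> 1" "1 \<le> p"
  shows "((1 - t) * x + t * y) powr p \<le> (1 - t) * x powr p + t * y powr p"
proof -
  have scale: "(s * z) powr p \<le> s * z powr p" if "0 \<le> s" "s \<le> 1" "0 \<le> z" for s z :: real
  proof (cases "s = 0")
    case False
    then have "s powr p \<le> s powr 1"
      using that assms(5) by (intro powr_mono') auto
    then show ?thesis
      using that by (simp add: powr_mult mult_right_mono)
  qed simp
  consider "x = 0" | "y = 0" | "x > 0" "y > 0"
    using assms by linarith
  then show ?thesis
  proof cases
    case 1
    then show ?thesis using scale[of t y] assms by simp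
  next
    case 2
    then show ?thesis using scale[of "1 - t" x] assms by simp
  next
    case 3
    then show ?thesis
      using convex_onD[OF powr_convex[OF assms(5)], of t x y] assms by simp
  qed
qed

lemma edge_sum_convex:
  assumes q: "1 \<le> q" and t: "0 \<le> t" "t \<le> 1"
  shows "edge_sum q e ((1 - t) *\<^sub>R x + t *\<^sub>R y) \<le> (1 - t) * edge_sum q e x + t * edge_sum q e y"
proof -
  have "\<bar>((1 - t) *\<^sub>R x + t *\<^sub>R y) $ i - ((1 - t) *\<^sub>R x + t *\<^sub>R y) $ j\<bar> powr q
      \<le> (1 - t) * \<bar>x $ i - x $ j\<bar> powr q + t * \<bar>y $ i - y $ j\<bar> powr q" for i j
  proof -
    have "((1 - t) *\<^sub>R x + t *\<^sub>R y) $ i - ((1 - t) *\<^sub>R x + t *\<^sub>R y) $ j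
        = (1 - t) * (x $ i - x $ j) + t * (y $ i - y $ j)"
      by (simp add: algebra_simps)
    also have "\<bar>\<dots>\<bar> \<le> (1 - t) * \<bar>x $ i - x $ j\<bar> + t * \<bar>y $ i - y $ j\<bar>"
      using t by (intro order_trans[OF abs_triangle_ineq]) (simp add: abs_mult)
    finally have "\<bar>((1 - t) *\<^sub>R x + t *\<^sub>R y) $ i - ((1 - t) *\<^sub>R x + t *\<^sub>R y) $ j\<bar> powr q
        \<le> ((1 - t) * \<bar>x $ i - x $ j\<bar> + t * \<bar>y $ i - y $ j\<bar>) powr q"
      using q by (intro powr_mono2) auto
    also have "\<dots> \<le> (1 - t) * \<bar>x $ i - x $ j\<bar> powr q + t * \<bar>y $ i - y $ j\<bar> powr q"
      using q t by (intro convex_powr_nonneg) auto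
    finally show ?thesis .
  qed
  then have "(\<Sum>i\<in>e. \<Sum>j\<in>e. \<bar>((1 - t) *\<^sub>R x + t *\<^sub>R y) $ i - ((1 - t) *\<^sub>R x + t *\<^sub>R y) $ j\<bar> powr q)
      \<le> (\<Sum>i\<in>e. \<Sum>j\<in>e. (1 - t) * \<bar>x $ i - x $ j\<bar> powr q + t * \<bar>y $ i - y $ j\<bar> powr q)"
    by (intro sum_mono)
  also have "\<dots> = (1 - t) * (\<Sum>i\<in>e. \<Sum>j\<in>e. \<bar>x $ i - x $ j\<bar> powr q) + t * (\<Sum>i\<in>e. \<Sum>j\<in>e. \<bar>y $ i - y $ j\<bar> powr q)"
    by (simp add: sum.distrib sum_distrib_left)
  finally show ?thesis
    by (simp add: edge_sum_def)
qed

lemma edge_sum_scaleR: "edge_sum q e (c *\<^sub>R x) = \<bar>c\<bar> powr q * edge_sum q e x"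
proof -
  have "\<bar>(c *\<^sub>R x) $ i - (c *\<^sub>R x) $ j\<bar> powr q = \<bar>c\<bar> powr q * \<bar>x $ i - x $ j\<bar> powr q" for i j
    by (simp add: powr_mult[symmetric] abs_mult[symmetric] algebra_simps)
  then show ?thesis
    by (simp add: edge_sum_def sum_distrib_left)
qed

lemma edge_norm_scaleR:
  "0 < q \<Longrightarrow> edge_norm q e (c *\<^sub>R x) = \<bar>c\<bar> * edge_norm q e x"
  by (simp add: edge_norm_eq edge_sum_scaleR powr_mult powr_powr edge_sum_nonneg)

text \<open>Minkowski's inequality, from convexity of the set on which \<open>edge_sum q e\<close> is at most one: \<open>x\<close> and
  \<open>y\<close>, divided by numbers slightly larger than their norms, lie in this set.\<close>

lemma edge_norm_triangle:
  assumes q: "1 \<le> q"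
  shows "edge_norm q e (x + y) \<le> edge_norm q e x + edge_norm q e y"
proof (rule field_le_epsilon)
  fix \<epsilon> :: real assume \<epsilon>: "0 < \<epsilon>"
  define \<alpha> \<beta> where "\<alpha> = edge_norm q e x + \<epsilon> / 2" and "\<beta> = edge_norm q e y + \<epsilon> / 2"
  have pos: "\<alpha> > 0" "\<beta> > 0"
    using \<epsilon> edge_norm_nonneg[of q e] by (auto simp: \<alpha>_def \<beta>_def add_nonneg_pos)
  have le1: "edge_sum q e ((1 / \<gamma>) *\<^sub>R z) \<le> 1" if "edge_norm q e z \<le> \<gamma>" "\<gamma> > 0" for \<gamma> z
  proof -
    have "edge_sum q e ((1 / \<gamma>) *\<^sub>R z) = edge_norm q e ((1 / \<gamma>) *\<^sub>R z) powr q"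
      using q by (simp add: edge_norm_powr)
    also have "edge_norm q e ((1 / \<gamma>) *\<^sub>R z) \<le> 1"
      using that q by (simp add: edge_norm_scaleR)
    then have "edge_norm q e ((1 / \<gamma>) *\<^sub>R z) powr q \<le> 1"
      using q by (intro powr_le1) (auto simp: edge_norm_nonneg)
    finally show ?thesis .
  qed
  define t where "t = \<beta> / (\<alpha> + \<beta>)"
  have t: "0 \<le> t" "t \<le> 1" "1 - t = \<alpha> / (\<alpha> + \<beta>)"
    using pos by (auto simp: t_def field_simps)
  have "(1 / (\<alpha> + \<beta>)) *\<^sub>R (x + y) = (1 - t) *\<^sub>R ((1 / \<alpha>) *\<^sub>R x) + t *\<^sub>R ((1 / \<beta>) *\<^sub>R y)"
    unfolding t(3) using pos by (simp add: t_def scaleR_add_right)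
  then have "edge_sum q e ((1 / (\<alpha> + \<beta>)) *\<^sub>R (x + y))
      \<le> (1 - t) * edge_sum q e ((1 / \<alpha>) *\<^sub>R x) + t * edge_sum q e ((1 / \<beta>) *\<^sub>R y)"
    using edge_sum_convex[OF q t(1,2)] by metis
  also have "\<dots> \<le> (1 - t) * 1 + t * 1"
    using le1[of x \<alpha>] le1[of y \<beta>] t pos \<epsilon> by (intro add_mono mult_left_mono) (auto simp: \<alpha>_def \<beta>_def)
  finally have "edge_sum q e ((1 / (\<alpha> + \<beta>)) *\<^sub>R (x + y)) powr (1 / q) \<le> 1"
    using q by (intro powr_le1) (auto simp: edge_sum_nonneg)
  then have "edge_norm q e ((1 / (\<alpha> + \<beta>)) *\<^sub>R (x + y)) \<le> 1"
    by (simp add: edge_norm_eq)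
  then have "edge_norm q e (x + y) \<le> \<alpha> + \<beta>"
    using pos q by (simp add: edge_norm_scaleR)
  then show "edge_norm q e (x + y) \<le> edge_norm q e x + edge_norm q e y + \<epsilon>"
    by (simp add: \<alpha>_def \<beta>_def)
qed

context
  fixes E :: "'v::finite set set" and w :: "'v set \<Rightarrow> real" and p :: real
  assumes graph: "weighted_hypergraph E w" and p: "1 < p"
begin

lemma edge_nonempty: "e \<in> E \<Longrightarrow> e \<noteq> {}"
  using graph by (force simp: weighted_hypergraph_def)

lemma weight_pos: "e \<in> E \<Longrightarrow> 0 < w e"
  using graph by (simp add: weighted_hypergraph_def)

lemma energy_nonneg: "0 \<le> energy E w p x"
  unfolding energy_def using p weight_pos
  by (intro mult_nonneg_nonneg sum_nonneg) (auto simp: less_imp_le)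

lemma energy_le_energy_q:
  assumes "0 < q"
  shows "energy E w p x \<le> energy_q E w p q x"
  unfolding energy_def energy_q_def
  by (intro mult_left_mono sum_mono powr_mono2 edge_max_le_edge_norm)
     (use p weight_pos assms in \<open>auto simp: less_imp_le edge_max_nonneg edge_nonempty\<close>)

lemma energy_q_le_energy:
  assumes q: "0 < q"
  shows "energy_q E w p q x \<le> (real CARD('v))\<^sup>2 powr (p / q) * energy E w p x"
proof -
  define N where "N = (real CARD('v))\<^sup>2"
  have "edge_norm q e x powr p \<le> N powr (p / q) * edge_max e x powr p" if "e \<in> E" for e
  proof -
    have "edge_norm q e x powr p \<le> (N powr (1 / q) * edge_max e x) powr p"
      unfolding N_def using p edge_norm_nonneg
      by (intro powr_mono2 edge_norm_le_edge_max edge_nonempty[OF that] q) auto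
    also have "\<dots> = N powr (p / q) * edge_max e x powr p"
      using edge_max_nonneg[OF edge_nonempty[OF that]] by (simp add: powr_mult powr_powr)
    finally show ?thesis .
  qed
  then have "(\<Sum>e\<in>E. w e * edge_norm q e x powr p) \<le> (\<Sum>e\<in>E. w e * (N powr (p / q) * edge_max e x powr p))"
    using weight_pos by (intro sum_mono mult_left_mono) (auto simp: less_imp_le)
  also have "\<dots> = N powr (p / q) * (\<Sum>e\<in>E. w e * edge_max e x powr p)"
    by (simp add: sum_distrib_left algebra_simps)
  finally show ?thesis
    using p unfolding energy_def energy_q_def N_def by (simp add: divide_right_mono)
qed

lemma energy_q_nonneg: "0 < q \<Longrightarrow> 0 \<le> energy_q E w p q x"
  using order_trans[OF energy_nonneg energy_le_energy_q] .

text \<open>The energy is a sum of convex increasing functions \<open>r \<mapsto> r\<^sup>p\<close> of the seminorms \<open>edge_norm q e\<close>.\<close>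

lemma energy_q_convex:
  assumes q: "1 \<le> q"
  shows "convex_on UNIV (energy_q E w p q)"
proof (rule convex_onI)
  fix t :: real and x y :: "real ^ 'v"
  assume t: "0 < t" "t < 1"
  have "edge_norm q e ((1 - t) *\<^sub>R x + t *\<^sub>R y) powr p
      \<le> (1 - t) * edge_norm q e x powr p + t * edge_norm q e y powr p" for e
  proof -
    have "edge_norm q e ((1 - t) *\<^sub>R x + t *\<^sub>R y) \<le> (1 - t) * edge_norm q e x + t * edge_norm q e y"
      using edge_norm_triangle[OF q, of e "(1 - t) *\<^sub>R x" "t *\<^sub>R y"] q t by (simp add: edge_norm_scaleR)
    then have "edge_norm q e ((1 - t) *\<^sub>R x + t *\<^sub>R y) powr p
        \<le> ((1 - t) * edge_norm q e x + t * edge_norm q e y) powr p"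
      using p edge_norm_nonneg by (intro powr_mono2) auto
    also have "\<dots> \<le> (1 - t) * edge_norm q e x powr p + t * edge_norm q e y powr p"
      using p t edge_norm_nonneg by (intro convex_powr_nonneg) auto
    finally show ?thesis .
  qed
  then have "(\<Sum>e\<in>E. w e * edge_norm q e ((1 - t) *\<^sub>R x + t *\<^sub>R y) powr p)
      \<le> (\<Sum>e\<in>E. w e * ((1 - t) * edge_norm q e x powr p + t * edge_norm q e y powr p))"
    using weight_pos by (intro sum_mono mult_left_mono) (auto simp: less_imp_le)
  also have "\<dots> = (1 - t) * (\<Sum>e\<in>E. w e * edge_norm q e x powr p) + t * (\<Sum>e\<in>E. w e * edge_norm q e y powr p)"
  proof -
    have "w e * ((1 - t) * a + t * b) = (1 - t) * (w e * a) + t * (w e * b)" for e a b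
      by (simp add: algebra_simps)
    then show ?thesis
      by (simp only: sum.distrib sum_distrib_left)
  qed
  finally have "(1 / p) * (\<Sum>e\<in>E. w e * edge_norm q e ((1 - t) *\<^sub>R x + t *\<^sub>R y) powr p)
      \<le> (1 / p) * ((1 - t) * (\<Sum>e\<in>E. w e * edge_norm q e x powr p) + t * (\<Sum>e\<in>E. w e * edge_norm q e y powr p))"
    using p by (intro mult_left_mono) auto
  then show "energy_q E w p q ((1 - t) *\<^sub>R x + t *\<^sub>R y) \<le> (1 - t) * energy_q E w p q x + t * energy_q E w p q y"
    unfolding energy_q_def by (simp only: distrib_left mult.left_commute)
qed simp

text \<open>The bound does not depend on \<open>q\<close>, since \<open>p / q \<le> p\<close> in the exponent of the comparison factor.\<close>

lemma energy_bounded_on_balls: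
  obtains M where "0 \<le> M" "\<And>z. norm z \<le> R \<Longrightarrow> energy E w p z \<le> M"
    "\<And>q z. 1 \<le> q \<Longrightarrow> norm z \<le> R \<Longrightarrow> energy_q E w p q z \<le> M"
proof -
  define L where "L = (1 / p) * (\<Sum>e\<in>E. w e * (2 * R) powr p)"
  define N where "N = (real CARD('v))\<^sup>2"
  have L: "energy E w p z \<le> L" if "norm z \<le> R" for z
    unfolding energy_def L_def
    by (intro mult_left_mono sum_mono powr_mono2 order_trans[OF edge_max_le_norm])
       (use p weight_pos that in \<open>auto simp: less_imp_le edge_max_nonneg edge_nonempty\<close>)
  have N: "N \<ge> 1"
    unfolding N_def by (simp add: Suc_le_eq)
  have L0: "L \<ge> 0"
    unfolding L_def using p weight_pos
    by (intro mult_nonneg_nonneg sum_nonneg) (auto simp: less_imp_le)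
  show ?thesis
  proof (rule that[of "N powr p * L"])
    show "0 \<le> N powr p * L"
      using L0 by simp
    fix z :: "real ^ 'v" assume z: "norm z \<le> R"
    have "1 * L \<le> N powr p * L"
      using L0 N p by (intro mult_right_mono ge_one_powr_ge_zero) auto
    then show "energy E w p z \<le> N powr p * L"
      using L[OF z] by simp
    fix q :: real assume q: "1 \<le> q"
    have "energy_q E w p q z \<le> N powr (p / q) * energy E w p z"
      unfolding N_def using q by (intro energy_q_le_energy) auto
    also have "\<dots> \<le> N powr p * L"
      using q p N L[OF z] energy_nonneg[of z]
      by (intro mult_mono powr_mono) (auto simp: field_simps)
    finally show "energy_q E w p q z \<le> N powr p * L" .
  qed
qed

end

section \<open>Estimates for the penalised problem\<close>

lemma half_norm_squared_estimate:
  assumes y: "primitive T y y'" and g: "integrable (leb T) g" "AE t in leb T. 0 \<le> g t"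
    and le: "AE t in leb T. y t \<bullet> y' t \<le> g t" and s: "s \<in> {0..T}"
  shows "(norm (y s))\<^sup>2 / 2 \<le> (norm (y 0))\<^sup>2 / 2 + (\<integral>t. g t \<partial>leb T)"
proof (cases "s = 0")
  case True
  have "0 \<le> (\<integral>t. g t \<partial>leb T)"
    by (rule integral_nonneg_AE[OF g(2)])
  then show ?thesis using True by simp
next
  case False
  then have s0: "0 < s" "s \<le> T" using s by auto
  have "(norm (y s))\<^sup>2 / 2 - (norm (y 0))\<^sup>2 / 2 \<le> (\<integral>t. y t \<bullet> y' t \<partial>leb s)"
    by (rule half_norm_squared_chain_inequality[OF s0(1) primitive_mono[OF y s0(2)]])
  also have "\<dots> \<le> (\<integral>t. g t \<partial>leb T)"
    by (rule integral_mono_lebesgue_on_AE[OF g(1) AE_leb_mono[OF le s0(2)] g(2)]) (use s0 in auto)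
  finally show ?thesis by simp
qed

lemma uniform_limit_bound_sequence:
  fixes f :: "nat \<Rightarrow> real \<Rightarrow> 'a::euclidean_space"
  assumes T: "0 \<le> T" and lim: "uniform_limit {0..T} f f0 sequentially"
    and cont: "\<And>i. continuous_on {0..T} (f i)" "continuous_on {0..T} f0"
  obtains \<delta> where "\<delta> \<longlonglongrightarrow> 0" "\<And>i t. t \<in> {0..T} \<Longrightarrow> norm (f i t - f0 t) \<le> \<delta> i"
proof -
  have "\<exists>s\<in>{0..T}. \<forall>t\<in>{0..T}. norm (f i t - f0 t) \<le> norm (f i s - f0 s)" for i
    using T by (intro continuous_attains_sup) (auto intro!: continuous_intros cont)
  then obtain s where s: "\<And>i. s i \<in> {0..T}" "\<And>i t. t \<in> {0..T} \<Longrightarrow> norm (f i t - f0 t) \<le> norm (f i (s i) - f0 (s i))"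
    by metis
  have "(\<lambda>i. norm (f i (s i) - f0 (s i))) \<longlonglongrightarrow> 0"
  proof (rule tendstoI)
    fix e :: real assume "e > 0"
    then have "\<forall>\<^sub>F i in sequentially. \<forall>t\<in>{0..T}. dist (f i t) (f0 t) < e"
      using lim by (simp add: uniform_limit_iff)
    then show "\<forall>\<^sub>F i in sequentially. dist (norm (f i (s i) - f0 (s i))) 0 < e"
      by eventually_elim (use s(1) in \<open>auto simp: dist_norm\<close>)
  qed
  then show ?thesis
    using that s(2) by blast
qed

lemma quadratic_bound:
  fixes k c d :: real
  assumes "0 \<le> c" "0 \<le> d" "k\<^sup>2 \<le> c * k + d"
  shows "k \<le> c + d + 1"
proof (rule ccontr)
  assume "\<not> ?thesis"
  then have k: "c + d + 1 < k" by simp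
  then have "(c + d + 1) * k < k * k"
    using assms by (intro mult_strict_right_mono) auto
  moreover have "d * 1 \<le> d * k"
    using k assms by (intro mult_left_mono) auto
  ultimately show False
    using assms k by (simp add: power2_eq_square algebra_simps)
qed

lemma boundary_part_nth: "boundary_part B z $ i = (if i \<in> B then z $ i else 0)"
  by (simp add: boundary_part_def)

lemma bounded_linear_boundary_part: "bounded_linear (boundary_part B)"
  by (intro linear_conv_bounded_linear[THEN iffD1] linearI) (simp_all add: vec_eq_iff boundary_part_nth)

lemma boundary_part_diff: "boundary_part B (x - y) = boundary_part B x - boundary_part B y"
  by (simp add: vec_eq_iff boundary_part_nth)

lemma inner_boundary_part: "boundary_part B x \<bullet> y = boundary_part B x \<bullet> boundary_part B y"
  by (auto simp: inner_vec_def boundary_part_nth intro!: sum.cong)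

lemma boundary_part_boundary_data:
  "a \<in> boundary_data T B \<Longrightarrow> t \<in> {0..T} \<Longrightarrow> boundary_part B (a t) = a t"
  by (auto simp: boundary_data_def vec_eq_iff boundary_part_nth)

lemma boundary_part_constraint_set:
  assumes "a \<in> boundary_data T B" "t \<in> {0..T}" "x \<in> constraint_set B a t"
  shows "boundary_part B x = a t"
  using assms by (auto simp: boundary_data_def constraint_set_def vec_eq_iff boundary_part_nth)

lemma boundary_data_W12: "a \<in> boundary_data T B \<Longrightarrow> a \<in> W12 T"
  by (simp add: boundary_data_def)

lemma subdifferential_real:
  "\<xi> \<in> subdifferential (\<lambda>y. ereal (f y)) x \<longleftrightarrow> (\<forall>z. f x + \<xi> \<bullet> (z - x) \<le> f z)"
  unfolding subdifferential_def by (auto simp: le_diff_eq add.commute)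

text \<open>The coordinates outside \<open>B\<close> are free, and moving along one of them in the direction of \<open>\<eta>\<close> stays
  in the constraint set.\<close>

lemma subdifferential_indicator_constraint_set:
  assumes x: "x \<in> constraint_set B a t"
    and \<eta>: "\<eta> \<in> subdifferential (convex_indicator (constraint_set B a t)) x"
  shows "boundary_part B \<eta> = \<eta>"
proof -
  have "\<eta> $ i = 0" if "i \<notin> B" for i
  proof -
    have "x + (\<eta> $ i) *\<^sub>R axis i 1 \<in> constraint_set B a t"
      using x that by (auto simp: constraint_set_def axis_def)
    then have "\<eta> \<bullet> (x + (\<eta> $ i) *\<^sub>R axis i 1 - x) \<le> 0"
      using \<eta> x unfolding subdifferential_def convex_indicator_def
      by (auto simp: zero_ereal_def dest!: spec[of _ "x + (\<eta> $ i) *\<^sub>R axis i 1"])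
    then have "(\<eta> $ i) * (\<eta> $ i) \<le> 0"
      by (simp add: inner_axis)
    then show ?thesis
      by (metis antisym mult_eq_0_iff zero_le_square)
  qed
  then show ?thesis
    by (simp add: vec_eq_iff boundary_part_nth)
qed

text \<open>The penalty term of the approximate equation. It plays the part of the multiplier \<open>\<eta>\<close> in the normal
  cone of the constraint set, and stays bounded in \<open>L\<^sup>2\<close> as \<open>l\<close> tends to \<open>0\<close>.\<close>

definition penalty :: "'v::finite set \<Rightarrow> real \<Rightarrow> (real \<Rightarrow> real ^ 'v) \<Rightarrow> (real \<Rightarrow> real ^ 'v) \<Rightarrow> real \<Rightarrow> real ^ 'v" where
  "penalty B l a u t = (1 / l) *\<^sub>R (boundary_part B (u t) - a t)"

lemma penalty_primitive:
  assumes T: "0 < T" and "u \<in> W12 T" "b \<in> boundary_data T B"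
  shows "primitive T (\<lambda>t. boundary_part B (u t) - b t) (\<lambda>t. boundary_part B (weak_deriv T u t) - weak_deriv T b t)"
  by (intro primitive_diff primitive_bounded_linear[OF bounded_linear_boundary_part] W12_primitive[OF T]
      assms(2) boundary_data_W12[OF assms(3)])

lemma penalty_sq_integrable:
  assumes T: "0 < T" and "u \<in> W12 T" "b \<in> boundary_data T B"
  shows "sq_integrable (leb T) (penalty B l b u)"
  unfolding penalty_def[abs_def]
  by (intro sq_integrable_scaleR primitive_sq_integrable_fun[OF penalty_primitive[OF assms]])

text \<open>The bound \<open>c\<close> covers all data on which the a priori estimates depend, while \<open>q > 1\<close> and \<open>l > 0\<close> are
  arbitrary; constants that depend only on \<open>c\<close>, the graph, \<open>p\<close> and \<open>T\<close> are
  therefore uniform along the approximation.\<close>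

definition Pq_solution_le ::
    "real \<Rightarrow> 'v::finite set set \<Rightarrow> ('v set \<Rightarrow> real) \<Rightarrow> 'v set \<Rightarrow> real \<Rightarrow> real \<Rightarrow> real \<Rightarrow> real \<Rightarrow>
     (real \<Rightarrow> real ^ 'v) \<Rightarrow> (real \<Rightarrow> real ^ 'v) \<Rightarrow> (real \<Rightarrow> real ^ 'v) \<Rightarrow> bool" where
  "Pq_solution_le c E w B T p q l b h u \<longleftrightarrow>
     1 < q \<and> 0 < l \<and> b \<in> boundary_data T B \<and> h \<in> L2 T \<and>
     solves_Pq E w B T p q l b h (u 0) u \<and> u 0 \<in> constraint_set B b 0 \<and>
     norm (u 0) \<le> c \<and> (\<forall>t\<in>{0..T}. norm (b t) \<le> c) \<and>
     l2norm (leb T) (weak_deriv T b) \<le> c \<and> l2norm (leb T) h \<le> c"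

context
  fixes E :: "'v::finite set set" and w :: "'v set \<Rightarrow> real" and p :: real and T :: real and B :: "'v set"
  assumes graph: "weighted_hypergraph E w" and p: "1 < p" and T: "0 < T"
begin

lemma solves_Pq_subgradient:
  assumes q: "1 < q" and sol: "solves_Pq E w B T p q l b h x0 u"
  defines "G \<equiv> \<lambda>t. h t - weak_deriv T u t - penalty B l b u t"
  shows "AE t in leb T. \<forall>z. energy_q E w p q (u t) + G t \<bullet> (z - u t) \<le> energy_q E w p q z"
proof -
  have "AE t in leb T. \<exists>D. (GDERIV (energy_q E w p q) (u t) :> D) \<and>
          weak_deriv T u t + D + (1 / l) *\<^sub>R (boundary_part B (u t) - b t) = h t"
    using sol by (simp add: solves_Pq_def)
  then show ?thesis
  proof eventually_elim
    case (elim t)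
    then obtain D where D: "GDERIV (energy_q E w p q) (u t) :> D"
      and eq: "weak_deriv T u t + D + (1 / l) *\<^sub>R (boundary_part B (u t) - b t) = h t"
      by blast
    have "D = G t"
      unfolding G_def penalty_def eq[symmetric] by simp
    then show ?case
      using GDERIV_imp_subgradient[OF energy_q_convex[OF graph p less_imp_le[OF q]] D] by simp
  qed
qed

text \<open>Test the equation with \<open>u - b\<close>. The penalty has the good sign because \<open>b\<close> agrees with its boundary
  part, and the energy of \<open>b\<close> bounds the contribution of the gradient from below.\<close>

lemma solves_Pq_sup_bound:
  obtains R where "0 \<le> R"
    "\<And>q l b h u t. Pq_solution_le c E w B T p q l b h u \<Longrightarrow> t \<in> {0..T} \<Longrightarrow> norm (u t) \<le> R"
proof -
  obtain M where M: "0 \<le> M" "\<And>q z. 1 \<le> q \<Longrightarrow> norm z \<le> c \<Longrightarrow> energy_q E w p q z \<le> M"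
    using energy_bounded_on_balls[OF graph p, of c] by metis
  define R where "R = (4 * c * sqrt T) + (4 * c\<^sup>2 + 2 * T * M) + 1 + c"
  show ?thesis
  proof (rule that[of "\<bar>R\<bar>"])
    fix q l :: real and b h u :: "real \<Rightarrow> real ^ 'v" and t0 :: real
    assume "Pq_solution_le c E w B T p q l b h u" and t0: "t0 \<in> {0..T}"
    then have q: "1 < q" and l: "0 < l" and b: "b \<in> boundary_data T B" and h: "h \<in> L2 T"
      and sol: "solves_Pq E w B T p q l b h (u 0) u"
      and u0: "norm (u 0) \<le> c" and b_le: "\<And>t. t \<in> {0..T} \<Longrightarrow> norm (b t) \<le> c"
      and b'_le: "l2norm (leb T) (weak_deriv T b) \<le> c" and h_le: "l2norm (leb T) h \<le> c"
      by (simp_all add: Pq_solution_le_def)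
    have c: "0 \<le> c"
      using order_trans[OF norm_ge_zero u0] .
    have uW: "u \<in> W12 T"
      using sol by (simp add: solves_Pq_def)
    note uP = W12_primitive[OF T uW] and bP = W12_primitive[OF T boundary_data_W12[OF b]]
    note hL = h[unfolded L2_iff]
    define v b' where "v = weak_deriv T u" and "b' = weak_deriv T b"
    define y where "y t = u t - b t" for t
    have yP: "primitive T y (\<lambda>t. v t - b' t)"
      unfolding y_def v_def b'_def by (rule primitive_diff[OF uP bP])
    have "continuous_on {0..T} (\<lambda>t. norm (y t))"
      by (intro continuous_intros primitive_continuous[OF yP])
    then obtain s where s: "s \<in> {0..T}" "\<And>t. t \<in> {0..T} \<Longrightarrow> norm (y t) \<le> norm (y s)"
      using continuous_attains_sup[of "{0..T}" "\<lambda>t. norm (y t)"] T by auto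
    define K where "K = norm (y s)"
    define g where "g t = M + K * (norm (h t) + norm (b' t))" for t
    have b'L: "sq_integrable (leb T) b'"
      unfolding b'_def by (rule primitive_sq_integrable[OF bP])
    have hn: "integrable (leb T) (\<lambda>t. norm (h t))" and bn: "integrable (leb T) (\<lambda>t. norm (b' t))"
      using sq_integrable_imp_integrable[OF hL] sq_integrable_imp_integrable[OF b'L] by (auto intro: integrable_norm)
    have gi: "integrable (leb T) g"
      unfolding g_def[abs_def] using hn bn
      by (intro Bochner_Integration.integrable_add integrable_mult_right finite_measure.integrable_const[OF finite_measure_leb]) auto
    have K: "K \<ge> 0" by (simp add: K_def)
    have "AE t in leb T. y t \<bullet> (v t - b' t) \<le> g t"
      using AE_leb_interior[OF solves_Pq_subgradient[OF q sol]]
    proof eventually_elim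
      case (elim t)
      then have t: "t \<in> {0..T}" by auto
      define G where "G = h t - v t - penalty B l b u t"
      have "energy_q E w p q (u t) + G \<bullet> (b t - u t) \<le> energy_q E w p q (b t)"
        using elim unfolding G_def v_def by blast
      then have G: "- (y t \<bullet> G) \<le> M"
        using M(2)[of q "b t"] b_le[OF t] q energy_q_nonneg[OF graph p, of q "u t"]
        by (simp add: y_def inner_diff_left inner_diff_right inner_commute)
      have "boundary_part B (u t) - b t = boundary_part B (y t)"
        unfolding y_def boundary_part_diff boundary_part_boundary_data[OF b t] ..
      then have "y t \<bullet> penalty B l b u t = (1 / l) * (boundary_part B (y t) \<bullet> boundary_part B (y t))"
        using inner_boundary_part[of B "y t" "y t"] by (simp add: penalty_def inner_commute)
      then have pen: "0 \<le> y t \<bullet> penalty B l b u t"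
        using l by simp
      have "y t \<bullet> (h t - b' t) \<le> K * (norm (h t) + norm (b' t))"
      proof -
        have "y t \<bullet> (h t - b' t) \<le> norm (y t) * norm (h t - b' t)"
          by (rule norm_cauchy_schwarz)
        also have "\<dots> \<le> K * (norm (h t) + norm (b' t))"
          using s(2)[OF t] K norm_triangle_ineq4 by (intro mult_mono) (auto simp: K_def)
        finally show ?thesis .
      qed
      moreover have "y t \<bullet> (v t - b' t) = y t \<bullet> (h t - b' t) - y t \<bullet> G - y t \<bullet> penalty B l b u t"
        by (simp add: G_def algebra_simps)
      ultimately show ?case
        using G pen by (simp add: g_def)
    qed
    then have "K\<^sup>2 / 2 \<le> (norm (y 0))\<^sup>2 / 2 + (\<integral>t. g t \<partial>leb T)"
      unfolding K_def using M(1) K s(1)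
      by (intro half_norm_squared_estimate[OF yP gi]) (auto simp: g_def K_def)
    moreover have "(\<integral>t. g t \<partial>leb T) \<le> T * M + K * (2 * c * sqrt T)"
    proof -
      have "(\<integral>t. g t \<partial>leb T) = T * M + K * ((\<integral>t. norm (h t) \<partial>leb T) + (\<integral>t. norm (b' t) \<partial>leb T))"
        unfolding g_def using hn bn T finite_measure.integrable_const[OF finite_measure_leb, of T M]
        by (subst Bochner_Integration.integral_add) (simp_all add: integral_const_leb del: Bochner_Integration.lebesgue_integral_const)
      also have "\<dots> \<le> T * M + K * (sqrt T * c + sqrt T * c)"
        using integral_norm_leb_le[OF less_imp_le[OF T] hL] integral_norm_leb_le[OF less_imp_le[OF T] b'L] h_le b'_le T K
        by (intro add_left_mono mult_left_mono add_mono) (auto simp: b'_def elim!: order_trans)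
      finally show ?thesis by (simp add: algebra_simps)
    qed
    moreover have "(norm (y 0))\<^sup>2 \<le> (2 * c)\<^sup>2"
      using norm_triangle_ineq4[of "u 0" "b 0"] u0 b_le[of 0] T
      by (intro power_mono) (auto simp: y_def)
    ultimately have "K\<^sup>2 \<le> (4 * c * sqrt T) * K + (4 * c\<^sup>2 + 2 * T * M)"
      by (simp add: power_mult_distrib algebra_simps)
    then have "K \<le> (4 * c * sqrt T) + (4 * c\<^sup>2 + 2 * T * M) + 1"
      using c T M(1) by (intro quadratic_bound) auto
    moreover have "norm (u t0) \<le> norm (y t0) + norm (b t0)"
      using norm_triangle_ineq[of "y t0" "b t0"] by (simp add: y_def)
    ultimately show "norm (u t0) \<le> \<bar>R\<bar>"
      using s(2)[OF t0] b_le[OF t0] unfolding R_def K_def by linarith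
  qed simp
qed

text \<open>Test the equation with \<open>u'\<close>. The gradient and penalty terms are handled by the chain inequality, for the
  energy and for half of the squared distance from the constraint, which vanishes initially;
  the remaining occurrence of the penalty is paired with \<open>b'\<close> and is expressed by the equation.\<close>

lemma solves_Pq_derivative_bound:
  obtains R where "0 \<le> R"
    "\<And>q l b h u. Pq_solution_le c E w B T p q l b h u
      \<Longrightarrow> l2norm (leb T) (weak_deriv T u) \<le> R \<and> l2norm (leb T) (penalty B l b u) \<le> R"
proof -
  obtain R1 where R1: "0 \<le> R1"
    "\<And>q l b h u t. Pq_solution_le c E w B T p q l b h u \<Longrightarrow> t \<in> {0..T} \<Longrightarrow> norm (u t) \<le> R1"
    using solves_Pq_sup_bound[of c] by metis
  obtain M where M: "0 \<le> M" "\<And>q z. 1 \<le> q \<Longrightarrow> norm z \<le> R1 + 1 \<Longrightarrow> energy_q E w p q z \<le> M"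
    using energy_bounded_on_balls[OF graph p, of "R1 + 1"] by metis
  define X where "X = M + (c + sqrt T * M) * c"
  define Rv where "Rv = 2 * c + X + 1"
  show ?thesis
  proof (rule that[of "\<bar>c\<bar> + \<bar>Rv\<bar> + sqrt T * M"])
    show "0 \<le> \<bar>c\<bar> + \<bar>Rv\<bar> + sqrt T * M"
      using T M(1) by simp
    fix q l :: real and b h u :: "real \<Rightarrow> real ^ 'v"
    assume bounded: "Pq_solution_le c E w B T p q l b h u"
    then have q: "1 < q" and l: "0 < l" and b: "b \<in> boundary_data T B" and h: "h \<in> L2 T"
      and sol: "solves_Pq E w B T p q l b h (u 0) u" and u0K: "u 0 \<in> constraint_set B b 0"
      and u0: "norm (u 0) \<le> c"
      and b'_le: "l2norm (leb T) (weak_deriv T b) \<le> c" and h_le: "l2norm (leb T) h \<le> c"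
      by (simp_all add: Pq_solution_le_def)
    note u_le = R1(2)[OF bounded]
    have c: "0 \<le> c"
      using order_trans[OF norm_ge_zero u0] .
    have uW: "u \<in> W12 T"
      using sol by (simp add: solves_Pq_def)
    note uP = W12_primitive[OF T uW] and bP = W12_primitive[OF T boundary_data_W12[OF b]]
    note hL = h[unfolded L2_iff]
    define v b' where "v = weak_deriv T u" and "b' = weak_deriv T b"
    define \<kappa> where "\<kappa> = penalty B l b u"
    define G where "G t = h t - v t - \<kappa> t" for t
    have vL: "sq_integrable (leb T) v" and b'L: "sq_integrable (leb T) b'"
      unfolding v_def b'_def by (rule primitive_sq_integrable[OF uP], rule primitive_sq_integrable[OF bP])
    have \<kappa>L: "sq_integrable (leb T) \<kappa>"
      unfolding \<kappa>_def by (rule penalty_sq_integrable[OF T uW b])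
    have GL: "sq_integrable (leb T) G"
      unfolding G_def[abs_def] by (intro sq_integrable_diff hL vL \<kappa>L)
    have sub: "AE t in leb T. \<forall>z. energy_q E w p q (u t) + G t \<bullet> (z - u t) \<le> energy_q E w p q z"
      using solves_Pq_subgradient[OF q sol] by (simp add: G_def v_def \<kappa>_def)
    have G_le: "AE t in leb T. norm (G t) \<le> M"
      using AE_leb_interior[OF sub]
    proof eventually_elim
      case (elim t)
      show ?case
        by (rule subgradient_norm_le[of "energy_q E w p q" "u t" "G t" R1])
           (use elim u_le[of t] energy_q_nonneg[OF graph p, of q] M(2)[of q] q in auto)
    qed
    have "continuous_on UNIV (energy_q E w p q)"
      by (rule convex_on_continuous[OF open_UNIV energy_q_convex[OF graph p less_imp_le[OF q]]])
    then have F: "continuous_on {0..T} (\<lambda>t. energy_q E w p q (u t))"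
      by (rule continuous_on_compose2[OF _ primitive_continuous[OF uP]]) simp
    have "energy_q E w p q (u T) - energy_q E w p q (u 0) \<le> (\<integral>t. G t \<bullet> v t \<partial>leb T)"
      unfolding v_def
      by (rule subgradient_chain_inequality[OF T uP F sq_integrable_measurable[OF GL] G_le])
         (use sub in \<open>auto elim: eventually_mono\<close>)
    then have Gv: "- M \<le> (\<integral>t. G t \<bullet> v t \<partial>leb T)"
      using energy_q_nonneg[OF graph p, of q "u T"] M(2)[of q "u 0"] u_le[of 0] T q by simp
    have \<kappa>v: "(\<integral>t. \<kappa> t \<bullet> b' t \<partial>leb T) \<le> (\<integral>t. \<kappa> t \<bullet> v t \<partial>leb T)"
    proof -
      define y where "y t = boundary_part B (u t) - b t" for t
      have yP: "primitive T y (\<lambda>t. boundary_part B (v t) - b' t)"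
        unfolding y_def v_def b'_def by (rule penalty_primitive[OF T uW b])
      have "y 0 = 0"
        using boundary_part_constraint_set[OF b _ u0K] T by (simp add: y_def)
      then have "0 \<le> (norm (y T))\<^sup>2 / 2 - (norm (y 0))\<^sup>2 / 2"
        by simp
      also have "\<dots> \<le> (\<integral>t. y t \<bullet> (boundary_part B (v t) - b' t) \<partial>leb T)"
        by (rule half_norm_squared_chain_inequality[OF T yP])
      also have "\<dots> = (\<integral>t. l * (\<kappa> t \<bullet> v t - \<kappa> t \<bullet> b' t) \<partial>leb T)"
      proof (rule Bochner_Integration.integral_cong[OF refl])
        fix t assume "t \<in> space (leb T)"
        then have t: "t \<in> {0..T}" by auto
        have "y t = boundary_part B (u t - b t)"
          unfolding y_def boundary_part_diff boundary_part_boundary_data[OF b t] ..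
        then have "y t \<bullet> boundary_part B (v t) = y t \<bullet> v t"
          using inner_boundary_part[of B "u t - b t" "v t"] by simp
        moreover have "y t = l *\<^sub>R \<kappa> t"
          using l by (simp add: y_def \<kappa>_def penalty_def)
        ultimately show "y t \<bullet> (boundary_part B (v t) - b' t) = l * (\<kappa> t \<bullet> v t - \<kappa> t \<bullet> b' t)"
          by (simp add: inner_diff_right right_diff_distrib)
      qed
      also have "\<dots> = l * ((\<integral>t. \<kappa> t \<bullet> v t \<partial>leb T) - (\<integral>t. \<kappa> t \<bullet> b' t \<partial>leb T))"
        using sq_integrable_inner[OF \<kappa>L vL] sq_integrable_inner[OF \<kappa>L b'L] by simp
      finally show ?thesis
        using l by (simp add: zero_le_mult_iff)
    qed
    have T0: "0 \<le> T" using T by simp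
    have G_l2: "l2norm (leb T) G \<le> sqrt T * M"
      by (rule l2norm_le_of_bound[OF T0 GL M(1) G_le])
    define n where "n = l2norm (leb T) v"
    have n0: "0 \<le> n"
      by (simp add: n_def l2norm_nonneg)
    have \<kappa>_l2: "l2norm (leb T) \<kappa> \<le> c + n + sqrt T * M"
    proof -
      have "\<kappa> = (\<lambda>t. h t - v t - G t)"
        by (simp add: G_def fun_eq_iff)
      then have "l2norm (leb T) \<kappa> = l2norm (leb T) (\<lambda>t. h t - v t - G t)"
        by (rule arg_cong)
      also have "\<dots> \<le> l2norm (leb T) (\<lambda>t. h t - v t) + l2norm (leb T) G"
        by (rule l2norm_triangle_diff[OF sq_integrable_diff[OF hL vL] GL])
      also have "\<dots> \<le> (l2norm (leb T) h + l2norm (leb T) v) + l2norm (leb T) G"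
        by (rule add_right_mono[OF l2norm_triangle_diff[OF hL vL]])
      finally show ?thesis
        using h_le G_l2 by (simp add: n_def)
    qed
    have "n\<^sup>2 = (\<integral>t. v t \<bullet> v t \<partial>leb T)"
      by (simp add: n_def l2norm_inner)
    also have "\<dots> = (\<integral>t. h t \<bullet> v t - G t \<bullet> v t - \<kappa> t \<bullet> v t \<partial>leb T)"
      by (rule Bochner_Integration.integral_cong) (simp_all add: G_def algebra_simps)
    also have "\<dots> = (\<integral>t. h t \<bullet> v t \<partial>leb T) - (\<integral>t. G t \<bullet> v t \<partial>leb T) - (\<integral>t. \<kappa> t \<bullet> v t \<partial>leb T)"
      using sq_integrable_inner[OF hL vL] sq_integrable_inner[OF GL vL] sq_integrable_inner[OF \<kappa>L vL] by simp
    finally have n_eq: "n\<^sup>2 = (\<integral>t. h t \<bullet> v t \<partial>leb T) - (\<integral>t. G t \<bullet> v t \<partial>leb T) - (\<integral>t. \<kappa> t \<bullet> v t \<partial>leb T)" .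
    have hv: "(\<integral>t. h t \<bullet> v t \<partial>leb T) \<le> c * n"
    proof -
      have "l2norm (leb T) h * l2norm (leb T) v \<le> c * n"
        unfolding n_def by (rule mult_right_mono[OF h_le l2norm_nonneg])
      then show ?thesis
        using l2_Cauchy_Schwarz[OF hL vL] by (meson abs_le_D1 order_trans)
    qed
    have \<kappa>b: "- ((c + n + sqrt T * M) * c) \<le> (\<integral>t. \<kappa> t \<bullet> b' t \<partial>leb T)"
    proof -
      have "l2norm (leb T) \<kappa> * l2norm (leb T) b' \<le> (c + n + sqrt T * M) * c"
        using \<kappa>_l2 b'_le c n0 M(1) T0 by (intro mult_mono) (auto simp: b'_def l2norm_nonneg)
      then have "\<bar>\<integral>t. \<kappa> t \<bullet> b' t \<partial>leb T\<bar> \<le> (c + n + sqrt T * M) * c"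
        using l2_Cauchy_Schwarz[OF \<kappa>L b'L] by (rule order_trans[rotated])
      then show ?thesis
        by (metis abs_le_D2 minus_le_iff)
    qed
    have "n\<^sup>2 \<le> c * n + M + (c + n + sqrt T * M) * c"
      using n_eq hv Gv order_trans[OF \<kappa>b \<kappa>v] by linarith
    also have "\<dots> = (2 * c) * n + X"
      by (simp add: X_def algebra_simps)
    finally have "n \<le> Rv"
      unfolding Rv_def using c M(1) T0 by (intro quadratic_bound) (auto simp: X_def)
    then have "l2norm (leb T) v \<le> \<bar>c\<bar> + \<bar>Rv\<bar> + sqrt T * M \<and> l2norm (leb T) \<kappa> \<le> \<bar>c\<bar> + \<bar>Rv\<bar> + sqrt T * M"
      using \<kappa>_l2 M(1) T0 mult_nonneg_nonneg[OF real_sqrt_ge_zero[OF T0] M(1)] unfolding n_def by linarith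
    then show "l2norm (leb T) (weak_deriv T u) \<le> \<bar>c\<bar> + \<bar>Rv\<bar> + sqrt T * M
        \<and> l2norm (leb T) (penalty B l b u) \<le> \<bar>c\<bar> + \<bar>Rv\<bar> + sqrt T * M"
      by (simp add: v_def \<kappa>_def)
  qed
qed

end

section \<open>Convergence\<close>

text \<open>The curve \<open>u - x - K\<close> is tested with its derivative \<open>r\<close>. Subtracting \<open>K\<close> removes the difference of the
  forces, which converges only weakly, from the derivative; in exchange \<open>K\<close> is paired with \<open>r\<close>,
  which is harmless as \<open>K\<close> is uniformly small. The monotone parts leave the error
  between the two energies at \<open>x\<close>, and the constraint leaves the error between \<open>b\<close> and \<open>a\<close>, paired with the
  penalty \<open>\<kappa>\<close> and the multiplier \<open>\<eta>\<close>, and a term of order \<open>l\<close>. The function \<open>m\<close> dominates \<open>\<bar>\<eta>\<bar>\<close> by the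
  equation for \<open>x\<close>.\<close>

lemma solves_P_comparison:
  fixes E :: "'v::finite set set" and K :: "real \<Rightarrow> real ^ 'v"
  assumes graph: "weighted_hypergraph E w" and p: "1 < p" and T: "0 < T"
    and q: "1 < q" and l: "0 < l" and b: "b \<in> boundary_data T B" and a: "a \<in> boundary_data T B"
    and h': "h' \<in> L2 T" and h: "h \<in> L2 T"
    and sol': "solves_Pq E w B T p q l b h' x0' u" and sol: "solves_P E w B T p a h x0 x"
    and x_le: "\<And>t. t \<in> {0..T} \<Longrightarrow> norm (x t) \<le> R"
    and M: "\<And>z. norm z \<le> R + 1 \<Longrightarrow> energy E w p z \<le> M"
    and K: "primitive T K (\<lambda>t. h' t - h t)" and K0: "K 0 = 0"
    and \<delta>: "\<And>t. t \<in> {0..T} \<Longrightarrow> norm (b t - a t) \<le> \<delta>"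
    and \<sigma>: "\<And>t. t \<in> {0..T} \<Longrightarrow> norm (K t) \<le> \<sigma>"
    and s: "s \<in> {0..T}"
  defines "r \<equiv> \<lambda>t. weak_deriv T u t - weak_deriv T x t - (h' t - h t)"
    and "m \<equiv> \<lambda>t. norm (h t) + norm (weak_deriv T x t) + M"
  shows "(norm (u s - x s - K s))\<^sup>2 / 2 \<le> (norm (x0' - x0))\<^sup>2 / 2
    + T * (((real CARD('v))\<^sup>2 powr (p / q) - 1) * M) + l / 4 * (l2norm (leb T) m)\<^sup>2
    + sqrt T * (\<delta> * l2norm (leb T) (penalty B l b u) + \<delta> * l2norm (leb T) m + \<sigma> * l2norm (leb T) r)"
proof -
  define \<epsilon> where "\<epsilon> = ((real CARD('v))\<^sup>2 powr (p / q) - 1) * M"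
  define \<kappa> where "\<kappa> = penalty B l b u"
  define g where "g t = \<epsilon> + l / 4 * (m t)\<^sup>2 + \<delta> * norm (\<kappa> t) + \<delta> * m t + \<sigma> * norm (r t)" for t
  have uW: "u \<in> W12 T" "u 0 = x0'" and xW: "x \<in> W12 T" "x 0 = x0"
    and xK: "\<And>t. t \<in> {0..T} \<Longrightarrow> x t \<in> constraint_set B a t"
    using sol' sol by (auto simp: solves_Pq_def solves_P_def)
  note uP = W12_primitive[OF T uW(1)] and xP = W12_primitive[OF T xW(1)]
  note hL = h[unfolded L2_iff] h'[unfolded L2_iff]
  have yP: "primitive T (\<lambda>t. u t - x t - K t) r"
    unfolding r_def by (rule primitive_diff[OF primitive_diff[OF uP xP] K])
  have T0: "0 \<in> {0..T}" using T by simp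
  have pos: "0 \<le> \<delta>" "0 \<le> \<sigma>" "0 \<le> M" "0 \<le> \<epsilon>"
  proof -
    show "0 \<le> \<delta>" "0 \<le> \<sigma>"
      using order_trans[OF norm_ge_zero \<delta>[OF T0]] order_trans[OF norm_ge_zero \<sigma>[OF T0]] .
    show M0: "0 \<le> M"
      using order_trans[OF energy_nonneg[OF graph p, of "x 0"] M] x_le[OF T0] by simp
    have "1 \<le> (real CARD('v))\<^sup>2"
      by (simp add: Suc_le_eq)
    then have "1 \<le> (real CARD('v))\<^sup>2 powr (p / q)"
      using p q by (intro ge_one_powr_ge_zero) auto
    then show "0 \<le> \<epsilon>"
      using M0 by (simp add: \<epsilon>_def)
  qed
  have m0: "0 \<le> m t" for t
    using pos by (simp add: m_def)
  have mL: "sq_integrable (leb T) m"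
    unfolding m_def
    by (intro sq_integrable_add sq_integrable_norm sq_integrable_const finite_measure_leb hL primitive_sq_integrable[OF xP])
  have \<kappa>L: "sq_integrable (leb T) \<kappa>"
    unfolding \<kappa>_def by (rule penalty_sq_integrable[OF T uW(1) b])
  have rL: "sq_integrable (leb T) r"
    by (rule primitive_sq_integrable[OF yP])
  have ints: "integrable (leb T) (\<lambda>t. \<epsilon>)" "integrable (leb T) (\<lambda>t. l / 4 * (m t)\<^sup>2)"
    "integrable (leb T) (\<lambda>t. \<delta> * norm (\<kappa> t))" "integrable (leb T) (\<lambda>t. \<delta> * m t)" "integrable (leb T) (\<lambda>t. \<sigma> * norm (r t))"
    using mL sq_integrable_imp_integrable[OF mL] sq_integrable_imp_integrable[OF \<kappa>L] sq_integrable_imp_integrable[OF rL]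
      finite_measure.integrable_const[OF finite_measure_leb]
    by (auto simp: sq_integrable_def)
  note add = Bochner_Integration.integrable_add
  note ints2 = add[OF ints(1,2)] add[OF add[OF ints(1,2)] ints(3)] add[OF add[OF add[OF ints(1,2)] ints(3)] ints(4)]
    add[OF add[OF add[OF add[OF ints(1,2)] ints(3)] ints(4)] ints(5)]
  have gi: "integrable (leb T) g"
    unfolding g_def[abs_def] by (rule ints2(4))
  have g0: "0 \<le> g t" for t
    using pos m0 l by (simp add: g_def)
  have sol_ae: "AE t in leb T. \<exists>\<xi>\<in>subdifferential (\<lambda>y. ereal (energy E w p y)) (x t).
        \<exists>\<eta>\<in>subdifferential (convex_indicator (constraint_set B a t)) (x t). weak_deriv T x t + \<xi> + \<eta> = h t"
    using sol by (simp add: solves_P_def)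
  have le: "AE t in leb T. (u t - x t - K t) \<bullet> r t \<le> g t"
    using AE_leb_interior[OF sol_ae] solves_Pq_subgradient[OF graph p T q sol']
  proof eventually_elim
    case (elim t)
    then have t: "t \<in> {0..T}" by auto
    obtain \<xi> \<eta> where \<xi>: "\<xi> \<in> subdifferential (\<lambda>y. ereal (energy E w p y)) (x t)"
      and \<eta>: "\<eta> \<in> subdifferential (convex_indicator (constraint_set B a t)) (x t)"
      and eq: "weak_deriv T x t + \<xi> + \<eta> = h t"
      using elim by blast
    define G where "G = h' t - weak_deriv T u t - \<kappa> t"
    have \<xi>_sub: "energy E w p (x t) + \<xi> \<bullet> (z - x t) \<le> energy E w p z" for z
      using \<xi> unfolding subdifferential_real by blast
    have G_sub: "energy_q E w p q (u t) + G \<bullet> (x t - u t) \<le> energy_q E w p q (x t)"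
      using elim unfolding G_def \<kappa>_def by blast
    have \<xi>_le: "norm \<xi> \<le> M"
      by (rule subgradient_norm_le[OF \<xi>_sub energy_nonneg[OF graph p] x_le[OF t] M])
    have "\<eta> = h t - weak_deriv T x t - \<xi>"
      using eq by (metis add_diff_cancel_left' diff_diff_add)
    then have "norm \<eta> \<le> norm (h t) + norm (weak_deriv T x t) + norm \<xi>"
      by (simp add: order_trans[OF norm_triangle_ineq4 add_right_mono[OF norm_triangle_ineq4]])
    then have \<eta>_le: "norm \<eta> \<le> m t"
      using \<xi>_le by (simp add: m_def)
    have r_eq: "r t = (\<xi> - G) + (\<eta> - \<kappa> t)"
      unfolding r_def G_def eq[symmetric] by (simp add: algebra_simps)
    \<comment> \<open>The energies are compared at \<open>x\<close> only: at \<open>u\<close> the difference has a favourable sign.\<close>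
    have energies: "(u t - x t) \<bullet> (\<xi> - G) \<le> \<epsilon>"
    proof -
      have "(u t - x t) \<bullet> (\<xi> - G) = \<xi> \<bullet> (u t - x t) + G \<bullet> (x t - u t)"
        by (simp add: algebra_simps inner_commute)
      also have "\<dots> \<le> (energy E w p (u t) - energy_q E w p q (u t)) + (energy_q E w p q (x t) - energy E w p (x t))"
        using \<xi>_sub[of "u t"] G_sub by linarith
      also have "\<dots> \<le> energy_q E w p q (x t) - energy E w p (x t)"
        using energy_le_energy_q[OF graph p, of q "u t"] q by simp
      also have "\<dots> \<le> ((real CARD('v))\<^sup>2 powr (p / q) - 1) * energy E w p (x t)"
        using energy_q_le_energy[OF graph p, of q "x t"] q by (simp add: algebra_simps)
      also have "\<dots> \<le> \<epsilon>"
      proof -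
        have "0 \<le> (real CARD('v))\<^sup>2 powr (p / q) - 1"
          using p q by (simp add: ge_one_powr_ge_zero Suc_le_eq)
        then show ?thesis
          unfolding \<epsilon>_def using M[of "x t"] x_le[OF t] by (intro mult_left_mono) auto
      qed
      finally show ?thesis .
    qed
    \<comment> \<open>Completing the square absorbs \<open>\<eta> \<bullet> (l \<kappa>)\<close> into the dissipation \<open>l \<bar>\<kappa>\<bar>\<^sup>2\<close> of the penalty.\<close>
    have penalties: "(u t - x t) \<bullet> (\<eta> - \<kappa> t) \<le> l / 4 * (m t)\<^sup>2 + \<delta> * norm (\<kappa> t) + \<delta> * m t"
    proof -
      define d where "d = b t - a t"
      have d_le: "norm d \<le> \<delta>"
        unfolding d_def by (rule \<delta>[OF t])
      have \<eta>B: "boundary_part B \<eta> = \<eta>"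
        by (rule subdifferential_indicator_constraint_set[OF xK[OF t] \<eta>])
      have \<kappa>B: "boundary_part B (\<kappa> t) = \<kappa> t"
      proof -
        have "\<kappa> t = (1 / l) *\<^sub>R boundary_part B (u t - b t)"
          unfolding \<kappa>_def penalty_def boundary_part_diff boundary_part_boundary_data[OF b t] ..
        then show ?thesis
          by (simp add: vec_eq_iff boundary_part_nth)
      qed
      have "boundary_part B (u t - x t) = l *\<^sub>R \<kappa> t + d"
        unfolding boundary_part_diff boundary_part_constraint_set[OF a t xK[OF t]] d_def
        using l by (simp add: \<kappa>_def penalty_def)
      moreover have "(u t - x t) \<bullet> (\<eta> - \<kappa> t) = boundary_part B (u t - x t) \<bullet> (\<eta> - \<kappa> t)"
        using inner_boundary_part[of B "\<eta> - \<kappa> t" "u t - x t"]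
        by (simp add: boundary_part_diff \<eta>B \<kappa>B inner_commute)
      ultimately have "(u t - x t) \<bullet> (\<eta> - \<kappa> t) = l * (\<kappa> t \<bullet> \<eta>) - l * (\<kappa> t \<bullet> \<kappa> t) + d \<bullet> \<eta> - d \<bullet> \<kappa> t"
        by (simp add: inner_add_left inner_diff_right right_diff_distrib)
      moreover have "l * (\<kappa> t \<bullet> \<eta>) - l * (\<kappa> t \<bullet> \<kappa> t) \<le> l / 4 * (m t)\<^sup>2"
      proof -
        have "0 \<le> (\<eta> - 2 *\<^sub>R \<kappa> t) \<bullet> (\<eta> - 2 *\<^sub>R \<kappa> t)"
          by (rule inner_ge_zero)
        also have "\<dots> = \<eta> \<bullet> \<eta> - 4 * (\<kappa> t \<bullet> \<eta>) + 4 * (\<kappa> t \<bullet> \<kappa> t)"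
          by (simp add: algebra_simps inner_commute)
        also have "\<eta> \<bullet> \<eta> \<le> (m t)\<^sup>2"
          using \<eta>_le by (simp add: dot_square_norm power_mono)
        finally have "\<kappa> t \<bullet> \<eta> - \<kappa> t \<bullet> \<kappa> t \<le> (m t)\<^sup>2 / 4"
          by simp
        then have "l * (\<kappa> t \<bullet> \<eta> - \<kappa> t \<bullet> \<kappa> t) \<le> l * ((m t)\<^sup>2 / 4)"
          using l by (intro mult_left_mono) auto
        then show ?thesis
          by (simp add: right_diff_distrib)
      qed
      moreover have "d \<bullet> \<eta> \<le> \<delta> * m t"
        using d_le \<eta>_le pos by (intro order_trans[OF norm_cauchy_schwarz] mult_mono) auto
      moreover have "- (d \<bullet> \<kappa> t) \<le> \<delta> * norm (\<kappa> t)"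
        using order_trans[OF norm_cauchy_schwarz[of "- d" "\<kappa> t"] mult_right_mono[OF _ norm_ge_zero, of "norm (- d)" \<delta>]] d_le
        by simp
      ultimately show ?thesis by linarith
    qed
    have "- (K t \<bullet> r t) \<le> \<sigma> * norm (r t)"
      using order_trans[OF norm_cauchy_schwarz[of "- K t" "r t"] mult_right_mono[OF _ norm_ge_zero, of "norm (- K t)" \<sigma>]] \<sigma>[OF t]
      by simp
    moreover have "(u t - x t - K t) \<bullet> r t = (u t - x t) \<bullet> (\<xi> - G) + (u t - x t) \<bullet> (\<eta> - \<kappa> t) - K t \<bullet> r t"
      unfolding inner_diff_left[of "u t - x t"] by (simp add: r_eq inner_add_right)
    ultimately show ?case
      using energies penalties by (simp add: g_def)
  qed
  have "(norm (u s - x s - K s))\<^sup>2 / 2 \<le> (norm (u 0 - x 0 - K 0))\<^sup>2 / 2 + (\<integral>t. g t \<partial>leb T)"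
    using g0 by (intro half_norm_squared_estimate[OF yP gi _ le s]) simp
  also have "(\<integral>t. g t \<partial>leb T) = T * \<epsilon> + l / 4 * (l2norm (leb T) m)\<^sup>2 + \<delta> * (\<integral>t. norm (\<kappa> t) \<partial>leb T)
      + \<delta> * (\<integral>t. norm (m t) \<partial>leb T) + \<sigma> * (\<integral>t. norm (r t) \<partial>leb T)"
  proof -
    have "(\<integral>t. \<epsilon> \<partial>leb T) = T * \<epsilon>"
      by (rule integral_const_leb[OF less_imp_le[OF T]])
    moreover have "(\<integral>t. l / 4 * (m t)\<^sup>2 \<partial>leb T) = l / 4 * (l2norm (leb T) m)\<^sup>2"
      by (simp add: l2norm_power2)
    moreover have "(\<integral>t. m t \<partial>leb T) = (\<integral>t. norm (m t) \<partial>leb T)"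
      using m0 by simp
    ultimately show ?thesis
      unfolding g_def Bochner_Integration.integral_add[OF ints2(3) ints(5)] Bochner_Integration.integral_add[OF ints2(2) ints(4)]
        Bochner_Integration.integral_add[OF ints2(1) ints(3)] Bochner_Integration.integral_add[OF ints(1,2)]
      by (simp only: integral_mult_right_zero)
  qed
  also have "\<dots> \<le> T * \<epsilon> + l / 4 * (l2norm (leb T) m)\<^sup>2 + \<delta> * (sqrt T * l2norm (leb T) \<kappa>)
      + \<delta> * (sqrt T * l2norm (leb T) m) + \<sigma> * (sqrt T * l2norm (leb T) r)"
    by (intro add_mono mult_left_mono order_refl integral_norm_leb_le less_imp_le[OF T] \<kappa>L mL rL pos)
  finally show ?thesis
    unfolding \<epsilon>_def \<kappa>_def using uW(2) xW(2) K0 by (simp add: algebra_simps)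
qed

theorem theorem1:
  fixes E :: "'v::finite set set" and w :: "'v set \<Rightarrow> real" and B :: "'v set"
    and T p :: real and q l :: "nat \<Rightarrow> real"
    and as hs xs :: "nat \<Rightarrow> real \<Rightarrow> real ^ 'v" and a h x :: "real \<Rightarrow> real ^ 'v"
    and x0s :: "nat \<Rightarrow> real ^ 'v" and x0 :: "real ^ 'v"
  assumes "weighted_hypergraph E w"
    and "0 < T" and "1 < p"
    and "\<And>i. 1 < q i" and "\<And>i. 0 < l i"
    and "filterlim q at_top sequentially" and "l \<longlonglongrightarrow> 0"
    and "\<And>i. as i \<in> boundary_data T B" and "a \<in> boundary_data T B"
    and "\<And>i. hs i \<in> L2 T" and "h \<in> L2 T"
    and "weakly_W12 T as a" and "uniform_limit {0..T} as a sequentially"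
    and "weakly_L2 T hs h"
    and "x0s \<longlonglongrightarrow> x0"
    and "\<And>i. x0s i \<in> constraint_set B (as i) 0" and "x0 \<in> constraint_set B a 0"
    and "\<And>i. solves_Pq E w B T p (q i) (l i) (as i) (hs i) (x0s i) (xs i)"
    and "solves_P E w B T p a h x0 x"
  shows "weakly_W12 T xs x \<and> uniform_limit {0..T} xs x sequentially"
proof -
  note graph = assms(1) and T = assms(2) and p = assms(3) and q = assms(4) and l = assms(5)
    and as = assms(8) and a = assms(9) and hs = assms(10) and h = assms(11)
    and sol_q = assms(18) and sol = assms(19)
  note hsL = hs[unfolded L2_iff] and hL = h[unfolded L2_iff]
  have xsW: "xs i \<in> W12 T" and xW: "x \<in> W12 T" for i
    using sol_q sol by (auto simp: solves_Pq_def solves_P_def)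
  note xsP = W12_primitive[OF T xsW] and xP = W12_primitive[OF T xW]
  note x'L = primitive_sq_integrable[OF xP]
  note asP = W12_primitive[OF T boundary_data_W12[OF as]] and aP = W12_primitive[OF T boundary_data_W12[OF a]]

  \<comment> \<open>Bounds on the data that are uniform in the index.\<close>
  obtain Ch where Ch: "\<And>i. l2norm (leb T) (hs i) \<le> Ch"
    using weakly_L2_bounded[OF assms(14)] by blast
  obtain Ca where Ca: "\<And>i. l2norm (leb T) (weak_deriv T (as i)) \<le> Ca"
    using weakly_W12_derivatives_bounded[OF T assms(12,13)] by blast
  obtain \<delta> where \<delta>: "\<delta> \<longlonglongrightarrow> 0" "\<And>i t. t \<in> {0..T} \<Longrightarrow> norm (as i t - a t) \<le> \<delta> i"
    using uniform_limit_bound_sequence[OF less_imp_le[OF T] assms(13) primitive_continuous[OF asP] primitive_continuous[OF aP]]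
    by blast
  obtain D where D: "\<And>i. \<delta> i \<le> D"
    using convergent_imp_bounded[OF \<delta>(1)] by (auto simp: bounded_iff abs_le_iff)
  obtain Cx where Cx: "\<And>i. norm (x0s i) \<le> Cx"
    using convergent_imp_bounded[OF assms(15)] by (auto simp: bounded_iff)
  have cont_bound: "\<exists>C. \<forall>t\<in>{0..T}. norm (f t) \<le> C" if "continuous_on {0..T} f" for f :: "real \<Rightarrow> real ^ 'v"
    using compact_imp_bounded[OF compact_continuous_image[OF that compact_Icc]] unfolding bounded_iff by blast
  obtain A where A: "\<And>t. t \<in> {0..T} \<Longrightarrow> norm (a t) \<le> A"
    using cont_bound[OF primitive_continuous[OF aP]] by blast
  obtain R where R: "\<And>t. t \<in> {0..T} \<Longrightarrow> norm (x t) \<le> R"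
    using cont_bound[OF primitive_continuous[OF xP]] by blast
  define c where "c = \<bar>Ch\<bar> + \<bar>Ca\<bar> + \<bar>Cx\<bar> + (\<bar>A\<bar> + \<bar>D\<bar>)"
  have as_le: "norm (as i t) \<le> c" if t: "t \<in> {0..T}" for i t
  proof -
    have "norm (as i t) \<le> norm (a t) + norm (as i t - a t)"
      by (rule norm_triangle_sub)
    then show ?thesis
      using \<delta>(2)[OF t, of i] D[of i] A[OF t] unfolding c_def by linarith
  qed
  have data_le: "norm (x0s i) \<le> c" "l2norm (leb T) (weak_deriv T (as i)) \<le> c" "l2norm (leb T) (hs i) \<le> c" for i
    using Ch[of i] Ca[of i] Cx[of i] unfolding c_def by linarith+
  obtain C where C: "0 \<le> C" "\<And>i. l2norm (leb T) (weak_deriv T (xs i)) \<le> C"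
    "\<And>i. l2norm (leb T) (penalty B (l i) (as i) (xs i)) \<le> C"
  proof -
    have "Pq_solution_le c E w B T p (q i) (l i) (as i) (hs i) (xs i)" for i
      using q l as hs sol_q[of i] assms(16)[of i] data_le[of i] as_le by (auto simp: Pq_solution_le_def solves_Pq_def)
    then show ?thesis
      using solves_Pq_derivative_bound[OF graph p T, of c B] that by metis
  qed
  obtain M where M: "0 \<le> M" "\<And>z. norm z \<le> R + 1 \<Longrightarrow> energy E w p z \<le> M"
    using energy_bounded_on_balls[OF graph p, of "R + 1"] by metis

  \<comment> \<open>The primitives of \<open>hs i - h\<close> turn weak into uniform convergence.\<close>
  define k where "k i t = hs i t - h t" for i t
  define K where "K i t = 0 + (\<integral>\<tau>. k i \<tau> \<partial>leb t)" for i t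
  have kL: "sq_integrable (leb T) (k i)" for i
    unfolding k_def[abs_def] by (rule sq_integrable_diff[OF hsL hL])
  have KP: "primitive T (K i) (k i)" for i
    unfolding K_def[abs_def] by (rule primitive_indefinite_integral[OF kL])
  have K0: "K i 0 = 0" for i
    by (simp add: K_def)
  have k_le: "l2norm (leb T) (k i) \<le> Ch + l2norm (leb T) h" for i
    using l2norm_triangle_diff[OF hsL hL, of i] Ch[of i] by (simp add: k_def[abs_def])
  have K_lim: "uniform_limit {0..T} K (\<lambda>t. 0) sequentially"
  proof (rule weakly_null_primitives_uniform[OF T KP K0 k_le])
    fix z :: "real \<Rightarrow> real ^ 'v" assume z: "sq_integrable (leb T) z"
    then have "(\<lambda>i. inner_L2 T (hs i) z - inner_L2 T h z) \<longlonglongrightarrow> inner_L2 T h z - inner_L2 T h z"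
      using assms(14) by (intro tendsto_diff tendsto_const) (auto simp: weakly_L2_def L2_iff)
    moreover have "inner_L2 T (hs i) z - inner_L2 T h z = (\<integral>t. k i t \<bullet> z t \<partial>leb T)" for i
      unfolding inner_L2_def k_def inner_diff_left
      by (rule Bochner_Integration.integral_diff[symmetric]) (intro sq_integrable_inner hsL hL z)+
    ultimately show "(\<lambda>i. \<integral>t. k i t \<bullet> z t \<partial>leb T) \<longlonglongrightarrow> 0"
      by simp
  qed
  obtain \<sigma> where \<sigma>: "\<sigma> \<longlonglongrightarrow> 0" "\<And>i t. t \<in> {0..T} \<Longrightarrow> norm (K i t - 0) \<le> \<sigma> i"
    using uniform_limit_bound_sequence[OF less_imp_le[OF T] K_lim primitive_continuous[OF KP] continuous_on_const] by blast

  define m where "m t = norm (h t) + norm (weak_deriv T x t) + M" for t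
  define r where "r i t = weak_deriv T (xs i) t - weak_deriv T x t - (hs i t - h t)" for i t
  define Q where "Q = C + l2norm (leb T) (weak_deriv T x) + (Ch + l2norm (leb T) h)"
  have r_le: "l2norm (leb T) (r i) \<le> Q" for i
  proof -
    have "l2norm (leb T) (r i) \<le> l2norm (leb T) (\<lambda>t. weak_deriv T (xs i) t - weak_deriv T x t) + l2norm (leb T) (k i)"
      unfolding r_def[abs_def] k_def[abs_def]
      by (rule l2norm_triangle_diff[OF sq_integrable_diff[OF primitive_sq_integrable[OF xsP] x'L] sq_integrable_diff[OF hsL hL]])
    also have "\<dots> \<le> (l2norm (leb T) (weak_deriv T (xs i)) + l2norm (leb T) (weak_deriv T x)) + l2norm (leb T) (k i)"
      by (rule add_right_mono[OF l2norm_triangle_diff[OF primitive_sq_integrable[OF xsP] x'L]])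
    finally show ?thesis
      using C(2)[of i] k_le[of i] unfolding Q_def by linarith
  qed
  have \<delta>0: "0 \<le> \<delta> i" and \<sigma>0: "0 \<le> \<sigma> i" for i
    using order_trans[OF norm_ge_zero \<delta>(2)[of 0 i]] order_trans[OF norm_ge_zero \<sigma>(2)[of 0 i]] T by auto
  define \<beta> where "\<beta> i = (norm (x0s i - x0))\<^sup>2 / 2 + T * (((real CARD('v))\<^sup>2 powr (p / q i) - 1) * M)
    + l i / 4 * (l2norm (leb T) m)\<^sup>2
    + sqrt T * (\<delta> i * C + \<delta> i * l2norm (leb T) m + \<sigma> i * Q)" for i
  have est: "(norm (xs i t - x t - K i t))\<^sup>2 / 2 \<le> \<beta> i" if t: "t \<in> {0..T}" for i t
  proof -
    have KP': "primitive T (K i) (\<lambda>t. hs i t - h t)"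
      using KP[of i] by (simp add: k_def[abs_def])
    have \<sigma>': "norm (K i t) \<le> \<sigma> i" if "t \<in> {0..T}" for t
      using \<sigma>(2)[OF that, of i] by simp
    have "(norm (xs i t - x t - K i t))\<^sup>2 / 2 \<le> (norm (x0s i - x0))\<^sup>2 / 2
        + T * (((real CARD('v))\<^sup>2 powr (p / q i) - 1) * M) + l i / 4 * (l2norm (leb T) m)\<^sup>2
        + sqrt T * (\<delta> i * l2norm (leb T) (penalty B (l i) (as i) (xs i)) + \<delta> i * l2norm (leb T) m + \<sigma> i * l2norm (leb T) (r i))"
      unfolding m_def[abs_def] r_def[abs_def]
      by (rule solves_P_comparison[OF graph p T q l as a hs h sol_q sol R M(2) KP' K0 \<delta>(2) \<sigma>' t])
    also have "\<dots> \<le> \<beta> i"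
      unfolding \<beta>_def using C(3)[of i] r_le[of i] \<delta>0[of i] \<sigma>0[of i] T
      by (intro add_mono mult_left_mono order_refl) auto
    finally show ?thesis .
  qed
  have \<beta>_lim: "\<beta> \<longlonglongrightarrow> 0"
  proof -
    have N: "(real CARD('v))\<^sup>2 > 0"
      by simp
    have "(\<lambda>i. p / q i) \<longlonglongrightarrow> 0"
      by (rule real_tendsto_divide_at_top[OF tendsto_const assms(6)])
    then have "(\<lambda>i. (real CARD('v))\<^sup>2 powr (p / q i)) \<longlonglongrightarrow> (real CARD('v))\<^sup>2 powr 0"
      using N by (intro tendsto_powr tendsto_const) auto
    then have pw: "(\<lambda>i. (real CARD('v))\<^sup>2 powr (p / q i)) \<longlonglongrightarrow> 1"
      by simp
    have "\<beta> \<longlonglongrightarrow> (norm (x0 - x0))\<^sup>2 / 2 + T * ((1 - 1) * M) + 0 / 4 * (l2norm (leb T) m)\<^sup>2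
        + sqrt T * (0 * C + 0 * l2norm (leb T) m + 0 * Q)"
      unfolding \<beta>_def[abs_def]
      by (intro tendsto_intros assms(15) pw assms(7) \<delta>(1) \<sigma>(1)) simp_all
    then show ?thesis by simp
  qed
  have unif: "uniform_limit {0..T} xs x sequentially"
  proof (rule uniform_limitI)
    fix e :: real assume "0 < e"
    have "(\<lambda>i. sqrt (2 * \<beta> i) + \<sigma> i) \<longlonglongrightarrow> sqrt (2 * 0) + 0"
      by (intro tendsto_intros \<beta>_lim \<sigma>(1))
    then have "\<forall>\<^sub>F i in sequentially. sqrt (2 * \<beta> i) + \<sigma> i < e"
      by (rule order_tendstoD) (use \<open>0 < e\<close> in simp)
    then show "\<forall>\<^sub>F i in sequentially. \<forall>t\<in>{0..T}. dist (xs i t) (x t) < e"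
    proof eventually_elim
      case (elim i)
      show ?case
      proof
        fix t assume t: "t \<in> {0..T}"
        have "norm (xs i t - x t - K i t) \<le> sqrt (2 * \<beta> i)"
          using est[OF t, of i] by (intro real_le_rsqrt) simp
        moreover have "norm (xs i t - x t) \<le> norm (xs i t - x t - K i t) + norm (K i t)"
          using norm_triangle_ineq[of "xs i t - x t - K i t" "K i t"] by simp
        ultimately show "dist (xs i t) (x t) < e"
          using \<sigma>(2)[OF t, of i] elim by (simp add: dist_norm)
      qed
    qed
  qed
  then show ?thesis
    using weakly_W12_I[OF T xsW xW C(2) unif] by simp
qed

end
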